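(* Let $\alpha>-1$, $\gamma>-1$, $\beta>0$, $\delta>0$ and $u>0$. Then $$G^{2,1}_{2,2}\left[u\,\Big|\,{-\delta,\ \alpha+\beta\atop \alpha,\ \gamma}\right]=\frac{\Gamma(\gamma+1+\delta)}{\Gamma(\beta)}u^{\alpha}\int_{u}^{\infty}v^{\gamma-\alpha-\beta}(v-u)^{\beta-1}(1+v)^{-(\gamma+1+\delta)}\,dv$$ $$=\frac{\Gamma(\gamma+1+\delta)}{\Gamma(\beta)}u^{\gamma}\int_{0}^1v^{\alpha+\delta}(1-v)^{\beta-1}(v+u)^{-(\gamma+1+\delta)}\,dv .$$ If $0<u<1$ and $\alpha-\gamma\ne\pm\nu$ for all $\nu=0,1,\dots$, these also equal $$\frac{\Gamma(\gamma-\alpha)\Gamma(1+\delta+\alpha)}{\Gamma(\beta)}u^{\alpha}\,{}_2F_1(1+\delta+\alpha,1-\beta;1+\alpha-\gamma;-u)$$ $$+\frac{\Gamma(\alpha-\gamma)\Gamma(1+\delta+\gamma)}{\Gamma(\alpha+\beta-\gamma)}u^{\gamma}\,{}_2F_1(1+\delta+\gamma,1+\gamma-\alpha-\beta;1+\gamma-\alpha;-u),$$ and if $1\le u<\infty$ they equal $$\frac{\Gamma(\alpha+1+\delta)\Gamma(\gamma+1+\delta)}{\Gamma(\alpha+\beta+1+\delta)}u^{-1-\delta}\,{}_2F_1\left(\alpha+1+\delta,\gamma+1+\delta;\alpha+\beta+1+\delta;-\tfrac{1}{u}\right).$$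
   Context: Meijer G-function: for $z>0$, $$G^{m,n}_{p,q}\left[z\,\Big|\,{a_1,\dots,a_p\atop b_1,\dots,b_q}\right]=\frac1{2\pi i}\int_{\kappa-i\infty}^{\kappa+i\infty}\frac{\prod_{j=1}^m\Gamma(b_j+s)\prod_{j=1}^n\Gamma(1-a_j-s)}{\prod_{j=m+1}^q\Gamma(1-b_j-s)\prod_{j=n+1}^p\Gamma(a_j+s)}\,z^{-s}\,ds,$$ where the real number $\kappa$ is such that all poles of $\Gamma(b_j+s)$, $j\le m$, lie to the left and all poles of $\Gamma(1-a_j-s)$, $j\le n$, lie to the right of the line $\Re s=\kappa$ (such $\kappa$ exists under the stated hypotheses). In the present case the integrand is $\frac{\Gamma(\alpha+s)\Gamma(\gamma+s)\Gamma(1+\delta-s)}{\Gamma(\alpha+\beta+s)}u^{-s}$. ${}_2F_1$ is the Gauss hypergeometric function (the power series inside the unit disc, and its analytic continuation to $\mathbb{C}\setminus[1,\infty)$, which is used at argument $-1$), and $1/\Gamma$ is taken to be $0$ at the poles of $\Gamma$. *)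

theory Defs
  imports "HOL-Complex_Analysis.Complex_Analysis"
begin

(* I is the improper integral of f along the upward line Re s = kappa, the two ends of the line
   being approached independently of each other. *)
definition has_vertical_integral :: "(complex \<Rightarrow> complex) \<Rightarrow> complex \<Rightarrow> real \<Rightarrow> bool" where
  "has_vertical_integral f I \<kappa> \<longleftrightarrow>
     ((\<lambda>(a, b). contour_integral (linepath (Complex \<kappa> a) (Complex \<kappa> b)) f) \<longlongrightarrow> I)
       (at_bot \<times>\<^sub>F at_top)"

(* The lists as and bs hold the p upper and the q lower parameters. Reciprocals of Gamma values are
   written with the entire function rGamma, which vanishes at the poles of Gamma. *)
definition meijer_integrand ::
    "nat \<Rightarrow> nat \<Rightarrow> complex list \<Rightarrow> complex list \<Rightarrow> real \<Rightarrow> complex \<Rightarrow> complex" where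
  "meijer_integrand m n as bs z s =
     (\<Prod>b\<leftarrow>take m bs. Gamma (b + s)) * (\<Prod>a\<leftarrow>take n as. Gamma (1 - a - s)) *
     (\<Prod>b\<leftarrow>drop m bs. rGamma (1 - b - s)) * (\<Prod>a\<leftarrow>drop n as. rGamma (a + s)) *
     of_real z powr (- s)"

definition separates_poles ::
    "nat \<Rightarrow> nat \<Rightarrow> complex list \<Rightarrow> complex list \<Rightarrow> real \<Rightarrow> bool" where
  "separates_poles m n as bs \<kappa> \<longleftrightarrow>
     (\<forall>b\<in>set (take m bs). \<forall>s. is_pole (\<lambda>s. Gamma (b + s)) s \<longrightarrow> Re s < \<kappa>) \<and>
     (\<forall>a\<in>set (take n as). \<forall>s. is_pole (\<lambda>s. Gamma (1 - a - s)) s \<longrightarrow> \<kappa> < Re s)"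

(* The value must be obtained on every separating line. If there is no such line, or if the
   integrals fail to converge to a common value, the description is not satisfied by a unique w
   and the result is unspecified. *)
definition meijer_G ::
    "nat \<Rightarrow> nat \<Rightarrow> complex list \<Rightarrow> complex list \<Rightarrow> real \<Rightarrow> complex" where
  "meijer_G m n as bs z =
     (THE w. \<forall>\<kappa>. separates_poles m n as bs \<kappa> \<longrightarrow>
        has_vertical_integral (meijer_integrand m n as bs z) (2 * of_real pi * \<i> * w) \<kappa>)"

definition hyp2F1_slit_plane :: "complex set" where
  "hyp2F1_slit_plane = - (of_real ` {1..})"

definition hyp2F1_series :: "complex \<Rightarrow> complex \<Rightarrow> complex \<Rightarrow> complex \<Rightarrow> complex" where
  "hyp2F1_series a b c z = eval_fps (fps_hypergeo [a, b] [c] 1) z"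

(* Outside the unit disc this is the value of the analytic continuation of the series to the plane
   cut along [1, infinity); the lemma hyp2F1_eq_continuation below shows that any such continuation
   determines the value. *)
definition hyp2F1 :: "complex \<Rightarrow> complex \<Rightarrow> complex \<Rightarrow> complex \<Rightarrow> complex" where
  "hyp2F1 a b c z =
     (if norm z < 1 then hyp2F1_series a b c z
      else (THE w. \<exists>F. F holomorphic_on hyp2F1_slit_plane \<and>
                      (\<forall>x\<in>ball 0 1. F x = hyp2F1_series a b c x) \<and> w = F z))"

lemma hyp2F1_series_altdef:
  "hyp2F1_series a b c z =
     (\<Sum>n. pochhammer a n * pochhammer b n / (pochhammer c n * fact n) * z ^ n)"
  by (simp add: hyp2F1_series_def eval_fps_def)

lemma open_hyp2F1_slit_plane: "open hyp2F1_slit_plane"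
proof -
  have "complex_of_real ` {1..} = {z. Im z = 0} \<inter> {z. Re z \<ge> 1}"
    by (auto simp: image_iff complex_eq_iff)
  moreover have "closed ({z. Im z = 0} \<inter> {z. Re z \<ge> 1})"
    by (intro closed_Int closed_Collect_eq closed_Collect_le continuous_intros)
  ultimately show ?thesis
    unfolding hyp2F1_slit_plane_def by (metis open_Compl)
qed

lemma connected_hyp2F1_slit_plane: "connected hyp2F1_slit_plane"
  unfolding hyp2F1_slit_plane_def
  by (intro starlike_imp_connected starlike_slotted_complex_plane_right)

lemma ball_subset_hyp2F1_slit_plane: "ball 0 1 \<subseteq> hyp2F1_slit_plane"
  by (auto simp: hyp2F1_slit_plane_def)

lemma hyp2F1_eq_continuation:
  assumes "F holomorphic_on hyp2F1_slit_plane"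
    and "\<And>x. x \<in> ball 0 1 \<Longrightarrow> F x = hyp2F1_series a b c x"
    and "z \<in> hyp2F1_slit_plane"
  shows "hyp2F1 a b c z = F z"
proof (cases "norm z < 1")
  case True
  then show ?thesis
    using assms(2)[of z] by (simp add: hyp2F1_def)
next
  case False
  have unique: "G z = F z"
    if "G holomorphic_on hyp2F1_slit_plane" and "\<forall>x\<in>ball 0 1. G x = hyp2F1_series a b c x" for G
    by (rule analytic_continuation_open[of "ball 0 1" hyp2F1_slit_plane])
       (use that assms open_hyp2F1_slit_plane connected_hyp2F1_slit_plane
          ball_subset_hyp2F1_slit_plane in auto)
  have "(THE w. \<exists>F. F holomorphic_on hyp2F1_slit_plane \<and>
           (\<forall>x\<in>ball 0 1. F x = hyp2F1_series a b c x) \<and> w = F z) = F z"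
    by (rule the_equality) (use assms unique in blast)+
  with False show ?thesis
    by (simp add: hyp2F1_def)
qed

end

theory Submission
  imports Defs "HOL-Probability.Characteristic_Functions" "HOL-Probability.Sinc_Integral"
begin

text \<open>
  Write \<open>c = \<gamma> + 1 + \<delta>\<close> and \<open>B\<close> for the Beta function. On a separating line \<open>Re s = \<kappa>\<close> the integrand of
  the G-function is the product of \<open>\<Gamma>(c) / \<Gamma>(\<beta>)\<close>, \<open>B(\<alpha> + s, \<beta>)\<close>, \<open>B(\<gamma> + s, 1 + \<delta> - s)\<close> and
  \<open>u powr (- s)\<close>.

  The arguments of the second Beta function have the constant sum \<open>c\<close>. In a logarithmic variable Euler's
  integral therefore exhibits it, as a function of \<open>Im s\<close>, as the Fourier transform of
  \<open>exp (a * y) * (1 + exp y) powr (- c)\<close> with \<open>a = \<gamma> + \<kappa>\<close>. It is a bounded function divided by a quadratic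
  polynomial in \<open>s\<close> (\<open>Beta_plus1_plus1_mult\<close>), hence integrable along the line, and Fourier inversion applies
  (\<open>fourier_inversion_Beta\<close>). The first Beta function is an integral of exponentials in \<open>s\<close>. Exchanging the two
  integrations (\<open>Beta_Beta_vertical_integral\<close>) turns the line integral into an absolutely convergent real
  integral, from which \<open>\<kappa>\<close> disappears. Thus the G-function exists and equals that integral
  (\<open>meijer_G_line_integral\<close>), and two substitutions give the two real integrals of the theorem
  (\<open>meijer_G_integrals\<close>).

  The rest concerns the integral of \<open>v powr (p - 1) * (1 - v) powr (\<beta> - 1) * (v + u) powr (- c)\<close> over the unit
  interval, where \<open>p = \<alpha> + 1 + \<delta>\<close>. Pulling out a power of \<open>u\<close> gives Euler's integral for the hypergeometric
  function at \<open>- 1 / u\<close>. That integral is holomorphic on the whole slit plane, so it is the analytic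
  continuation and covers the boundary value \<open>u = 1\<close> (\<open>hyp2F1_euler_integral\<close>, \<open>Beta_integral_hyp2F1\<close>).

  For \<open>u < 1\<close> the power of \<open>1 - v\<close> is expanded in powers of \<open>v\<close>, and each resulting integral is a Gamma
  quotient times a power of \<open>u\<close> plus a series of partial fractions (\<open>powr_shifted_integral\<close>). The Gamma
  quotients add up to the first hypergeometric series. In the double series formed by the partial fractions the
  order of summation may be exchanged, and the inner sums are then values of the Beta function
  (\<open>Beta_partial_fractions\<close>); they produce the second hypergeometric series
  (\<open>Beta_integral_connection\<close>). Both evaluations start in a range of parameters where they are integrals and
  reach all parameters through a contiguity relation, so no contour has to be moved.
\<close>

section \<open>Fourier inversion\<close>

lemma integral_iexp_gaussian:
  fixes s \<sigma> :: real
  assumes "\<sigma> > 0"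
  shows "integrable lborel (\<lambda>t. of_real (exp (- (\<sigma> * t)\<^sup>2 / 2)) * iexp (t * s))"
    and "(LINT t|lborel. of_real (exp (- (\<sigma> * t)\<^sup>2 / 2)) * iexp (t * s)) =
           of_real (sqrt (2 * pi) / \<sigma> * exp (- (s / \<sigma>)\<^sup>2 / 2))"
proof -
  \<comment> \<open>The case of width 1 is the characteristic function of the standard normal distribution.\<close>
  have std: "(LINT t|lborel. std_normal_density t *\<^sub>R iexp (s / \<sigma> * t)) = of_real (exp (- (s / \<sigma>)\<^sup>2 / 2))"
    using fun_cong[OF char_std_normal_distribution, of "s / \<sigma>"]
    unfolding char_def by (subst (asm) integral_density) auto
  have int: "integrable lborel (\<lambda>t. std_normal_density t *\<^sub>R iexp (s / \<sigma> * t))"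
    by (rule Bochner_Integration.integrable_bound[OF integrable_normal_density[of 1 0]]) (auto)
  have eq: "of_real (exp (- (\<sigma> * t)\<^sup>2 / 2)) * iexp (t * s) =
      of_real (sqrt (2 * pi)) * (std_normal_density (0 + \<sigma> * t) *\<^sub>R iexp (s / \<sigma> * (0 + \<sigma> * t)))" for t
    using assms by (simp add: normal_density_def scaleR_conv_of_real mult_ac)
  show "integrable lborel (\<lambda>t. of_real (exp (- (\<sigma> * t)\<^sup>2 / 2)) * iexp (t * s))"
    unfolding eq using lborel_integrable_real_affine[OF int, of \<sigma> 0] assms by (intro integrable_mult_right) auto
  have "(LINT t|lborel. of_real (exp (- (\<sigma> * t)\<^sup>2 / 2)) * iexp (t * s)) =
      of_real (sqrt (2 * pi)) * (LINT t|lborel. (std_normal_density (0 + \<sigma> * t) *\<^sub>R iexp (s / \<sigma> * (0 + \<sigma> * t))))"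
    unfolding eq by (rule integral_mult_right_zero)
  moreover have "of_real (exp (- (s / \<sigma>)\<^sup>2 / 2)) =
      \<bar>\<sigma>\<bar> *\<^sub>R (LINT t|lborel. (std_normal_density (0 + \<sigma> * t) *\<^sub>R iexp (s / \<sigma> * (0 + \<sigma> * t))))"
    unfolding std[symmetric] by (rule lborel_integral_real_affine) (use assms in auto)
  ultimately show "(LINT t|lborel. of_real (exp (- (\<sigma> * t)\<^sup>2 / 2)) * iexp (t * s)) =
           of_real (sqrt (2 * pi) / \<sigma> * exp (- (s / \<sigma>)\<^sup>2 / 2))"
    using assms by (simp add: scaleR_conv_of_real field_simps)
qed

text \<open>
  Damping the inversion integral by a Gaussian makes it absolutely convergent as a double integral. By
  Fubini it becomes an average of \<open>f\<close> over a Gaussian of width \<open>\<sigma>\<close> centred at \<open>x\<close>.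
\<close>
lemma fourier_inversion_gaussian:
  fixes f :: "real \<Rightarrow> complex" and \<sigma> x :: real
  assumes f: "integrable lborel f" and \<sigma>: "\<sigma> > 0"
  shows "(LINT t|lborel. (LINT y|lborel. f y * iexp (t * y)) * iexp (- (t * x)) * of_real (exp (- (\<sigma> * t)\<^sup>2 / 2))) =
         of_real (sqrt (2 * pi)) * (LINT z|lborel. f (x + \<sigma> * z) * of_real (exp (- z\<^sup>2 / 2)))"
proof -
  define g where "g = (\<lambda>t. complex_of_real (exp (- (\<sigma> * t)\<^sup>2 / 2)))"
  have g: "integrable lborel g"
    using integral_iexp_gaussian(1)[OF \<sigma>, of 0] by (simp add: g_def)
  have [measurable]: "f \<in> borel_measurable borel" "g \<in> borel_measurable borel"
    using f g by (auto dest: borel_measurable_integrable)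
  \<comment> \<open>Without the damping factor \<open>g\<close> the double integral would not converge absolutely.\<close>
  have prod: "integrable (lborel \<Otimes>\<^sub>M lborel) (\<lambda>(t, y). f y * iexp (t * (y - x)) * g t)"
  proof (rule lborel_pair.Fubini_integrable)
    show "(\<lambda>(t, y). f y * iexp (t * (y - x)) * g t) \<in> borel_measurable (lborel \<Otimes>\<^sub>M lborel)"
      by measurable
    have "(\<lambda>t. LINT y|lborel. norm (case (t, y) of (t, y) \<Rightarrow> f y * iexp (t * (y - x)) * g t)) =
        (\<lambda>t. (LINT y|lborel. norm (f y)) * norm (g t))"
      by (simp add: norm_mult)
    then show "integrable lborel (\<lambda>t. LINT y|lborel. norm (case (t, y) of (t, y) \<Rightarrow> f y * iexp (t * (y - x)) * g t))"
      using g by simp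
    show "AE t in lborel. integrable lborel (\<lambda>y. case (t, y) of (t, y) \<Rightarrow> f y * iexp (t * (y - x)) * g t)"
    proof (intro AE_I2)
      fix t
      have "integrable lborel (\<lambda>y. f y * iexp (t * (y - x)))"
        by (rule Bochner_Integration.integrable_bound[OF f]) (auto simp: norm_mult)
      then show "integrable lborel (\<lambda>y. case (t, y) of (t, y) \<Rightarrow> f y * iexp (t * (y - x)) * g t)"
        by simp
    qed
  qed
  have "(LINT t|lborel. (LINT y|lborel. f y * iexp (t * y)) * iexp (- (t * x)) * g t) =
        (LINT t|lborel. (LINT y|lborel. f y * iexp (t * (y - x)) * g t))"
    by (simp add: algebra_simps exp_add exp_diff exp_minus field_simps flip: integral_mult_right_zero integral_mult_left_zero integral_divide_zero)
  also have "\<dots> = (LINT y|lborel. (LINT t|lborel. f y * iexp (t * (y - x)) * g t))"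
    using lborel_pair.Fubini_integral[OF prod] by simp
  also have "\<dots> = (LINT y|lborel. f y * (LINT t|lborel. g t * iexp (t * (y - x))))"
    by (subst integral_mult_right_zero[symmetric]) (simp add: mult_ac)
  also have "\<dots> = (LINT y|lborel. f y * of_real (sqrt (2 * pi) / \<sigma> * exp (- ((y - x) / \<sigma>)\<^sup>2 / 2)))"
    unfolding g_def by (subst integral_iexp_gaussian(2)[OF \<sigma>]) (rule refl)
  also have "\<dots> = \<sigma> *\<^sub>R (LINT z|lborel. f (x + \<sigma> * z) * of_real (sqrt (2 * pi) / \<sigma> * exp (- z\<^sup>2 / 2)))"
    by (subst lborel_integral_real_affine[of \<sigma> _ x]) (use \<sigma> in auto)
  also have "\<dots> = (LINT z|lborel. of_real (sqrt (2 * pi)) * (f (x + \<sigma> * z) * of_real (exp (- z\<^sup>2 / 2))))"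
    using \<sigma> by (subst integral_scaleR_right[symmetric], intro Bochner_Integration.integral_cong)
      (auto simp: scaleR_conv_of_real field_simps)
  also have "\<dots> = of_real (sqrt (2 * pi)) * (LINT z|lborel. f (x + \<sigma> * z) * of_real (exp (- z\<^sup>2 / 2)))"
    by (rule integral_mult_right_zero)
  finally show ?thesis by (simp add: g_def)
qed

text \<open>
  Both sides of the damped formula converge as \<open>\<sigma>\<close> tends to 0: the left one is dominated by the
  integrable transform, the right one by a multiple of the Gaussian because \<open>f\<close> is bounded.
\<close>
lemma fourier_inversion:
  fixes f :: "real \<Rightarrow> complex" and x :: real
  assumes f: "integrable lborel f" and cont: "continuous_on UNIV f" and bdd: "\<And>y. norm (f y) \<le> M"
    and F: "integrable lborel (\<lambda>t. LINT y|lborel. f y * iexp (t * y))"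
  shows "(LINT t|lborel. (LINT y|lborel. f y * iexp (t * y)) * iexp (- (t * x))) = 2 * of_real pi * f x"
proof -
  define F where "F = (\<lambda>t. LINT y|lborel. f y * iexp (t * y))"
  define \<sigma> where "\<sigma> = (\<lambda>n. 1 / real (Suc n))"
  have \<sigma>: "\<sigma> n > 0" for n by (simp add: \<sigma>_def)
  have \<sigma>0: "\<sigma> \<longlonglongrightarrow> 0" unfolding \<sigma>_def by real_asymp
  have [measurable]: "f \<in> borel_measurable borel" "F \<in> borel_measurable borel"
    using f F by (auto simp: F_def dest: borel_measurable_integrable)
  have "(\<lambda>n. LINT t|lborel. F t * iexp (- (t * x)) * of_real (exp (- (\<sigma> n * t)\<^sup>2 / 2)))
      \<longlonglongrightarrow> (LINT t|lborel. F t * iexp (- (t * x)))"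
  proof (rule integral_dominated_convergence[where w = "\<lambda>t. norm (F t)"])
    show "integrable lborel (\<lambda>t. norm (F t))"
      using F by (simp add: F_def)
    show "AE t in lborel. (\<lambda>n. F t * iexp (- (t * x)) * of_real (exp (- (\<sigma> n * t)\<^sup>2 / 2)))
            \<longlonglongrightarrow> F t * iexp (- (t * x))"
    proof (intro AE_I2)
      fix t
      have "(\<lambda>n. F t * iexp (- (t * x)) * of_real (exp (- (\<sigma> n * t)\<^sup>2 / 2)))
         \<longlonglongrightarrow> F t * iexp (- (t * x)) * of_real (exp (- (0 * t)\<^sup>2 / 2))"
        by (intro tendsto_intros \<sigma>0) auto
      then show "(\<lambda>n. F t * iexp (- (t * x)) * of_real (exp (- (\<sigma> n * t)\<^sup>2 / 2)))
            \<longlonglongrightarrow> F t * iexp (- (t * x))" by simp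
    qed
  qed (auto simp: norm_mult intro!: mult_left_le)
  moreover have "(\<lambda>n. LINT t|lborel. F t * iexp (- (t * x)) * of_real (exp (- (\<sigma> n * t)\<^sup>2 / 2)))
      \<longlonglongrightarrow> of_real (sqrt (2 * pi)) * (LINT z|lborel. f x * of_real (exp (- z\<^sup>2 / 2)))"
    unfolding F_def fourier_inversion_gaussian[OF f \<sigma>]
  proof (intro tendsto_intros integral_dominated_convergence[where w = "\<lambda>z. M * exp (- z\<^sup>2 / 2)"])
    show "integrable lborel (\<lambda>z. M * exp (- z\<^sup>2 / 2))"
    proof -
      have "integrable lborel (\<lambda>z. sqrt (2 * pi) * std_normal_density z)"
        by (intro integrable_mult_right integrable_normal_density) auto
      then show ?thesis by (intro integrable_mult_right) (simp add: normal_density_def)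
    qed
    show "AE z in lborel. (\<lambda>n. f (x + \<sigma> n * z) * of_real (exp (- z\<^sup>2 / 2)))
            \<longlonglongrightarrow> f x * of_real (exp (- z\<^sup>2 / 2))"
    proof (intro AE_I2 tendsto_intros)
      fix z
      have "(\<lambda>n. x + \<sigma> n * z) \<longlonglongrightarrow> x + 0 * z" by (intro tendsto_intros \<sigma>0)
      then show "(\<lambda>n. f (x + \<sigma> n * z)) \<longlonglongrightarrow> f x"
        using cont by (auto simp: continuous_on_eq_continuous_at intro: isCont_tendsto_compose)
    qed
  qed (use bdd in \<open>auto simp: norm_mult intro!: mult_right_mono\<close>)
  ultimately have "(LINT t|lborel. F t * iexp (- (t * x))) =
       of_real (sqrt (2 * pi)) * (LINT z|lborel. f x * of_real (exp (- z\<^sup>2 / 2)))"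
    by (rule LIMSEQ_unique)
  also have "(LINT z|lborel. f x * complex_of_real (exp (- z\<^sup>2 / 2))) = f x * of_real (sqrt (2 * pi))"
    using integral_iexp_gaussian(2)[of 1 0] by simp
  also have "complex_of_real (sqrt (2 * pi)) * (f x * of_real (sqrt (2 * pi))) = of_real (sqrt (2 * pi) * sqrt (2 * pi)) * f x"
    by (simp only: of_real_mult mult_ac)
  also have "\<dots> = 2 * of_real pi * f x" by simp
  finally show ?thesis by (simp add: F_def)
qed

section \<open>Gamma and Beta integrals in a logarithmic variable\<close>

lemma powr_minus_one_mult: "x > 0 \<Longrightarrow> x powr (a - 1) * x = x powr a" for x a :: real
  by (simp add: powr_diff)

lemma absolutely_integrable_imp_lborel:
  fixes f :: "real \<Rightarrow> 'a :: euclidean_space"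
  assumes "f absolutely_integrable_on S" "f \<in> borel_measurable borel" "S \<in> sets borel"
  shows "set_integrable lborel S f"
  using assms unfolding set_integrable_def by (subst (asm) integrable_completion) auto

lemma exp_of_real_integrand: "exp (of_real a * of_real y - of_real c) = complex_of_real (exp (a * y - c))"
  by (simp only: of_real_mult[symmetric] of_real_diff[symmetric] exp_of_real)

lemma norm_exp_integrand: "norm (exp (z * of_real y - of_real c)) = exp (Re z * y - c)"
  by (simp add: norm_exp_eq_Re)

text \<open>
  Substituting \<open>t = exp y\<close> in Euler's integral. In the logarithmic variable multiplication by
  \<open>exp (\<i> * t * y)\<close> shifts the parameter \<open>z\<close>, and scaling becomes translation.
\<close>
lemma Gamma_integral_exp:
  fixes z :: complex
  assumes z: "Re z > 0"
  shows "integrable lborel (\<lambda>y::real. exp (z * of_real y - of_real (exp y)))"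
    and "(LINT y|lborel. exp (z * of_real y - of_real (exp y))) = Gamma z"
proof -
  have lims: "((ereal \<circ> ln \<circ> real_of_ereal) \<longlongrightarrow> -\<infinity>) (at_right 0)"
             "((ereal \<circ> ln \<circ> real_of_ereal) \<longlongrightarrow> \<infinity>) (at_left \<infinity>)"
    by (simp_all add: zero_ereal_def ereal_tendsto_simps ln_at_0 ln_at_top)
  have int0: "set_integrable lborel {0<..} (\<lambda>t. complex_of_real t powr (w - 1) / of_real (exp t))"
    if "Re w > 0" for w
    by (rule absolutely_integrable_imp_lborel[OF absolutely_integrable_Gamma_integral'[OF that]]) auto
  have Ioi: "einterval 0 \<infinity> = {0<..}" 
    by (auto simp: einterval_def zero_ereal_def)
  have subst: "1 / t * exp (x * ln t - t) = t powr (x - 1) / exp t" if "t > 0" for t x :: real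
    using that by (simp add: powr_def exp_diff algebra_simps)
  have csubst: "(1 / t) *\<^sub>R exp (z * of_real (ln t) - of_real (exp (ln t))) =
      complex_of_real t powr (z - 1) / of_real (exp t)" if "t > 0" for t :: real
  proof -
    have "(z - 1) * of_real (ln t) = z * of_real (ln t) - of_real (ln t)"
      by (simp add: ring_distribs)
    then show ?thesis
      using that by (simp only: powr_def exp_diff exp_of_real exp_ln scaleR_conv_of_real Ln_of_real) auto
  qed
  have cRe: "Re (complex_of_real t powr (of_real x - 1) / of_real (exp t)) = exp (x * ln t - exp (ln t)) * (1 / t)"
    if "t > 0" for t x :: real
  proof -
    have "complex_of_real t powr (of_real x - 1) / of_real (exp t) = of_real (t powr (x - 1) / exp t)"
      using that by (simp only: powr_of_real[of t "x - 1", symmetric] of_real_diff of_real_1 of_real_divide order_less_imp_le)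
    then show ?thesis using that subst[of t x] by (simp only: Re_complex_of_real exp_ln mult.commute)
  qed
  have real_int: "set_integrable lborel (einterval (-\<infinity>) \<infinity>) (\<lambda>y. exp (Re z * y - exp y))"
  proof (rule interval_integral_substitution_nonneg(1)[OF _ _ _ _ _ _ lims])
    have "set_integrable lborel {0<..} (\<lambda>t. Re (complex_of_real t powr (complex_of_real (Re z) - 1) / of_real (exp t)))"
      using int0[of "of_real (Re z)"] z unfolding set_integrable_def 
      by (auto dest!: Bochner_Integration.integrable_Re)
    then show "set_integrable lborel (einterval 0 \<infinity>) (\<lambda>x. exp (Re z * ln x - exp (ln x)) * (1 / x))"
      unfolding Ioi
      by (rule set_integrable_cong[THEN iffD1, rotated -1])
         (simp_all only: greaterThan_iff cRe)
  qed (auto intro!: continuous_intros derivative_eq_intros simp: zero_ereal_def)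
  have norm_eq: "norm (exp (z * of_real y - of_real (exp y))) = exp (Re z * y - exp y)" for y :: real
    by (simp add: norm_exp_eq_Re)
  show int1: "integrable lborel (\<lambda>y::real. exp (z * of_real y - of_real (exp y)))"
  proof (rule Bochner_Integration.integrable_bound)
    show "integrable lborel (\<lambda>y. exp (Re z * y - exp y))"
      using real_int by (simp add: set_integrable_def)
  qed (auto simp: norm_eq)
  have "(LBINT y=-\<infinity>..\<infinity>. exp (z * of_real y - of_real (exp y))) =
      (LBINT t=0..\<infinity>. (1 / t) *\<^sub>R exp (z * of_real (ln t) - of_real (exp (ln t))))"
  proof (rule interval_integral_substitution_integrable[OF _ _ _ _ _ lims])
    show "set_integrable lborel (einterval 0 \<infinity>) (\<lambda>x. (1 / x) *\<^sub>R exp (z * complex_of_real (ln x) - complex_of_real (exp (ln x))))"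
      unfolding Ioi
      by (rule set_integrable_cong[THEN iffD1, OF _ _ _ int0[OF z]]) (simp_all only: greaterThan_iff csubst)
    show "set_integrable lborel (einterval (-\<infinity>) \<infinity>) (\<lambda>x. exp (z * complex_of_real x - complex_of_real (exp x)))"
      using int1 by (simp add: set_integrable_def)
  qed (auto intro!: continuous_intros derivative_eq_intros simp: zero_ereal_def)
  also have "\<dots> = (LBINT t:{0<..}. complex_of_real t powr (z - 1) / of_real (exp t))"
    unfolding interval_lebesgue_integral_def Ioi
    by (simp, rule set_lebesgue_integral_cong) (simp, blast intro: csubst)
  also have "\<dots> = Gamma z"
    using Gamma_integral_complex'[OF z] set_borel_integral_eq_integral[OF int0[OF z]]
    by (simp add: integral_unique)
  finally show "(LINT y|lborel. exp (z * of_real y - of_real (exp y))) = Gamma z"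
    by (simp add: interval_lebesgue_integral_def set_lebesgue_integral_def)
qed

lemma Gamma_integral_exp_shift:
  fixes z :: complex and w :: real
  assumes z: "Re z > 0"
  shows "integrable lborel (\<lambda>y::real. exp (z * of_real y - of_real (exp (w + y))))"
    and "(LINT y|lborel. exp (z * of_real y - of_real (exp (w + y)))) = exp (- z * of_real w) * Gamma z"
proof -
  have eq: "exp (z * of_real y - of_real (exp (w + y))) =
      exp (- z * of_real w) * exp (z * of_real (w + 1 * y) - of_real (exp (w + 1 * y)))" for y
    unfolding exp_add[symmetric] by (intro arg_cong[where f = exp]) (simp add: ring_distribs)
  show "integrable lborel (\<lambda>y::real. exp (z * of_real y - of_real (exp (w + y))))"
    unfolding eq by (intro integrable_mult_right lborel_integrable_real_affine Gamma_integral_exp z) auto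
  have "(LINT y|lborel. exp (z * of_real y - of_real (exp (w + y)))) = exp (- z * of_real w) *
     (LINT y|lborel. exp (z * of_real (w + 1 * y) - of_real (exp (w + 1 * y))))"
    unfolding eq by (rule integral_mult_right_zero)
  also have "(LINT y|lborel. exp (z * of_real (w + 1 * y) - of_real (exp (w + 1 * y)))) = Gamma z"
    using lborel_integral_real_affine[of 1 "\<lambda>y. exp (z * of_real y - of_real (exp y))" w] Gamma_integral_exp(2)[OF z]
    by simp
  finally show "(LINT y|lborel. exp (z * of_real y - of_real (exp (w + y)))) = exp (- z * of_real w) * Gamma z" .
qed

text \<open>
  The double integral of \<open>K\<close> can be evaluated in either order. Integrating over \<open>w\<close> first gives
  \<open>\<Gamma>(a + b)\<close> times the integrand of the claim, integrating over \<open>y\<close> first gives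
  \<open>\<Gamma>(a)\<close> times the integrand for \<open>\<Gamma>(b)\<close>.
\<close>
lemma Beta_integral_exp:
  fixes a b :: complex
  assumes a: "Re a > 0" and b: "Re b > 0"
  shows "integrable lborel (\<lambda>y::real. exp (a * of_real y - (a + b) * of_real (ln (1 + exp y))))"
    and "(LINT y|lborel. exp (a * of_real y - (a + b) * of_real (ln (1 + exp y)))) = Beta a b"
proof -
  define c where "c = a + b"
  define K where "K = (\<lambda>w y::real. exp (c * of_real w - of_real (exp w)) * exp (a * of_real y - of_real (exp (w + y))))"
  have c: "Re c > 0" using a b by (simp add: c_def)
  have K1: "(LINT y|lborel. K w y) = exp (b * of_real w - of_real (exp w)) * Gamma a" for w
  proof -
    have "(LINT y|lborel. K w y) = exp (c * of_real w - of_real (exp w)) * (exp (- a * of_real w) * Gamma a)"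
      by (simp only: K_def integral_mult_right_zero Gamma_integral_exp_shift(2)[OF a])
    also have "\<dots> = exp ((c * of_real w - of_real (exp w)) + - a * of_real w) * Gamma a"
      by (simp only: exp_add mult.assoc)
    also have "(c * of_real w - of_real (exp w)) + - a * of_real w = b * of_real w - of_real (exp w)"
      by (simp add: c_def algebra_simps)
    finally show ?thesis .
  qed
  have K2': "K w y = exp (a * of_real y) * exp (c * of_real w - of_real (exp (ln (1 + exp y) + w)))" for w y
  proof -
    have "exp (ln (1 + exp y) + w) = exp w + exp (w + y)"
      by (simp add: exp_add add_pos_pos algebra_simps)
    then have "(c * of_real w - of_real (exp w)) + (a * of_real y - of_real (exp (w + y))) =
        a * of_real y + (c * of_real w - complex_of_real (exp (ln (1 + exp y) + w)))"
      by (simp add: algebra_simps)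
    then show ?thesis
      unfolding K_def by (simp only: exp_add[symmetric])
  qed
  have K2: "(LINT w|lborel. K w y) = exp (a * of_real y - c * of_real (ln (1 + exp y))) * Gamma c" for y
  proof -
    have "(LINT w|lborel. K w y) = exp (a * of_real y) * (exp (- c * of_real (ln (1 + exp y))) * Gamma c)"
      by (simp only: K2' integral_mult_right_zero Gamma_integral_exp_shift(2)[OF c])
    also have "\<dots> = exp (a * of_real y + - c * of_real (ln (1 + exp y))) * Gamma c"
      by (simp only: exp_add mult.assoc)
    finally show ?thesis by simp
  qed
  have int: "integrable (lborel \<Otimes>\<^sub>M lborel) (\<lambda>(w, y). K w y)"
  proof (rule lborel_pair.Fubini_integrable)
    show "(\<lambda>(w, y). K w y) \<in> borel_measurable (lborel \<Otimes>\<^sub>M lborel)"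
      unfolding K_def by measurable
    have "(LINT y|lborel. norm (K w y)) = norm (exp (b * of_real w - of_real (exp w))) * Gamma (Re a)" for w
    proof -
      have "complex_of_real (LINT y|lborel. exp (Re a * y - exp (w + y))) =
          (LINT y|lborel. exp (of_real (Re a) * of_real y - of_real (exp (w + y))))"
        by (simp only: exp_of_real_integrand integral_complex_of_real)
      also have "\<dots> = exp (- of_real (Re a) * of_real w) * Gamma (of_real (Re a))"
        using a by (subst Gamma_integral_exp_shift(2)) auto
      also have "\<dots> = of_real (exp (- Re a * w) * Gamma (Re a))"
        by (simp add: Gamma_complex_of_real exp_of_real del: of_real_minus of_real_mult
              flip: of_real_minus of_real_mult)
      finally have "(LINT y|lborel. exp (Re a * y - exp (w + y))) = exp (- Re a * w) * Gamma (Re a)"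
        by (simp only: of_real_eq_iff)
      then show ?thesis
        unfolding K_def norm_mult integral_mult_right_zero norm_exp_integrand
        by (simp add: c_def algebra_simps flip: exp_add)
    qed
    then show "integrable lborel (\<lambda>w. LINT y|lborel. norm (case (w, y) of (w, y) \<Rightarrow> K w y))"
      using integrable_norm[OF Gamma_integral_exp(1)[OF b]] by (simp del: norm_exp_eq_Re)
    show "AE w in lborel. integrable lborel (\<lambda>y. case (w, y) of (w, y) \<Rightarrow> K w y)"
      unfolding K_def using Gamma_integral_exp_shift(1)[OF a] by auto
  qed
  have [simp]: "Gamma c \<noteq> 0" using c by (auto simp: Gamma_eq_zero_iff elim!: nonpos_Ints_cases)
  have "integrable lborel (\<lambda>y. LINT w|lborel. K w y)"
    using lborel_pair.integrable_snd[OF int] by simp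
  then have "integrable lborel (\<lambda>y. (LINT w|lborel. K w y) / Gamma c)"
    by (rule integrable_divide_zero)
  then show "integrable lborel (\<lambda>y::real. exp (a * of_real y - (a + b) * of_real (ln (1 + exp y))))"
    unfolding K2 by (simp add: c_def[symmetric])
  have "(LINT y|lborel. exp (a * of_real y - c * of_real (ln (1 + exp y)))) * Gamma c = (LINT y|lborel. LINT w|lborel. K w y)"
    unfolding K2 by simp
  also have "\<dots> = (LINT w|lborel. LINT y|lborel. K w y)"
    by (rule lborel_pair.Fubini_integral[OF int])
  also have "\<dots> = Gamma b * Gamma a"
    unfolding K1 using Gamma_integral_exp(2)[OF b] by simp
  finally show "(LINT y|lborel. exp (a * of_real y - (a + b) * of_real (ln (1 + exp y)))) = Beta a b"
    by (simp add: Beta_def c_def[symmetric] field_simps)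
qed

lemma Beta_integral_exp_real:
  fixes a b :: real
  assumes "a > 0" and "b > 0"
  shows "integrable lborel (\<lambda>y. exp (a * y - (a + b) * ln (1 + exp y)))"
    and "(LBINT y. exp (a * y - (a + b) * ln (1 + exp y))) = Beta a b"
proof -
  have eq: "complex_of_real (exp (a * y - (a + b) * ln (1 + exp y))) =
      exp (of_real a * of_real y - (of_real a + of_real b) * of_real (ln (1 + exp y)))" for y
    by (simp only: exp_of_real_integrand[symmetric] of_real_mult of_real_add)
  have *: "integrable lborel (\<lambda>y. complex_of_real (exp (a * y - (a + b) * ln (1 + exp y))))"
      "(LINT y|lborel. complex_of_real (exp (a * y - (a + b) * ln (1 + exp y)))) = of_real (Beta a b)"
    unfolding eq using Beta_integral_exp[of "of_real a" "of_real b"] assms by (auto simp: Beta_complex_of_real)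
  show "integrable lborel (\<lambda>y. exp (a * y - (a + b) * ln (1 + exp y)))"
    using *(1) by (simp only: complex_of_real_integrable_eq)
  show "(LBINT y. exp (a * y - (a + b) * ln (1 + exp y))) = Beta a b"
    using *(2) by (simp only: integral_complex_of_real of_real_eq_iff)
qed

lemma norm_Beta_le:
  fixes a b :: complex
  assumes a: "Re a > 0" and b: "Re b > 0"
  shows "norm (Beta a b) \<le> Beta (Re a) (Re b)"
proof -
  have "norm (Beta a b) \<le> (LINT y|lborel. norm (exp (a * complex_of_real y - (a + b) * of_real (ln (1 + exp y)))))"
    unfolding Beta_integral_exp(2)[OF a b, symmetric] by (rule integral_norm_bound)
  also have "\<dots> = (LINT y|lborel. exp (Re a * y - (Re a + Re b) * ln (1 + exp y)))"
    by (simp add: norm_exp_eq_Re)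
  also have "\<dots> = Beta (Re a) (Re b)"
    by (rule Beta_integral_exp_real(2)[OF a b])
  finally show ?thesis .
qed

section \<open>Products of Beta functions along a vertical line\<close>

text \<open>
  Along a vertical line with \<open>a + b\<close> fixed, the Beta function on the right is bounded, so the one on the left
  decays quadratically.
\<close>
lemma Beta_plus1_plus1_mult:
  fixes a b :: complex
  assumes a: "Re a > 0" and b: "Re b > 0"
  shows "a * b * Beta a b = (a + b) * (a + b + 1) * Beta (a + 1) (b + 1)"
proof -
  have nz: "Gamma (z + 1) = z * Gamma z" "rGamma z = z * rGamma (z + 1)" if "Re z > 0" for z :: complex
  proof -
    have "z \<notin> \<int>\<^sub>\<le>\<^sub>0" using that by (auto elim!: nonpos_Ints_cases)
    then show "Gamma (z + 1) = z * Gamma z" by (rule Gamma_plus1)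
    show "rGamma z = z * rGamma (z + 1)" by (simp add: rGamma_plus1)
  qed
  have "a + 1 + (b + 1) = a + b + 1 + 1" by simp
  then show ?thesis
    using nz(1)[OF a] nz(1)[OF b] nz(2)[of "a + b"] nz(2)[of "a + b + 1"] a b unfolding Beta_altdef
    by simp
qed

lemma integrable_Beta_vertical:
  fixes a b :: real
  assumes a: "a > 0" and b: "b > 0"
  shows "integrable lborel (\<lambda>t. Beta (of_real a + \<i> * of_real t) (of_real b - \<i> * of_real t))"
proof -
  \<comment> \<open>A common constant with \<open>m * sqrt (1 + t\<^sup>2)\<close> below both \<open>norm (a + \<i> t)\<close> and \<open>norm (b - \<i> t)\<close>.\<close>
  define m where "m = min (min a b) 1"
  have m: "m > 0" "m \<le> a" "m \<le> b" "m \<le> 1" using a b by (auto simp: m_def)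
  define C where "C = (a + b) * (a + b + 1) * Beta (a + 1) (b + 1) / m\<^sup>2"
  have quad: "integrable lborel (\<lambda>t::real. inverse (1 + t\<^sup>2))"
    using integrable_inverse_1_plus_square by (simp add: set_integrable_def)
  have low: "m * sqrt (1 + t\<^sup>2) \<le> norm (Complex x t)" if "m \<le> x" for x t
  proof -
    have "m\<^sup>2 * t\<^sup>2 \<le> 1 * t\<^sup>2" using m by (intro mult_right_mono) (auto simp: power_le_one)
    moreover have "m\<^sup>2 \<le> x\<^sup>2" using m that by (intro power_mono) auto
    ultimately have "m\<^sup>2 * (1 + t\<^sup>2) \<le> x\<^sup>2 + t\<^sup>2" by (simp add: algebra_simps)
    then have "sqrt (m\<^sup>2 * (1 + t\<^sup>2)) \<le> sqrt (x\<^sup>2 + t\<^sup>2)" by (rule real_sqrt_le_mono)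
    then show ?thesis using m by (simp add: real_sqrt_mult cmod_def)
  qed
  have bound: "norm (Beta (of_real a + \<i> * of_real t) (of_real b - \<i> * of_real t)) \<le> C * inverse (1 + t\<^sup>2)" for t
  proof -
    let ?A = "complex_of_real a + \<i> * of_real t" and ?B = "complex_of_real b - \<i> * of_real t"
    have AB: "?A = Complex a t" "?B = Complex b (- t)" by (auto simp: complex_eq_iff)
    have "m * sqrt (1 + t\<^sup>2) * (m * sqrt (1 + t\<^sup>2)) \<le> norm ?A * norm ?B"
      using low[OF m(2), of t] low[OF m(3), of "-t"] m unfolding AB by (intro mult_mono) auto
    then have 1: "m\<^sup>2 * (1 + t\<^sup>2) \<le> norm ?A * norm ?B"
      by (simp add: power2_eq_square algebra_simps)
    have "?A * ?B * Beta ?A ?B = of_real ((a + b) * (a + b + 1)) * Beta (?A + 1) (?B + 1)"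
      using a b by (subst Beta_plus1_plus1_mult) auto
    then have "norm ?A * norm ?B * norm (Beta ?A ?B) = (a + b) * (a + b + 1) * norm (Beta (?A + 1) (?B + 1))"
      using a b by (metis (no_types, lifting) norm_mult norm_of_real abs_of_pos add_pos_pos mult_pos_pos zero_less_one)
    also have "\<dots> \<le> (a + b) * (a + b + 1) * Beta (a + 1) (b + 1)"
      using norm_Beta_le[of "?A + 1" "?B + 1"] a b by (intro mult_left_mono) auto
    finally have "m\<^sup>2 * (1 + t\<^sup>2) * norm (Beta ?A ?B) \<le> (a + b) * (a + b + 1) * Beta (a + 1) (b + 1)"
      using mult_right_mono[OF 1, of "norm (Beta ?A ?B)"] by simp
    moreover have "m\<^sup>2 * (1 + t\<^sup>2) > 0" using m by (intro mult_pos_pos) (auto intro: add_pos_nonneg)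
    ultimately show ?thesis unfolding C_def using m
      by (simp add: field_simps)
  qed
  show ?thesis
  proof (rule Bochner_Integration.integrable_bound)
    show "integrable lborel (\<lambda>t. C * inverse (1 + t\<^sup>2))" using quad by (rule integrable_mult_right)
    have "continuous_on UNIV (\<lambda>t. Beta (of_real a + \<i> * of_real t) (of_real b - \<i> * of_real t))"
      unfolding Beta_altdef using a b
      by (intro continuous_intros continuous_on_compose2[OF continuous_on_Gamma[of "- \<int>\<^sub>\<le>\<^sub>0"]])
         (auto elim!: nonpos_Ints_cases simp: complex_eq_iff)
    then show "(\<lambda>t. Beta (of_real a + \<i> * of_real t) (of_real b - \<i> * of_real t)) \<in> borel_measurable lborel"
      by (simp add: borel_measurable_continuous_onI)
    have "C * inverse (1 + t\<^sup>2) \<ge> 0" for t using order_trans[OF norm_ge_zero bound] .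
    then show "AE t in lborel. norm (Beta (of_real a + \<i> * of_real t) (of_real b - \<i> * of_real t)) \<le> norm (C * inverse (1 + t\<^sup>2))"
      using bound by (intro AE_I2) (metis abs_of_nonneg real_norm_def)
  qed
qed

lemma softplus_bounds: "0 \<le> ln (1 + exp y)" "y \<le> ln (1 + exp y)" for y :: real
proof -
  show "0 \<le> ln (1 + exp y)" by simp
  have "ln (exp y) \<le> ln (1 + exp y)" by (intro ln_mono) (auto intro: add_pos_pos)
  then show "y \<le> ln (1 + exp y)" by simp
qed

text \<open>
  The bound that Fourier inversion needs, and the domination by the other Beta factor below.
\<close>
lemma logistic_le_1:
  fixes a b y :: real
  assumes "a > 0" "b > 0"
  shows "exp (a * y - (a + b) * ln (1 + exp y)) \<le> 1"
proof -
  have "a * y \<le> a * ln (1 + exp y)" "0 \<le> b * ln (1 + exp y)"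
    using softplus_bounds[of y] assms by (auto intro: mult_left_mono)
  then show ?thesis by (simp add: algebra_simps)
qed

text \<open>
  The phase \<open>exp (\<i> * t * y)\<close> moves the two parameters of the logistic function in opposite directions, so its
  Fourier transform is a Beta function whose arguments have a constant sum.
\<close>
lemma fourier_inversion_Beta:
  fixes a b x :: real
  assumes a: "a > 0" and b: "b > 0"
  shows "(LINT t|lborel. Beta (of_real a + \<i> * of_real t) (of_real b - \<i> * of_real t) * iexp (- (t * x))) =
         2 * of_real pi * of_real (exp (a * x - (a + b) * ln (1 + exp x)))"
proof -
  define f where "f = (\<lambda>y. complex_of_real (exp (a * y - (a + b) * ln (1 + exp y))))"
  have f_eq: "f y = exp (of_real a * of_real y - (of_real a + of_real b) * of_real (ln (1 + exp y)))" for y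
    unfolding f_def by (simp only: exp_of_real_integrand[symmetric] of_real_mult of_real_add)
  have "f y * iexp (t * y) = exp ((of_real a + \<i> * of_real t) * of_real y -
      ((of_real a + \<i> * of_real t) + (of_real b - \<i> * of_real t)) * of_real (ln (1 + exp y)))" for t y
    unfolding f_eq exp_add[symmetric] by (intro arg_cong[where f = exp]) (simp add: algebra_simps)
  then have F: "(LINT y|lborel. f y * iexp (t * y)) = Beta (of_real a + \<i> * of_real t) (of_real b - \<i> * of_real t)" for t
    using Beta_integral_exp(2)[of "of_real a + \<i> * of_real t" "of_real b - \<i> * of_real t"] a b by simp
  have "(LINT t|lborel. (LINT y|lborel. f y * iexp (t * y)) * iexp (- (t * x))) = 2 * of_real pi * f x"
  proof (rule fourier_inversion)
    show "integrable lborel f"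
      unfolding f_eq by (rule Beta_integral_exp(1)) (use a b in auto)
    show "continuous_on UNIV f"
      unfolding f_def by (intro continuous_intros) (metis add_pos_pos exp_gt_zero less_irrefl zero_less_one)
    show "norm (f y) \<le> 1" for y
      using logistic_le_1[OF a b, of y] by (simp add: f_def)
    show "integrable lborel (\<lambda>t. LINT y|lborel. f y * iexp (t * y))"
      unfolding F by (rule integrable_Beta_vertical[OF a b])
  qed
  then show ?thesis unfolding F by (simp only: f_def)
qed

text \<open>
  Writing the first Beta function as an integral over \<open>y\<close>, the dependence of its integrand on \<open>t\<close> is the
  phase \<open>exp (- \<i> t ln (1 + exp y))\<close>. It only shifts the point \<open>x\<close> at which the second factor is inverted.
\<close>
lemma Beta_Beta_vertical_integral:
  fixes p \<beta> a b x :: real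
  assumes p: "p > 0" and \<beta>: "\<beta> > 0" and a: "a > 0" and b: "b > 0"
  defines "B \<equiv> \<lambda>t. Beta (of_real p + \<i> * of_real t) (of_real \<beta>) * Beta (of_real a + \<i> * of_real t) (of_real b - \<i> * of_real t)"
  defines "H \<equiv> \<lambda>y. exp (\<beta> * y - (\<beta> + p) * ln (1 + exp y)) *
             exp (a * (x + ln (1 + exp y)) - (a + b) * ln (1 + exp (x + ln (1 + exp y))))"
  shows "integrable lborel (\<lambda>t. B t * iexp (- (t * x)))"
    and "integrable lborel H"
    and "(LINT t|lborel. B t * iexp (- (t * x))) = 2 * of_real pi * of_real (LINT y|lborel. H y)"
proof -
  define V where "V = (\<lambda>t. Beta (complex_of_real a + \<i> * of_real t) (of_real b - \<i> * of_real t))"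
  define h where "h = (\<lambda>y. exp (\<beta> * y - (\<beta> + p) * ln (1 + exp y)))"
  have V: "integrable lborel V" unfolding V_def by (rule integrable_Beta_vertical[OF a b])
  have h: "integrable lborel h" unfolding h_def by (rule Beta_integral_exp_real(1)[OF \<beta> p])
  have [measurable]: "V \<in> borel_measurable borel" "h \<in> borel_measurable borel"
    using V h by (auto dest: borel_measurable_integrable)
  have hpos: "h y \<ge> 0" for y by (simp add: h_def)
  define K where "K = (\<lambda>t y. V t * of_real (h y) * iexp (- (t * (x + ln (1 + exp y)))))"
  have K: "integrable (lborel \<Otimes>\<^sub>M lborel) (\<lambda>(t, y). K t y)"
  proof (rule lborel_pair.Fubini_integrable)
    show "(\<lambda>(t, y). K t y) \<in> borel_measurable (lborel \<Otimes>\<^sub>M lborel)"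
      unfolding K_def by measurable
    have "(LINT y|lborel. norm (K t y)) = norm (V t) * (LINT y|lborel. h y)" for t
      using hpos by (simp add: K_def norm_mult)
    then show "integrable lborel (\<lambda>t. LINT y|lborel. norm (case (t, y) of (t, y) \<Rightarrow> K t y))"
      using V by simp
    show "AE t in lborel. integrable lborel (\<lambda>y. case (t, y) of (t, y) \<Rightarrow> K t y)"
    proof (intro AE_I2)
      fix t
      have "integrable lborel (\<lambda>y. norm (V t) * h y)" using h by simp
      then have "integrable lborel (\<lambda>y. K t y)"
        by (rule Bochner_Integration.integrable_bound) (auto simp: K_def norm_mult)
      then show "integrable lborel (\<lambda>y. case (t, y) of (t, y) \<Rightarrow> K t y)" by simp
    qed
  qed
  have Ky: "(LINT y|lborel. K t y) = B t * iexp (- (t * x))" for t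
  proof -
    have "K t y = V t * iexp (- (t * x)) * exp (of_real \<beta> * of_real y -
        (of_real \<beta> + (of_real p + \<i> * of_real t)) * of_real (ln (1 + exp y)))" for y
    proof -
      have "complex_of_real (h y) * iexp (- (t * (x + ln (1 + exp y)))) = iexp (- (t * x)) * exp (of_real \<beta> * of_real y -
        (of_real \<beta> + (of_real p + \<i> * of_real t)) * of_real (ln (1 + exp y)))"
        unfolding h_def exp_of_real_integrand[symmetric] exp_add[symmetric]
        by (intro arg_cong[where f = exp]) (simp add: algebra_simps)
      then show ?thesis by (simp only: K_def mult.assoc)
    qed
    then have "(LINT y|lborel. K t y) = V t * iexp (- (t * x)) * Beta (of_real \<beta>) (of_real p + \<i> * of_real t)"
      using Beta_integral_exp(2)[of "of_real \<beta>" "of_real p + \<i> * of_real t"] \<beta> p by simp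
    then show ?thesis by (simp add: B_def V_def Beta_commute mult_ac)
  qed
  have Kt: "(LINT t|lborel. K t y) = 2 * of_real pi * of_real (H y)" for y
  proof -
    have "(LINT t|lborel. K t y) = of_real (h y) * (LINT t|lborel. V t * iexp (- (t * (x + ln (1 + exp y)))))"
      by (subst integral_mult_right_zero[symmetric]) (simp only: K_def mult_ac)
    also have "\<dots> = of_real (h y) * (2 * of_real pi * of_real (exp (a * (x + ln (1 + exp y)) - (a + b) * ln (1 + exp (x + ln (1 + exp y))))))"
      unfolding V_def by (subst fourier_inversion_Beta[OF a b]) (rule refl)
    also have "\<dots> = 2 * of_real pi * of_real (H y)"
      by (simp only: H_def h_def of_real_mult mult_ac)
    finally show ?thesis .
  qed
  show "integrable lborel (\<lambda>t. B t * iexp (- (t * x)))"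
    using lborel_pair.integrable_fst[OF K] by (simp only: Ky)
  show "integrable lborel H"
  proof (rule Bochner_Integration.integrable_bound[OF h])
    show "AE y in lborel. norm (H y) \<le> norm (h y)"
      using logistic_le_1[OF a b] by (intro AE_I2) (simp add: H_def h_def abs_mult del: exp_le_one_iff exp_diff)
  qed (simp add: H_def)
  have "(LINT t|lborel. B t * iexp (- (t * x))) = (LINT t|lborel. LINT y|lborel. K t y)"
    by (simp only: Ky)
  also have "\<dots> = (LINT y|lborel. LINT t|lborel. K t y)"
    using lborel_pair.Fubini_integral[OF K] by simp
  also have "\<dots> = 2 * of_real pi * (LINT y|lborel. of_real (H y))"
    by (simp only: Kt integral_mult_right_zero)
  finally show "(LINT t|lborel. B t * iexp (- (t * x))) = 2 * of_real pi * of_real (LINT y|lborel. H y)"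
    by (simp only: integral_complex_of_real)
qed

section \<open>The G-function as a real integral\<close>

lemma set_integral_split_at_0:
  fixes g :: "real \<Rightarrow> complex"
  assumes g: "integrable lborel g" and "A \<in> sets borel"
  shows "(LINT t:A|lborel. g t) = (LINT t:A \<inter> {..0}|lborel. g t) + (LINT t:A \<inter> {0..}|lborel. g t)"
proof -
  have [measurable]: "A \<in> sets borel" "g \<in> borel_measurable borel"
    using assms by (auto dest: borel_measurable_integrable)
  have int: "integrable lborel (\<lambda>t. indicator B t *\<^sub>R g t)" if "B \<in> sets borel" for B
    using g that by (intro integrable_mult_indicator) auto
  have "(LINT t:A|lborel. g t) = (LINT t|lborel. indicator (A \<inter> {..0}) t *\<^sub>R g t + indicator (A \<inter> {0..}) t *\<^sub>R g t)"
    unfolding set_lebesgue_integral_def using AE_lborel_singleton[of 0]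
    by (intro integral_cong_AE) (auto elim!: eventually_mono simp: indicator_def)
  also have "\<dots> = (LINT t:A \<inter> {..0}|lborel. g t) + (LINT t:A \<inter> {0..}|lborel. g t)"
    unfolding set_lebesgue_integral_def by (intro Bochner_Integration.integral_add int) auto
  finally show ?thesis .
qed

text \<open>
  The two ends move independently, so the segment is cut at 0 and each half converges along its own
  coordinate of the product filter.
\<close>
lemma tendsto_integral_two_ended:
  fixes g :: "real \<Rightarrow> complex"
  assumes g: "integrable lborel g"
  shows "((\<lambda>(a, b). LINT t:{a..b}|lborel. g t) \<longlongrightarrow> (LINT t|lborel. g t)) (at_bot \<times>\<^sub>F at_top)"
proof -
  have int: "set_integrable lborel B g" if "B \<in> sets borel" for B
    using g that unfolding set_integrable_def by (intro integrable_mult_indicator) auto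
  have "((\<lambda>p. (LINT t:{fst p..0}|lborel. g t) + (LINT t:{0..snd p}|lborel. g t)) \<longlongrightarrow>
      (LINT t:{..0}|lborel. g t) + (LINT t:{0..}|lborel. g t)) (at_bot \<times>\<^sub>F at_top)"
    by (intro tendsto_add
        filterlim_compose[OF tendsto_set_lebesgue_integral_at_bot filterlim_fst]
        filterlim_compose[OF tendsto_set_lebesgue_integral_at_top filterlim_snd] int) auto
  moreover have "(LINT t:{..0}|lborel. g t) + (LINT t:{0..}|lborel. g t) = (LINT t|lborel. g t)"
    using set_integral_split_at_0[OF g, of UNIV] by (simp add: set_lebesgue_integral_def)
  moreover have "\<forall>\<^sub>F p in at_bot \<times>\<^sub>F at_top. (LINT t:{fst p..0}|lborel. g t) + (LINT t:{0..snd p}|lborel. g t) =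
      (case p of (a, b) \<Rightarrow> LINT t:{a..b}|lborel. g t)"
  proof -
    have "\<forall>\<^sub>F p in at_bot \<times>\<^sub>F at_top. fst p \<le> (0::real) \<and> (0::real) \<le> snd p"
      using eventually_prodI[OF eventually_le_at_bot[of "0::real"] eventually_ge_at_top[of "0::real"]] .
    then show ?thesis
    proof (rule eventually_mono)
      fix p :: "real \<times> real"
      assume p: "fst p \<le> 0 \<and> 0 \<le> snd p"
      obtain a b where [simp]: "p = (a, b)" by (cases p)
      have "{a..b} \<inter> {..0} = {a..0}" "{a..b} \<inter> {0..} = {0..b}" using p by auto
      note split = set_integral_split_at_0[OF g, of "{a..b}", unfolded this]
      show "(LINT t:{fst p..0}|lborel. g t) + (LINT t:{0..snd p}|lborel. g t) =
          (case p of (a, b) \<Rightarrow> LINT t:{a..b}|lborel. g t)"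
        by (simp add: split)
    qed
  qed
  ultimately show ?thesis
    using Lim_transform_eventually by fastforce
qed

lemma contour_integral_vertical_segment:
  assumes g: "integrable lborel (\<lambda>t. f (Complex \<kappa> t))" and ab: "a < b"
  shows "contour_integral (linepath (Complex \<kappa> a) (Complex \<kappa> b)) f = \<i> * (LINT t:{a..b}|lborel. f (Complex \<kappa> t))"
proof -
  let ?g = "\<lambda>x. (b - a) *\<^sub>R f (Complex \<kappa> (a + (b - a) * x))"
  have int: "integrable lborel (\<lambda>t. indicator {a..b} t *\<^sub>R f (Complex \<kappa> t))"
    using g by (intro integrable_mult_indicator) auto
  have ind: "indicator {a..b} (a + (b - a) * x) = (indicator {0..1} x :: real)" for x
  proof -
    have "a \<le> a + (b - a) * x \<longleftrightarrow> 0 \<le> x" using ab by (simp add: zero_le_mult_iff)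
    moreover have "a + (b - a) * x \<le> b \<longleftrightarrow> x \<le> 1"
      proof -
      have "(b - a) * x \<le> b - a \<longleftrightarrow> x \<le> 1" using mult_le_cancel_left_pos[of "b - a" x 1] ab by simp
      then show ?thesis by linarith
    qed
    ultimately show ?thesis by (simp add: indicator_def)
  qed
  have "integrable lborel (\<lambda>x. (b - a) *\<^sub>R (indicator {a..b} (a + (b - a) * x) *\<^sub>R f (Complex \<kappa> (a + (b - a) * x))))"
    using ab by (intro integrable_scaleR_right lborel_integrable_real_affine[OF int]) auto
  then have si: "set_integrable lborel {0..1} ?g"
    unfolding set_integrable_def ind by (simp add: scaleR_left_commute mult_ac)
  have "(LINT t:{a..b}|lborel. f (Complex \<kappa> t)) = (b - a) *\<^sub>R (LINT x|lborel. indicator {a..b} (a + (b - a) * x) *\<^sub>R f (Complex \<kappa> (a + (b - a) * x)))"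
    unfolding set_lebesgue_integral_def using ab by (subst lborel_integral_real_affine[of "b - a" _ a]) auto
  also have "\<dots> = (LINT x:{0..1}|lborel. ?g x)"
    unfolding set_lebesgue_integral_def ind integral_scaleR_right[symmetric] by (simp add: scaleR_left_commute mult_ac)
  finally have eq: "(LINT t:{a..b}|lborel. f (Complex \<kappa> t)) = (LINT x:{0..1}|lborel. ?g x)" .
  have lp: "linepath (Complex \<kappa> a) (Complex \<kappa> b) x = Complex \<kappa> (a + (b - a) * x)" for x
    by (simp add: linepath_def complex_eq_iff algebra_simps)
  have di: "Complex \<kappa> b - Complex \<kappa> a = \<i> * of_real (b - a)"
    by (simp add: complex_eq_iff)
  have "(?g has_integral (LINT t:{a..b}|lborel. f (Complex \<kappa> t))) {0..1}"
    unfolding eq set_borel_integral_eq_integral(2)[OF si]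
    by (rule integrable_integral[OF set_borel_integral_eq_integral(1)[OF si]])
  then have "((\<lambda>x. \<i> * ?g x) has_integral \<i> * (LINT t:{a..b}|lborel. f (Complex \<kappa> t))) {0..1}"
    by (rule has_integral_mult_right)
  then have "(f has_contour_integral \<i> * (LINT t:{a..b}|lborel. f (Complex \<kappa> t))) (linepath (Complex \<kappa> a) (Complex \<kappa> b))"
    unfolding has_contour_integral_linepath lp di by (simp add: scaleR_conv_of_real mult_ac)
  then show ?thesis by (rule contour_integral_unique)
qed

lemma has_vertical_integral_integrable:
  assumes g: "integrable lborel (\<lambda>t. f (Complex \<kappa> t))"
  shows "has_vertical_integral f (\<i> * (LINT t|lborel. f (Complex \<kappa> t))) \<kappa>"
proof -
  have "((\<lambda>p. \<i> * (case p of (a, b) \<Rightarrow> LINT t:{a..b}|lborel. f (Complex \<kappa> t))) \<longlongrightarrow>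
      \<i> * (LINT t|lborel. f (Complex \<kappa> t))) (at_bot \<times>\<^sub>F at_top)"
    by (intro tendsto_intros tendsto_integral_two_ended g)
  moreover have "\<forall>\<^sub>F p in at_bot \<times>\<^sub>F at_top. \<i> * (case p of (a, b) \<Rightarrow> LINT t:{a..b}|lborel. f (Complex \<kappa> t)) =
     (case p of (a, b) \<Rightarrow> contour_integral (linepath (Complex \<kappa> a) (Complex \<kappa> b)) f)"
  proof -
    have "\<forall>\<^sub>F p in at_bot \<times>\<^sub>F at_top. fst p < (0::real) \<and> (0::real) \<le> snd p"
      using eventually_prodI[OF eventually_gt_at_bot[of "0::real"] eventually_ge_at_top[of "0::real"]] .
    then show ?thesis
      by (rule eventually_mono) (auto simp: contour_integral_vertical_segment[OF g] split: prod.splits)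
  qed
  ultimately show ?thesis
    unfolding has_vertical_integral_def by (rule Lim_transform_eventually)
qed

text \<open>
  One separating line determines the value, because limits along the proper filter of the two independent
  ends are unique.
\<close>
lemma meijer_G_eqI:
  assumes "separates_poles m n as bs \<kappa>\<^sub>0"
    and "\<And>\<kappa>. separates_poles m n as bs \<kappa> \<Longrightarrow>
           has_vertical_integral (meijer_integrand m n as bs z) (2 * of_real pi * \<i> * w) \<kappa>"
  shows "meijer_G m n as bs z = w"
  unfolding meijer_G_def
proof (rule the_equality)
  fix v
  assume "\<forall>\<kappa>. separates_poles m n as bs \<kappa> \<longrightarrow>
           has_vertical_integral (meijer_integrand m n as bs z) (2 * of_real pi * \<i> * v) \<kappa>"
  then have v: "has_vertical_integral (meijer_integrand m n as bs z) (2 * of_real pi * \<i> * v) \<kappa>\<^sub>0"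
    using assms(1) by blast
  have "at_bot \<times>\<^sub>F at_top \<noteq> (bot :: (real \<times> real) filter)"
    by (simp add: prod_filter_eq_bot trivial_limit_at_bot_linorder trivial_limit_at_top_linorder)
  then have "2 * of_real pi * \<i> * v = 2 * of_real pi * \<i> * w"
    using v assms(2)[OF assms(1)] unfolding has_vertical_integral_def by (rule tendsto_unique)
  then show "v = w" by simp
qed (use assms in auto)

lemma is_pole_Gamma_iff: "is_pole Gamma z \<longleftrightarrow> z \<in> \<int>\<^sub>\<le>\<^sub>0" for z :: complex
proof
  assume "z \<in> \<int>\<^sub>\<le>\<^sub>0"
  then show "is_pole Gamma z" by (auto elim!: nonpos_Ints_cases' simp: is_pole_Gamma)
next
  assume *: "is_pole Gamma z"
  show "z \<in> \<int>\<^sub>\<le>\<^sub>0"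
  proof (rule ccontr)
    assume "z \<notin> \<int>\<^sub>\<le>\<^sub>0"
    then have "\<not> is_pole Gamma z"
      by (intro not_is_pole_holomorphic[of "- \<int>\<^sub>\<le>\<^sub>0"]) (auto intro!: holomorphic_intros open_Compl)
    then show False using * by simp
  qed
qed

lemma is_pole_Gamma_shift: "is_pole (\<lambda>s. Gamma (b + s)) s \<longleftrightarrow> b + s \<in> \<int>\<^sub>\<le>\<^sub>0" for b s :: complex
  using is_pole_shift_iff[of Gamma b s] by (simp add: o_def is_pole_Gamma_iff add.commute)

lemma is_pole_Gamma_reflect: "is_pole (\<lambda>s. Gamma (c - s)) s \<longleftrightarrow> c - s \<in> \<int>\<^sub>\<le>\<^sub>0" for c s :: complex
proof -
  have "filtermap (\<lambda>s. c - s) (at s) = at (c - s)"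
  proof -
    have "filtermap (\<lambda>s. c - s) (at s) = filtermap (\<lambda>x. x - (- c)) (filtermap uminus (at s))"
      by (simp add: filtermap_filtermap)
    also have "\<dots> = at (c - s)" by (simp only: filtermap_at_minus filtermap_at_shift) simp
    finally show ?thesis .
  qed
  from is_pole_compose_iff[OF this, of Gamma] show ?thesis by (simp add: o_def is_pole_Gamma_iff)
qed

lemma Re_nonpos_Int: "z \<in> \<int>\<^sub>\<le>\<^sub>0 \<Longrightarrow> Re z \<le> 0" for z :: complex
  by (auto elim!: nonpos_Ints_cases)

text \<open>
  The poles form arithmetic progressions running away from the line; only the first pole of each matters.
\<close>
lemma separates_poles_iff:
  fixes \<alpha> \<beta> \<gamma> \<delta> \<kappa> :: real
  shows "separates_poles 2 1 [- of_real \<delta>, of_real (\<alpha> + \<beta>)] [of_real \<alpha>, of_real \<gamma>] \<kappa> \<longleftrightarrow>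
    - \<alpha> < \<kappa> \<and> - \<gamma> < \<kappa> \<and> \<kappa> < 1 + \<delta>"
proof -
  have left: "(\<forall>s. is_pole (\<lambda>s. Gamma (complex_of_real b + s)) s \<longrightarrow> Re s < \<kappa>) \<longleftrightarrow> - b < \<kappa>" for b
  proof
    assume "\<forall>s. is_pole (\<lambda>s. Gamma (complex_of_real b + s)) s \<longrightarrow> Re s < \<kappa>"
    from this[rule_format, of "- of_real b"] show "- b < \<kappa>" by (simp add: is_pole_Gamma_shift)
  qed (auto simp: is_pole_Gamma_shift dest!: Re_nonpos_Int)
  have "(\<forall>s. is_pole (\<lambda>s. Gamma (1 + complex_of_real \<delta> - s)) s \<longrightarrow> \<kappa> < Re s) \<longleftrightarrow> \<kappa> < 1 + \<delta>"
  proof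
    assume "\<forall>s. is_pole (\<lambda>s. Gamma (1 + complex_of_real \<delta> - s)) s \<longrightarrow> \<kappa> < Re s"
    from this[rule_format, of "1 + of_real \<delta>"] show "\<kappa> < 1 + \<delta>" by (simp add: is_pole_Gamma_reflect)
  qed (auto simp: is_pole_Gamma_reflect dest!: Re_nonpos_Int)
  then show ?thesis
    unfolding separates_poles_def by (simp add: numeral_2_eq_2 left del: of_real_add)
qed

text \<open>
  The factor \<open>u powr (\<gamma> + \<kappa>)\<close> that comes out of Fourier inversion cancels the \<open>\<kappa>\<close>-dependence of
  \<open>u powr (- s)\<close>, so all separating lines give the same value. The line \<open>\<kappa> = 1\<close> is always separating.
\<close>
lemma meijer_G_line_integral:
  fixes \<alpha> \<beta> \<gamma> \<delta> u :: real
  assumes "\<alpha> > -1" and "\<gamma> > -1" and "\<beta> > 0" and "\<delta> > 0" and "u > 0"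
  defines "H \<equiv> \<lambda>y. exp (\<beta> * y) * (1 + exp y) powr (\<gamma> - \<alpha> - \<beta>) * (1 + u * (1 + exp y)) powr (- (\<gamma> + 1 + \<delta>))"
  shows "integrable lborel H"
    and "meijer_G 2 1 [- of_real \<delta>, of_real (\<alpha> + \<beta>)] [of_real \<alpha>, of_real \<gamma>] u =
           of_real (Gamma (\<gamma> + 1 + \<delta>) / Gamma \<beta> * u powr \<gamma> * (LINT y|lborel. H y))"
proof -
  define w where "w = Gamma (\<gamma> + 1 + \<delta>) / Gamma \<beta> * u powr \<gamma> * (LINT y|lborel. H y)"
  let ?f = "meijer_integrand 2 1 [- of_real \<delta>, of_real (\<alpha> + \<beta>)] [of_real \<alpha>, of_real \<gamma>] u"
  have main: "integrable lborel H \<and> has_vertical_integral ?f (2 * of_real pi * \<i> * of_real w) \<kappa>"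
    if sep: "- \<alpha> < \<kappa>" "- \<gamma> < \<kappa>" "\<kappa> < 1 + \<delta>" for \<kappa>
  proof -
    define p a b where "p = \<alpha> + \<kappa>" and "a = \<gamma> + \<kappa>" and "b = 1 + \<delta> - \<kappa>"
    have pos: "p > 0" "a > 0" "b > 0" using sep by (auto simp: p_def a_def b_def)
    define B where "B = (\<lambda>t. Beta (of_real p + \<i> * of_real t) (of_real \<beta>) * Beta (of_real a + \<i> * of_real t) (of_real b - \<i> * of_real t))"
    define H' where "H' = (\<lambda>y. exp (\<beta> * y - (\<beta> + p) * ln (1 + exp y)) *
             exp (a * (ln u + ln (1 + exp y)) - (a + b) * ln (1 + exp (ln u + ln (1 + exp y)))))"
    have *: "integrable lborel (\<lambda>t. B t * iexp (- (t * ln u)))" "integrable lborel H'"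
        "(LINT t|lborel. B t * iexp (- (t * ln u))) = 2 * of_real pi * of_real (LINT y|lborel. H' y)"
      unfolding B_def H'_def by (rule Beta_Beta_vertical_integral[OF pos(1) \<open>\<beta> > 0\<close> pos(2,3)])+
    have H': "H' y = u powr (\<gamma> + \<kappa>) * H y" for y
    proof -
      have pos1: "1 + exp y > 0" "1 + u * (1 + exp y) > 0" using \<open>u > 0\<close> by (auto intro!: add_pos_pos mult_pos_pos)
      have e: "exp (ln u + ln (1 + exp y)) = u * (1 + exp y)"
        using pos1 \<open>u > 0\<close> by (simp add: exp_add)
      show ?thesis
        unfolding H'_def H_def e using pos1 \<open>u > 0\<close>
        by (simp add: powr_def p_def a_def b_def algebra_simps flip: exp_add)
    qed
    have [simp]: "u powr (\<gamma> + \<kappa>) \<noteq> 0" using \<open>u > 0\<close> by simp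
    have "integrable lborel (\<lambda>y. u powr - (\<gamma> + \<kappa>) * H' y)" using *(2) by (rule integrable_mult_right)
    moreover have "u powr - (\<gamma> + \<kappa>) * H' y = H y" for y
      using \<open>u > 0\<close> by (simp only: H' powr_minus) simp
    ultimately have H: "integrable lborel H" by (simp only:)
    have f: "?f (Complex \<kappa> t) = of_real (Gamma (\<gamma> + 1 + \<delta>) / Gamma \<beta> * u powr (- \<kappa>)) * (B t * iexp (- (t * ln u)))" for t
    proof -
      have f: "?f s = Gamma (of_real \<alpha> + s) * Gamma (of_real \<gamma> + s) * Gamma (1 + of_real \<delta> - s) *
          rGamma (of_real \<alpha> + of_real \<beta> + s) * of_real u powr (- s)" for s
        by (simp add: meijer_integrand_def numeral_2_eq_2)
      have args: "of_real \<alpha> + Complex \<kappa> t = of_real p + \<i> * of_real t"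
          "of_real \<gamma> + Complex \<kappa> t = of_real a + \<i> * of_real t"
          "1 + of_real \<delta> - Complex \<kappa> t = of_real b - \<i> * of_real t"
          "of_real \<alpha> + of_real \<beta> + Complex \<kappa> t = of_real p + \<i> * of_real t + of_real \<beta>"
        by (auto simp: complex_eq_iff p_def a_def b_def)
      have sum: "of_real a + \<i> * of_real t + (of_real b - \<i> * of_real t) = complex_of_real (\<gamma> + 1 + \<delta>)"
        by (simp add: a_def b_def)
      have pw: "complex_of_real u powr (- Complex \<kappa> t) = of_real (u powr (- \<kappa>)) * iexp (- (t * ln u))"
        using \<open>u > 0\<close> unfolding powr_def Complex_eq
        by (simp add: Ln_of_real ring_distribs mult.assoc flip: exp_of_real exp_add)
      have "\<gamma> + 1 + \<delta> > 0" using assms(2,4) by linarith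
      then have "Gamma \<beta> \<noteq> 0" "Gamma (\<gamma> + 1 + \<delta>) \<noteq> 0"
        using Gamma_real_pos[OF assms(3)] Gamma_real_pos by fastforce+
      then have G: "Gamma (complex_of_real \<beta>) = of_real (Gamma \<beta>)" "of_real (Gamma \<beta>) \<noteq> (0 :: complex)"
          "complex_of_real (Gamma (\<gamma> + 1 + \<delta>)) * rGamma (complex_of_real (\<gamma> + 1 + \<delta>)) = 1"
        by (simp_all only: rGamma_inverse_Gamma Gamma_complex_of_real right_inverse of_real_eq_0_iff simp_thms)
      define c where "c = \<gamma> + 1 + \<delta>"
      show ?thesis
        using G(2,3) unfolding f args pw B_def Beta_altdef sum G(1) c_def[symmetric]
        by (simp add: field_simps)
    qed
    have "has_vertical_integral ?f (\<i> * (LINT t|lborel. ?f (Complex \<kappa> t))) \<kappa>"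
      by (rule has_vertical_integral_integrable) (unfold f, rule integrable_mult_right, rule *(1))
    moreover have "(LINT t|lborel. ?f (Complex \<kappa> t)) = 2 * of_real pi * of_real w"
    proof -
      have "(LINT t|lborel. ?f (Complex \<kappa> t)) = of_real (Gamma (\<gamma> + 1 + \<delta>) / Gamma \<beta> * u powr (- \<kappa>)) * (2 * of_real pi * of_real (LINT y|lborel. H' y))"
        unfolding f integral_mult_right_zero by (simp only: *(3))
      also have "(LINT y|lborel. H' y) = u powr (\<gamma> + \<kappa>) * (LINT y|lborel. H y)"
        unfolding H' by (rule integral_mult_right_zero)
      finally have "(LINT t|lborel. ?f (Complex \<kappa> t)) = 2 * of_real pi * of_real (Gamma (\<gamma> + 1 + \<delta>) / Gamma \<beta> * (u powr (- \<kappa>) * u powr (\<gamma> + \<kappa>)) * (LINT y|lborel. H y))"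
        by simp
      also have "u powr (- \<kappa>) * u powr (\<gamma> + \<kappa>) = u powr \<gamma>" by (simp flip: powr_add)
      finally show ?thesis by (simp only: w_def)
    qed
    ultimately show ?thesis using H by (simp add: mult_ac)
  qed
  have one: "- \<alpha> < 1" "- \<gamma> < 1" "1 < 1 + \<delta>" using assms by auto
  show "integrable lborel H" using main[OF one] by simp
  show "meijer_G 2 1 [- of_real \<delta>, of_real (\<alpha> + \<beta>)] [of_real \<alpha>, of_real \<gamma>] u = of_real w"
    using main one by (intro meijer_G_eqI[of _ _ _ _ 1]) (simp_all only: separates_poles_iff simp_thms)
qed

text \<open>
  The substitution is \<open>v = u (1 + exp y)\<close>.
\<close>
lemma substitution_half_line:
  fixes a b c u :: real
  assumes u: "u > 0"
  defines "H \<equiv> \<lambda>y. exp (b * y) * (1 + exp y) powr a * (1 + u * (1 + exp y)) powr c"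
  assumes int: "integrable lborel H"
  shows "set_integrable lborel {u<..} (\<lambda>v. v powr a * (v - u) powr (b - 1) * (1 + v) powr c)" (is ?th1)
    and "(LBINT v:{u<..}. v powr a * (v - u) powr (b - 1) * (1 + v) powr c) = u powr (a + b) * (LBINT y. H y)" (is ?th2)
proof -
  define f where "f = (\<lambda>v. v powr a * (v - u) powr (b - 1) * (1 + v) powr c)"
  define g where "g = (\<lambda>y. u * (1 + exp y))"
  have pos: "1 + exp y > 0" "1 + u * (1 + exp y) > 0" for y using u by (auto intro!: add_pos_pos mult_pos_pos)
  have fg: "f (g y) * (u * exp y) = u powr (a + b) * H y" for y
  proof -
    have "f (g y) * (u * exp y) = (u * (1 + exp y)) powr a * ((u * exp y) powr (b - 1) * (u * exp y)) * (1 + u * (1 + exp y)) powr c"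
      by (simp add: f_def g_def algebra_simps)
    also have "(u * exp y) powr (b - 1) * (u * exp y) = (u * exp y) powr b"
      using u by (intro powr_minus_one_mult) auto
    also have "(u * exp y) powr b = u powr b * exp (b * y)"
      using u by (simp add: powr_mult) (simp add: powr_def)
    also have "(u * (1 + exp y)) powr a = u powr a * (1 + exp y) powr a"
      using u pos(1)[of y] by (simp add: powr_mult)
    finally show ?thesis by (simp add: H_def powr_add mult_ac)
  qed
  have int': "set_integrable lborel (einterval (-\<infinity>) \<infinity>) (\<lambda>y. f (g y) * (u * exp y))"
    unfolding fg using int by (simp add: set_integrable_def)
  have e: "einterval (ereal u) \<infinity> = {u<..}" by (auto simp: einterval_def)
  have g_gt: "g x > u" "g x > 0" for x using u by (auto simp: g_def intro!: mult_pos_pos add_pos_pos)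
  have lims: "((ereal \<circ> g \<circ> real_of_ereal) \<longlongrightarrow> ereal u) (at_right (-\<infinity>))"
      "((ereal \<circ> g \<circ> real_of_ereal) \<longlongrightarrow> \<infinity>) (at_left \<infinity>)"
    unfolding ereal_tendsto_simps g_def using u by real_asymp+
  have contf: "isCont f (g x)" for x
    using g_gt[of x] u unfolding f_def by (intro continuous_intros) auto
  have *: "set_integrable lborel (einterval (ereal u) \<infinity>) f"
       "(LBINT x=ereal u..\<infinity>. f x) = (LBINT x=-\<infinity>..\<infinity>. (f (g x) * (u * exp x)))"
    using contf u by (intro interval_integral_substitution_nonneg[OF _ _ _ _ _ _ lims int'];
        force simp: g_def f_def intro!: continuous_intros derivative_eq_intros)+
  show ?th1 using *(1) by (simp add: e f_def)
  show ?th2 using *(2) unfolding fg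
    by (simp add: interval_lebesgue_integral_def e f_def set_lebesgue_integral_def)
qed

text \<open>
  The substitution is \<open>w = 1 / (1 + exp (- y))\<close>, which increases with \<open>y\<close>; \<open>H\<close> is met at \<open>- y\<close>.
\<close>
lemma substitution_unit_interval:
  fixes a b c u :: real
  assumes u: "u > 0"
  defines "H \<equiv> \<lambda>y. exp (b * y) * (1 + exp y) powr a * (1 + u * (1 + exp y)) powr c"
  assumes int: "integrable lborel H"
  shows "set_integrable lborel {0<..<1} (\<lambda>w. w powr (- a - b - c - 1) * (1 - w) powr (b - 1) * (w + u) powr c)" (is ?th1)
    and "(LBINT w:{0<..<1}. w powr (- a - b - c - 1) * (1 - w) powr (b - 1) * (w + u) powr c) = (LBINT y. H y)" (is ?th2)
proof -
  define f where "f = (\<lambda>w. w powr (- a - b - c - 1) * (1 - w) powr (b - 1) * (w + u) powr c)"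
  define g where "g = (\<lambda>y::real. 1 / (1 + exp (- y)))"
  have pos: "1 + exp y > 0" "1 + u * (1 + exp y) > 0" for y using u by (auto intro!: add_pos_pos mult_pos_pos)
  have fg: "f (g y) * (exp (- y) / (1 + exp (- y))\<^sup>2) = H (- y)" for y
  proof -
    define L where "L = 1 + exp (- y)"
    have L: "L > 0" "1 + u * L > 0" using pos[of "-y"] by (auto simp: L_def)
    have eq: "1 - 1 / L = exp (- y) / L" "1 / L + u = (1 + u * L) / L"
      using L by (auto simp: field_simps) (simp add: L_def)
    have "f (g y) * (exp (- y) / L\<^sup>2) =
        (1 / L) powr (- a - b - c - 1) * (exp (- y) / L) powr (b - 1) * ((1 + u * L) / L) powr c * (exp (- y) / L\<^sup>2)"
      unfolding f_def g_def L_def[symmetric] eq by simp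
    also have "\<dots> = exp ((- a - b - c - 1) * ln (1 / L) + (b - 1) * ln (exp (- y) / L) + c * ln ((1 + u * L) / L) + (- y - 2 * ln L))"
    proof -
      have "exp (- y) / L\<^sup>2 = exp (- y - 2 * ln L)"
        using L by (simp add: exp_diff exp_double)
      moreover have "1 / L \<noteq> 0" "exp (- y) / L \<noteq> 0" "(1 + u * L) / L \<noteq> 0" using L by auto
      ultimately show ?thesis by (simp only: powr_def exp_add if_False)
    qed
    also have "\<dots> = exp (b * (- y) + a * ln L + c * ln (1 + u * L))"
      using L by (simp add: ln_div algebra_simps)
    also have "\<dots> = H (- y)"
      unfolding H_def L_def[symmetric] using L by (simp add: powr_def flip: exp_add)
    finally show ?thesis by (simp only: L_def)
  qed
  have intr: "integrable lborel (\<lambda>y. H (- y))"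
    using lborel_integrable_real_affine[OF int, of "-1" 0] by simp
  have int': "set_integrable lborel (einterval (-\<infinity>) \<infinity>) (\<lambda>y. f (g y) * (exp (- y) / (1 + exp (- y))\<^sup>2))"
    unfolding fg using intr by (simp add: set_integrable_def)
  have e: "einterval (ereal 0) (ereal 1) = {0<..<1}" by auto
  have g_gt: "g x > 0" "g x < 1" for x using pos[of "-x"] by (auto simp: g_def)
  have lims: "((ereal \<circ> g \<circ> real_of_ereal) \<longlongrightarrow> ereal 0) (at_right (-\<infinity>))"
      "((ereal \<circ> g \<circ> real_of_ereal) \<longlongrightarrow> ereal 1) (at_left \<infinity>)"
    unfolding ereal_tendsto_simps g_def by real_asymp+
  have contf: "isCont f (g x)" for x
    using g_gt[of x] u unfolding f_def by (intro continuous_intros) auto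
  have nz: "1 + exp (- x) \<noteq> 0" for x :: real using pos(1)[of "-x"] by simp
  have deriv: "DERIV g x :> exp (- x) / (1 + exp (- x))\<^sup>2" for x
    unfolding g_def using nz[of x] by (auto intro!: derivative_eq_intros simp: power2_eq_square)
  have contg: "isCont (\<lambda>x. exp (- x) / (1 + exp (- x))\<^sup>2) x" for x :: real
    using nz[of x] by (intro continuous_intros) auto
  have f_nn: "f (g x) \<ge> 0" for x by (simp add: f_def)
  have *: "set_integrable lborel (einterval (ereal 0) (ereal 1)) f"
       "(LBINT x=ereal 0..ereal 1. f x) = (LBINT x=-\<infinity>..\<infinity>. (f (g x) * (exp (- x) / (1 + exp (- x))\<^sup>2)))"
    by (intro interval_integral_substitution_nonneg[OF _ _ _ _ _ _ lims int'] deriv contf contg f_nn; simp)+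
  show ?th1 using *(1) by (simp add: f_def)
  have "(LBINT y. H y) = (LBINT y. H (- y))"
    using lborel_integral_real_affine[of "-1" H 0] by simp
  then show ?th2 using *(2) unfolding fg
    by (simp add: interval_lebesgue_integral_def f_def set_lebesgue_integral_def)
qed

lemma meijer_G_integrals:
  fixes \<alpha> \<beta> \<gamma> \<delta> u :: real
  assumes "\<alpha> > -1" and "\<gamma> > -1" and "\<beta> > 0" and "\<delta> > 0" and "u > 0"
  shows "set_integrable lborel {u<..}
           (\<lambda>v. v powr (\<gamma> - \<alpha> - \<beta>) * (v - u) powr (\<beta> - 1) * (1 + v) powr (- (\<gamma> + 1 + \<delta>)))" (is ?th1)
    and "set_integrable lborel {0<..<1}
           (\<lambda>v. v powr (\<alpha> + \<delta>) * (1 - v) powr (\<beta> - 1) * (v + u) powr (- (\<gamma> + 1 + \<delta>)))" (is ?th2)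
    and "meijer_G 2 1 [- of_real \<delta>, of_real (\<alpha> + \<beta>)] [of_real \<alpha>, of_real \<gamma>] u =
       of_real (Gamma (\<gamma> + 1 + \<delta>) / Gamma \<beta> * u powr \<alpha> *
         (LBINT v:{u<..}.
            v powr (\<gamma> - \<alpha> - \<beta>) * (v - u) powr (\<beta> - 1) * (1 + v) powr (- (\<gamma> + 1 + \<delta>))))" (is ?th3)
    and "meijer_G 2 1 [- of_real \<delta>, of_real (\<alpha> + \<beta>)] [of_real \<alpha>, of_real \<gamma>] u =
       of_real (Gamma (\<gamma> + 1 + \<delta>) / Gamma \<beta> * u powr \<gamma> *
         (LBINT v:{0<..<1}.
            v powr (\<alpha> + \<delta>) * (1 - v) powr (\<beta> - 1) * (v + u) powr (- (\<gamma> + 1 + \<delta>))))" (is ?th4)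
proof -
  note G = meijer_G_line_integral[OF assms]
  note hl = substitution_half_line[OF \<open>u > 0\<close> G(1)]
  note ui = substitution_unit_interval[OF \<open>u > 0\<close> G(1)]
  have e1: "- (\<gamma> - \<alpha> - \<beta>) - \<beta> - - (\<gamma> + 1 + \<delta>) - 1 = \<alpha> + \<delta>" by simp
  have e2: "u powr \<alpha> * u powr (\<gamma> - \<alpha> - \<beta> + \<beta>) = u powr \<gamma>" by (simp flip: powr_add)
  show ?th1 by (rule hl(1))
  show ?th2 using ui(1) unfolding e1 .
  show ?th3 unfolding G(2) hl(2) e2[symmetric] by (simp only: mult.assoc)
  show ?th4 unfolding G(2) ui(2)[unfolded e1] ..
qed

section \<open>Power series integrated against a weight on the unit interval\<close>

lemma gchoose_neg_pochhammer:
  "((- c) gchoose n) * (- x) ^ n = pochhammer c n / fact n * x ^ n" for c x :: "'a :: field_char_0"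
proof -
  have "((- c) gchoose n) * (- x) ^ n = ((- 1) * (- 1)) ^ n * (pochhammer c n / fact n * x ^ n)"
    unfolding gbinomial_pochhammer power_mult_distrib power_minus[of x] by simp
  then show ?thesis by simp
qed

lemma binomial_series_complex:
  "norm x < 1 \<Longrightarrow> (\<lambda>n. pochhammer c n / fact n * x ^ n) sums (1 - x) powr (- c)" for c x :: complex
  using gen_binomial_complex[of "- x" "- c"] by (simp add: gchoose_neg_pochhammer)

lemma binomial_series_real:
  "\<bar>x\<bar> < 1 \<Longrightarrow> (\<lambda>n. pochhammer c n / fact n * x ^ n) sums (1 - x) powr (- c)" for c x :: real
  using gen_binomial_real[of "- x" "- c"] by (simp add: gchoose_neg_pochhammer)

lemma binomial_series_abs_summable:
  fixes c x :: "'a :: {real_normed_field, banach}"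
  assumes "norm x < 1"
  shows "summable (\<lambda>n. norm (pochhammer c n / fact n * x ^ n))"
proof -
  have "summable (\<lambda>n. norm (((- c) gchoose n) * (- x) ^ n))"
    by (rule abs_summable_in_conv_radius) (use assms in \<open>simp add: conv_radius_gchoose\<close>)
  then show ?thesis by (simp only: gchoose_neg_pochhammer)
qed

lemma set_integrable_mult_bounded:
  fixes g h :: "real \<Rightarrow> 'a :: {real_normed_field, banach, second_countable_topology}"
  assumes "set_integrable lborel A g" "h \<in> borel_measurable borel" "\<And>v. v \<in> A \<Longrightarrow> norm (h v) \<le> K"
  shows "set_integrable lborel A (\<lambda>v. g v * h v)"
  unfolding set_integrable_def
proof (rule Bochner_Integration.integrable_bound)
  show "integrable lborel (\<lambda>v. K * norm (indicator A v *\<^sub>R g v))"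
    using assms(1) unfolding set_integrable_def by (intro integrable_mult_right integrable_norm)
  have "(\<lambda>v. (indicator A v *\<^sub>R g v) * h v) \<in> borel_measurable lborel"
    using assms(1,2) unfolding set_integrable_def by (intro borel_measurable_times) (auto dest: borel_measurable_integrable)
  then show "(\<lambda>v. indicator A v *\<^sub>R (g v * h v)) \<in> borel_measurable lborel" by simp
  have "norm (g v * h v) \<le> K * norm (g v) \<and> 0 \<le> K * norm (g v)" if "v \<in> A" for v
  proof
    show "norm (g v * h v) \<le> K * norm (g v)"
      using mult_right_mono[OF assms(3)[OF that] norm_ge_zero[of "g v"]] by (simp add: norm_mult mult.commute)
    then show "0 \<le> K * norm (g v)" using norm_ge_zero order_trans by blast
  qed
  then show "AE v in lborel. norm (indicator A v *\<^sub>R (g v * h v)) \<le> norm (K * norm (indicator A v *\<^sub>R g v))"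
    by (intro AE_I2) (auto simp: indicator_def)
qed

text \<open>
  Termwise integration only needs the integrals of the norms to be summable. Taking weighted moments of
  \<open>norm (g v)\<close> into account, rather than the coefficients alone, is what admits the binomial series of
  \<open>(1 - v) powr (\<beta> - 1)\<close> with its singularity at the end of the interval.
\<close>
lemma sums_set_integral_power_series:
  fixes g :: "real \<Rightarrow> 'a :: {real_normed_field, banach, second_countable_topology}" and c :: "nat \<Rightarrow> 'a"
  assumes g: "set_integrable lborel {0<..<1} g"
    and c: "summable (\<lambda>n. norm (c n) * (LBINT v:{0<..<1}. norm (g v) * v ^ n))"
    and S: "\<And>v. v \<in> {0<..<1} \<Longrightarrow> (\<lambda>n. c n * of_real v ^ n) sums S v"
  shows "(\<lambda>n. c n * (LBINT v:{0<..<1}. g v * of_real v ^ n)) sums (LBINT v:{0<..<1}. g v * S v)"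
proof -
  define f where "f = (\<lambda>n v. indicator {0<..<1} v *\<^sub>R (g v * (c n * of_real v ^ n)))"
  have int: "integrable lborel (f n)" for n
  proof -
    have "set_integrable lborel {0<..<1} (\<lambda>v. g v * (c n * of_real v ^ n))"
      by (rule set_integrable_mult_bounded[OF g, where K = "norm (c n)"])
         (auto simp: norm_mult norm_power power_le_one intro!: mult_left_le)
    then show ?thesis by (simp add: set_integrable_def f_def)
  qed
  have f_sum: "(\<lambda>n. f n v) sums (indicator {0<..<1} v *\<^sub>R (g v * S v))" for v
    unfolding f_def by (cases "v \<in> {0<..<1}") (auto intro!: sums_mult S sums_scaleR_right)
  have abs: "summable (\<lambda>n. norm (f n v))" for v
  proof (cases "v \<in> {0<..<1}")
    case True
    define w where "w = (1 + v) / 2"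
    have w: "w \<in> {0<..<1}" "v < w" using True by (auto simp: w_def)
    have "summable (\<lambda>n. norm (c n * of_real v ^ n))"
      by (rule powser_insidea[OF sums_summable[OF S[OF w(1)]]]) (use w True in auto)
    then have "summable (\<lambda>n. norm (g v) * norm (c n * of_real v ^ n))" by (rule summable_mult)
    then show ?thesis using True by (simp add: f_def norm_mult)
  qed (simp add: f_def)
  have nint: "(LINT v|lborel. norm (f n v)) = norm (c n) * (LBINT v:{0<..<1}. norm (g v) * v ^ n)" for n
    unfolding set_lebesgue_integral_def integral_mult_right_zero[symmetric] f_def
    by (intro Bochner_Integration.integral_cong) (auto simp: indicator_def norm_mult norm_power)
  have "(\<lambda>n. LINT v|lborel. f n v) sums (LINT v|lborel. (\<Sum>n. f n v))"
    by (rule sums_integral) (use int abs nint c in auto)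
  also have "(LINT v|lborel. (\<Sum>n. f n v)) = (LBINT v:{0<..<1}. g v * S v)"
    unfolding set_lebesgue_integral_def by (simp only: sums_unique[OF f_sum, symmetric])
  also have "(\<lambda>n. LINT v|lborel. f n v) = (\<lambda>n. c n * (LBINT v:{0<..<1}. g v * of_real v ^ n))"
    unfolding set_lebesgue_integral_def integral_mult_right_zero[symmetric] f_def
    by (intro ext Bochner_Integration.integral_cong) (auto simp: mult_ac scaleR_conv_of_real)
  finally show ?thesis .
qed

lemma Beta_set_integral:
  fixes a b :: real
  assumes "a > 0" "b > 0"
  shows "set_integrable lborel {0<..<1} (\<lambda>v. v powr (a - 1) * (1 - v) powr (b - 1))"
    and "(LBINT v:{0<..<1}. v powr (a - 1) * (1 - v) powr (b - 1)) = Beta a b"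
proof -
  have hi: "((\<lambda>v. v powr (a - 1) * (1 - v) powr (b - 1)) has_integral Beta a b) {0<..<1}"
    using has_integral_Beta_real[OF assms] by (simp add: has_integral_Icc_iff_Ioo)
  show si: "set_integrable lborel {0<..<1} (\<lambda>v. v powr (a - 1) * (1 - v) powr (b - 1))"
    by (rule absolutely_integrable_imp_lborel, rule nonnegative_absolutely_integrable_1)
       (use hi in \<open>auto simp: has_integral_integrable\<close>)
  show "(LBINT v:{0<..<1}. v powr (a - 1) * (1 - v) powr (b - 1)) = Beta a b"
    using set_borel_integral_eq_integral(2)[OF si] hi by (simp add: integral_unique)
qed

lemma Beta_moment:
  fixes a b :: real
  assumes "a > 0" "b > 0"
  shows "(LBINT v:{0<..<1}. v powr (a - 1) * (1 - v) powr (b - 1) * v ^ n) = Beta (a + real n) b"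
proof -
  have "(LBINT v:{0<..<1}. v powr (a - 1) * (1 - v) powr (b - 1) * v ^ n) =
      (LBINT v:{0<..<1}. v powr (a + real n - 1) * (1 - v) powr (b - 1))"
    by (intro set_lebesgue_integral_cong) (auto simp: powr_realpow[symmetric] powr_add powr_diff)
  also have "\<dots> = Beta (a + real n) b"
    using assms by (intro Beta_set_integral(2)) auto
  finally show ?thesis .
qed

lemma Beta_pochhammer:
  fixes a b :: real
  assumes "a > 0" "b > 0"
  shows "Beta (a + real n) b = Beta a b * pochhammer a n / pochhammer (a + b) n"
proof (induction n)
  case (Suc n)
  have "a + real n \<notin> \<int>\<^sub>\<le>\<^sub>0" using assms by (auto elim!: nonpos_Ints_cases)
  from Beta_plus1_left[OF this, of b]
  have "(a + b + real n) * Beta (a + real (Suc n)) b = (a + real n) * Beta (a + real n) b"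
    by (simp add: algebra_simps)
  moreover have "a + b + real n \<noteq> 0"
    using assms by simp
  ultimately have "Beta (a + real (Suc n)) b = (a + real n) * Beta (a + real n) b / (a + b + real n)"
    by (metis nonzero_mult_div_cancel_left)
  then show ?case
    by (simp only: Suc pochhammer_Suc) simp
qed simp

lemma power_moment:
  fixes s :: real
  assumes s: "s > 0"
  shows "set_integrable lborel {0<..<1} (\<lambda>v. v powr (s - 1))"
    and "(LBINT v:{0<..<1}. v powr (s - 1) * v ^ n) = 1 / (s + real n)"
proof -
  show "set_integrable lborel {0<..<1} (\<lambda>v. v powr (s - 1))"
    using Beta_set_integral(1)[OF s zero_less_one]
    by (rule set_integrable_cong[THEN iffD1, rotated -1]) auto
  have "(LBINT v:{0<..<1}. v powr (s - 1) * v ^ n) = (LBINT v:{0<..<1}. v powr (s - 1) * (1 - v) powr (1 - 1) * v ^ n)"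
    by (intro set_lebesgue_integral_cong) auto
  also have "\<dots> = Beta (s + real n) 1" by (rule Beta_moment[OF s zero_less_one])
  also have "\<dots> = 1 / (s + real n)"
  proof -
    have "s + real n \<notin> \<int>\<^sub>\<le>\<^sub>0" "s + real n \<noteq> 0" using s by (auto elim!: nonpos_Ints_cases)
    then show ?thesis by (simp add: Beta_def Gamma_plus1 Gamma_eq_zero_iff)
  qed
  finally show "(LBINT v:{0<..<1}. v powr (s - 1) * v ^ n) = 1 / (s + real n)" .
qed

section \<open>The integral representation of Euler\<close>

text \<open>
  By Cauchy's inequality the dominating function also bounds the derivatives of the integrand on a smaller
  disc. Hence it bounds the difference quotients, and dominated convergence differentiates under the integral sign.
\<close>
lemma holomorphic_on_integral_dominated:
  fixes f :: "complex \<Rightarrow> 'a \<Rightarrow> complex"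
  assumes S: "open S"
    and hol: "\<And>x. x \<in> space M \<Longrightarrow> (\<lambda>z. f z x) holomorphic_on S"
    and meas: "\<And>z. z \<in> S \<Longrightarrow> f z \<in> borel_measurable M"
    and bd: "\<And>z x. z \<in> S \<Longrightarrow> x \<in> space M \<Longrightarrow> norm (f z x) \<le> G x"
    and G: "integrable M G"
  shows "(\<lambda>z. LINT x|M. f z x) holomorphic_on S"
proof -
  have int: "integrable M (f z)" if "z \<in> S" for z
    by (rule Bochner_Integration.integrable_bound[OF G meas[OF that]])
       (use bd[OF that] in \<open>auto intro!: AE_I2 intro: order_trans[OF _ abs_ge_self]\<close>)
  have "\<exists>D. ((\<lambda>z. LINT x|M. f z x) has_field_derivative D) (at z)" if z: "z \<in> S" for z
  proof -
    obtain r where r: "r > 0" "cball z r \<subseteq> S"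
      using S z by (meson open_contains_cball)
    define D where "D = (\<lambda>x. deriv (\<lambda>w. f w x) z)"
    have lip: "norm (f (z + h) x - f z x) \<le> 2 * G x / r * norm h" if x: "x \<in> space M" and h: "norm h < r / 2" for x h
    proof -
      have deriv_bd: "norm (deriv (\<lambda>w. f w x) w) \<le> 2 * G x / r" if w: "w \<in> ball z (r / 2)" for w
      proof -
        have sub: "cball w (r / 2) \<subseteq> S"
        proof
          fix y assume "y \<in> cball w (r / 2)"
          then have "dist z y \<le> r" using w dist_triangle[of z y w] by (auto simp: dist_commute)
          then show "y \<in> S" using r by auto
        qed
        have "norm ((deriv ^^ 1) (\<lambda>w. f w x) w) \<le> fact 1 * G x / (r / 2) ^ 1"
        proof (rule Cauchy_inequality)
          show "(\<lambda>w. f w x) holomorphic_on ball w (r / 2)"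
            using hol[OF x] by (rule holomorphic_on_subset) (use sub ball_subset_cball in blast)
          show "continuous_on (cball w (r / 2)) (\<lambda>w. f w x)"
            using holomorphic_on_imp_continuous_on[OF hol[OF x]] sub continuous_on_subset by blast
          show "norm (f y x) \<le> G x" if "norm (w - y) = r / 2" for y
            using sub that x by (intro bd) (auto simp: dist_norm)
        qed (use r in auto)
        then show ?thesis by (simp add: field_simps)
      qed
      have "norm (f (z + h) x - f z x) \<le> 2 * G x / r * norm (z + h - z)"
      proof (rule field_differentiable_bound[where S = "ball z (r / 2)"])
        fix w assume w: "w \<in> ball z (r / 2)"
        then have "w \<in> S" using r by auto
        then show "((\<lambda>w. f w x) has_field_derivative deriv (\<lambda>w. f w x) w) (at w within ball z (r / 2))"
          using holomorphic_derivI[OF hol[OF x] S] has_field_derivative_at_within by blast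
        show "norm (deriv (\<lambda>w. f w x) w) \<le> 2 * G x / r" by (rule deriv_bd[OF w])
      qed (use r h in \<open>auto simp: dist_norm\<close>)
      then show ?thesis by simp
    qed
    have "((\<lambda>z. LINT x|M. f z x) has_field_derivative (LINT x|M. D x)) (at z)"
      unfolding DERIV_def tendsto_at_iff_sequentially
    proof safe
      fix X :: "nat \<Rightarrow> complex"
      assume X: "\<forall>i. X i \<in> UNIV - {0}" "X \<longlonglongrightarrow> 0"
      then have "eventually (\<lambda>i. norm (X i) < r / 2) sequentially"
        using tendstoD[OF X(2), of "r / 2"] r by simp
      then obtain N where N: "norm (X i) < r / 2" if "i \<ge> N" for i
        by (auto simp: eventually_sequentially)
      \<comment> \<open>Dropping the initial terms keeps the whole sequence in the disc where the difference quotients are dominated.\<close>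
      define Y where "Y = (\<lambda>i. X (i + N))"
      have Y: "Y \<longlonglongrightarrow> 0" "norm (Y i) < r / 2" "Y i \<noteq> 0" "z + Y i \<in> S" for i
      proof -
        show "Y \<longlonglongrightarrow> 0" unfolding Y_def using X(2) by (rule LIMSEQ_ignore_initial_segment)
        show *: "norm (Y i) < r / 2" "Y i \<noteq> 0" using N X(1) by (auto simp: Y_def)
        show "z + Y i \<in> S" using * r by (intro subsetD[OF r(2)]) (auto simp: dist_norm)
      qed
      have "(\<lambda>i. LINT x|M. (f (z + Y i) x - f z x) / Y i) \<longlonglongrightarrow> (LINT x|M. D x)"
      proof (rule integral_dominated_convergence)
        show "integrable M (\<lambda>x. 2 * G x / r)" using G by auto
        have lim: "(\<lambda>i. (f (z + Y i) x - f z x) / Y i) \<longlonglongrightarrow> D x" if x: "x \<in> space M" for x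
        proof -
          have "((\<lambda>w. f w x) has_field_derivative D x) (at z)"
            unfolding D_def using holomorphic_derivI[OF hol[OF x] S z] .
          then have "((\<lambda>h. (f (z + h) x - f z x) / h) \<longlongrightarrow> D x) (at 0)" by (simp add: DERIV_def)
          then show ?thesis
            by (rule filterlim_compose) (use Y in \<open>auto simp: filterlim_at\<close>)
        qed
        then show "AE x in M. (\<lambda>i. (f (z + Y i) x - f z x) / Y i) \<longlonglongrightarrow> D x" by auto
        show meas_q: "(\<lambda>x. (f (z + Y i) x - f z x) / Y i) \<in> borel_measurable M" for i
          using meas[OF z] meas[OF Y(4)] by measurable
        show "D \<in> borel_measurable M"
          using lim meas_q by (rule borel_measurable_LIMSEQ_metric[rotated])
        show "AE x in M. norm ((f (z + Y i) x - f z x) / Y i) \<le> 2 * G x / r" for i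
          using lip[OF _ Y(2)] Y(3) by (intro AE_I2) (auto simp: norm_divide divide_le_eq)
      qed
      moreover have "(LINT x|M. (f (z + Y i) x - f z x) / Y i) = ((LINT x|M. f (z + Y i) x) - (LINT x|M. f z x)) / Y i" for i
        using int[OF z] int[OF Y(4)] by (simp add: Bochner_Integration.integral_diff)
      ultimately have "(\<lambda>i. ((\<lambda>h. ((LINT x|M. f (z + h) x) - (LINT x|M. f z x)) / h) \<circ> X) (i + N)) \<longlonglongrightarrow> (LINT x|M. D x)"
        by (simp only: Y_def o_def)
      then show "((\<lambda>h. ((LINT x|M. f (z + h) x) - (LINT x|M. f z x)) / h) \<circ> X) \<longlonglongrightarrow> (LINT x|M. D x)"
        by (rule LIMSEQ_offset)
    qed
    then show ?thesis by blast
  qed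
  then show ?thesis
    using S by (simp add: holomorphic_on_open)
qed

lemma one_minus_mult_not_nonpos_Reals:
  assumes z: "z \<in> hyp2F1_slit_plane" and v: "v \<in> {0..1}"
  shows "1 - z * of_real v \<notin> \<real>\<^sub>\<le>\<^sub>0"
proof
  assume "1 - z * of_real v \<in> \<real>\<^sub>\<le>\<^sub>0"
  then have im: "Im z * v = 0" and re: "Re z * v \<ge> 1" by (auto simp: complex_nonpos_Reals_iff)
  have "v > 0" using re v by (cases "v = 0") auto
  then have "Im z = 0" using im by simp
  have "1 \<le> Re z"
  proof (rule ccontr)
    assume "\<not> 1 \<le> Re z"
    then have "Re z * v < 1 * v" using \<open>v > 0\<close> by (intro mult_strict_right_mono) auto
    then show False using re v by simp
  qed
  then have "z \<in> of_real ` {1..}"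
    using \<open>Im z = 0\<close> by (auto simp: image_iff complex_eq_iff)
  then show False using z by (simp add: hyp2F1_slit_plane_def)
qed

text \<open>
  The power is bounded on a compact disc in the slit plane times the closed unit interval, so the weight
  \<open>g\<close> times a constant dominates the integrand locally.
\<close>
lemma euler_integral_holomorphic:
  fixes g :: "real \<Rightarrow> complex" and a :: complex
  assumes g: "set_integrable lborel {0<..<1} g"
  shows "(\<lambda>z. LBINT v:{0<..<1}. g v * (1 - z * of_real v) powr (- a)) holomorphic_on hyp2F1_slit_plane"
proof -
  let ?S = "hyp2F1_slit_plane"
  let ?F = "\<lambda>z. LBINT v:{0<..<1}. g v * (1 - z * of_real v) powr (- a)"
  have "\<exists>r>0. ?F holomorphic_on ball z r" if z: "z \<in> ?S" for z
  proof -
    obtain r where r: "r > 0" "cball z r \<subseteq> ?S"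
      using open_hyp2F1_slit_plane z by (meson open_contains_cball)
    define K where "K = (\<lambda>p. (1 - fst p * complex_of_real (snd p)) powr (- a)) ` (cball z r \<times> {0..1})"
    have "compact K"
      unfolding K_def
    proof (rule compact_continuous_image)
      have nn: "1 - fst p * complex_of_real (snd p) \<notin> \<real>\<^sub>\<le>\<^sub>0" if "p \<in> cball z r \<times> {0..1}" for p
        using that r by (intro one_minus_mult_not_nonpos_Reals) auto
      have "continuous_on (cball z r \<times> {0..1}) (\<lambda>p. exp (- a * Ln (1 - fst p * complex_of_real (snd p))))"
        by (intro continuous_intros nn)
      moreover have "exp (- a * Ln (1 - fst p * complex_of_real (snd p))) = (1 - fst p * complex_of_real (snd p)) powr (- a)"
        if "p \<in> cball z r \<times> {0..1}" for p
        using nn[OF that] unfolding powr_def by (metis nonpos_Reals_zero_I)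
      ultimately show "continuous_on (cball z r \<times> {0..1}) (\<lambda>p. (1 - fst p * complex_of_real (snd p)) powr (- a))"
        by (simp only: cong: continuous_on_cong)
      show "compact (cball z r \<times> {0..1::real})" by (intro compact_Times compact_cball compact_Icc)
    qed
    then obtain C where C: "norm x \<le> C" if "x \<in> K" for x
      using compact_imp_bounded bounded_iff by metis
    have bd: "norm ((1 - w * of_real v) powr (- a)) \<le> C" if "w \<in> ball z r" "v \<in> {0<..<1}" for w v
      using that by (intro C) (force simp: K_def)
    have sub: "w \<in> ?S" if "w \<in> ball z r" for w using r that by auto
    have "?F holomorphic_on ball z r"
      unfolding set_lebesgue_integral_def
    proof (rule holomorphic_on_integral_dominated)
      show "integrable lborel (\<lambda>v. C * norm (indicator {0<..<1} v *\<^sub>R g v))"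
        using g unfolding set_integrable_def by (intro integrable_mult_right integrable_norm)
      fix w assume w: "w \<in> ball z r"
      have "set_integrable lborel {0<..<1} (\<lambda>v. g v * (1 - w * of_real v) powr (- a))"
        by (rule set_integrable_mult_bounded[OF g _ bd[OF w]]) auto
      then show "(\<lambda>v. indicator {0<..<1} v *\<^sub>R (g v * (1 - w * of_real v) powr (- a))) \<in> borel_measurable lborel"
        unfolding set_integrable_def by (rule borel_measurable_integrable)
      show "norm (indicator {0<..<1} v *\<^sub>R (g v * (1 - w * of_real v) powr (- a))) \<le>
          C * norm (indicator {0<..<1} v *\<^sub>R g v)" for v
        using mult_right_mono[OF bd[OF w], of v "norm (g v)"] by (auto simp: indicator_def norm_mult mult.commute)
    next
      fix v :: real
      show "(\<lambda>w. indicator {0<..<1} v *\<^sub>R (g v * (1 - w * of_real v) powr (- a))) holomorphic_on ball z r"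
      proof (cases "v \<in> {0<..<1}")
        case True
        then show ?thesis
          using one_minus_mult_not_nonpos_Reals[OF sub]
          unfolding scaleR_conv_of_real by (intro holomorphic_intros) auto
      qed simp
    qed auto
    then show ?thesis using r by blast
  qed
  then show ?thesis
    using open_hyp2F1_slit_plane holomorphic_on_imp_differentiable_at
    by (metis (no_types, lifting) at_within_open centre_in_ball field_differentiable_def holomorphic_on_def open_ball)
qed

text \<open>
  In the unit disc the binomial series may be integrated term by term, and the moments of the Beta density
  supply the missing Pochhammer quotients. Outside the disc the two sides agree as continuations.
\<close>
lemma hyp2F1_euler_integral:
  fixes a b \<beta> :: real
  assumes b: "b > 0" and \<beta>: "\<beta> > 0" and z: "z \<in> hyp2F1_slit_plane"
  shows "of_real (Beta b \<beta>) * hyp2F1 (of_real b) (of_real a) (of_real (b + \<beta>)) z =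
     (LBINT v:{0<..<1}. of_real (v powr (b - 1) * (1 - v) powr (\<beta> - 1)) * (1 - z * of_real v) powr (- of_real a))"
proof -
  define g where "g = (\<lambda>v. complex_of_real (v powr (b - 1) * (1 - v) powr (\<beta> - 1)))"
  define F where "F = (\<lambda>z. (LBINT v:{0<..<1}. g v * (1 - z * of_real v) powr (- of_real a)) / of_real (Beta b \<beta>))"
  note gr = Beta_set_integral(1)[OF b \<beta>]
  have g: "set_integrable lborel {0<..<1} g"
    using gr unfolding set_integrable_def g_def scaleR_conv_of_real of_real_mult[symmetric]
      complex_of_real_integrable_eq by simp
  have Bpos: "Beta b \<beta> > 0" using b \<beta> by (simp add: Beta_def)
  have moment: "(LBINT v:{0<..<1}. g v * of_real v ^ n) = of_real (Beta (b + real n) \<beta>)" for n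
    unfolding Beta_moment[OF b \<beta>, symmetric] set_lebesgue_integral_def g_def integral_complex_of_real[symmetric]
    by (simp add: scaleR_conv_of_real)
  have nmoment: "(LBINT v:{0<..<1}. norm (g v) * v ^ n) = Beta (b + real n) \<beta>" for n
    unfolding Beta_moment[OF b \<beta>, symmetric] by (intro set_lebesgue_integral_cong) (auto simp: g_def norm_mult)
  have series: "F x = hyp2F1_series (of_real b) (of_real a) (of_real (b + \<beta>)) x" if x: "x \<in> ball 0 1" for x
  proof -
    let ?c = "\<lambda>n. pochhammer (complex_of_real a) n / fact n * x ^ n"
    have "(\<lambda>n. ?c n * (LBINT v:{0<..<1}. g v * of_real v ^ n)) sums
        (LBINT v:{0<..<1}. g v * (1 - x * of_real v) powr (- of_real a))"
    proof (rule sums_set_integral_power_series[OF g])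
      have "Beta (b + real n) \<beta> \<le> Beta b \<beta> \<and> 0 \<le> Beta (b + real n) \<beta>" for n
      proof -
        have "Beta (b + real n) \<beta> \<le> Beta b \<beta>" using b \<beta> by (intro Beta_real_mono) auto
        then show ?thesis using b \<beta> by (simp add: Beta_def add_pos_nonneg less_imp_le)
      qed
      then have "norm (norm (?c n) * Beta (b + real n) \<beta>) \<le> norm (?c n) * Beta b \<beta>" for n
        by (simp add: abs_mult mult_left_mono del: norm_mult norm_divide norm_power)
      then have "norm (norm (?c n) * (LBINT v:{0<..<1}. norm (g v) * v ^ n)) \<le> norm (?c n) * Beta b \<beta>" for n
        by (simp only: nmoment)
      moreover have "summable (\<lambda>n. norm (?c n) * Beta b \<beta>)"
        using binomial_series_abs_summable[of x "of_real a"] x by (intro summable_mult2) simp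
      ultimately show "summable (\<lambda>n. norm (?c n) * (LBINT v:{0<..<1}. norm (g v) * v ^ n))"
        by (rule summable_comparison_test'[where N = 0, rotated])
      fix v :: real
      assume v: "v \<in> {0<..<1}"
      have "norm (x * of_real v) < 1"
        using v x mult_strict_mono[of "norm x" 1 v 1] by (auto simp: norm_mult)
      from binomial_series_complex[OF this, of "of_real a"]
      show "(\<lambda>n. ?c n * of_real v ^ n) sums (1 - x * of_real v) powr (- of_real a)"
        by (simp add: power_mult_distrib mult_ac)
    qed
    then have "(\<lambda>n. ?c n * of_real (Beta (b + real n) \<beta>) / of_real (Beta b \<beta>)) sums F x"
      unfolding moment F_def by (rule sums_divide)
    moreover have "?c n * of_real (Beta (b + real n) \<beta>) / of_real (Beta b \<beta>) =
       pochhammer (of_real b) n * pochhammer (of_real a) n / (pochhammer (of_real (b + \<beta>)) n * fact n) * x ^ n" for n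
      using Bpos unfolding Beta_pochhammer[OF b \<beta>]
      by (simp add: pochhammer_of_real mult_ac del: of_real_add)
    ultimately show ?thesis
      unfolding hyp2F1_series_altdef by (simp add: sums_iff)
  qed
  have "F holomorphic_on hyp2F1_slit_plane"
    unfolding F_def using Bpos by (intro holomorphic_intros euler_integral_holomorphic g) auto
  from hyp2F1_eq_continuation[OF this series z]
  have "hyp2F1 (of_real b) (of_real a) (of_real (b + \<beta>)) z = F z" .
  then show ?thesis using Bpos by (simp add: F_def g_def)
qed

text \<open>
  Since \<open>v + u = u (1 - z v)\<close> for \<open>z = - 1 / u\<close>, the integral is Euler's.
\<close>
lemma Beta_integral_hyp2F1:
  fixes a b \<beta> u :: real
  assumes b: "b > 0" and \<beta>: "\<beta> > 0" and u: "u > 0"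
  shows "of_real (LBINT v:{0<..<1}. v powr (b - 1) * (1 - v) powr (\<beta> - 1) * (v + u) powr (- a)) =
     of_real (u powr (- a) * Beta b \<beta>) * hyp2F1 (of_real b) (of_real a) (of_real (b + \<beta>)) (of_real (- 1 / u))"
proof -
  have z: "complex_of_real (- 1 / u) \<in> hyp2F1_slit_plane"
  proof -
    have "- 1 / u < 1" using u by (simp add: field_simps)
    then show ?thesis
      unfolding hyp2F1_slit_plane_def by (auto simp only: Compl_iff image_iff of_real_eq_iff atLeast_iff)
  qed
  have eq: "complex_of_real (v powr (b - 1) * (1 - v) powr (\<beta> - 1)) * (1 - of_real (- 1 / u) * of_real v) powr (- of_real a) =
      of_real (u powr a * (v powr (b - 1) * (1 - v) powr (\<beta> - 1) * (v + u) powr (- a)))" if "v \<in> {0<..<1}" for v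
  proof -
    have "1 - (- 1 / u) * v = (v + u) / u" using u by (simp add: field_simps)
    then have *: "1 - complex_of_real (- 1 / u) * of_real v = of_real ((v + u) / u)"
      by (metis of_real_1 of_real_diff of_real_mult)
    have "complex_of_real ((v + u) / u) powr (- of_real a) = of_real (((v + u) / u) powr (- a))"
      using that u by (subst of_real_minus[symmetric], subst powr_of_real) auto
    also have "((v + u) / u) powr (- a) = u powr a * (v + u) powr (- a)"
      using that u by (simp add: powr_divide powr_minus_divide)
    finally show ?thesis unfolding * by (simp add: mult_ac)
  qed
  have "of_real (Beta b \<beta>) * hyp2F1 (of_real b) (of_real a) (of_real (b + \<beta>)) (of_real (- 1 / u)) =
      (LBINT v:{0<..<1}. complex_of_real (u powr a * (v powr (b - 1) * (1 - v) powr (\<beta> - 1) * (v + u) powr (- a))))"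
    unfolding hyp2F1_euler_integral[OF b \<beta> z] by (rule set_lebesgue_integral_cong) (simp, blast intro: eq)
  also have "\<dots> = of_real (u powr a * (LBINT v:{0<..<1}. v powr (b - 1) * (1 - v) powr (\<beta> - 1) * (v + u) powr (- a)))"
    unfolding set_lebesgue_integral_def integral_mult_right_zero[symmetric] integral_complex_of_real[symmetric]
    by (intro Bochner_Integration.integral_cong) (auto simp: scaleR_conv_of_real)
  finally have *: "of_real (Beta b \<beta>) * hyp2F1 (of_real b) (of_real a) (of_real (b + \<beta>)) (of_real (- 1 / u)) =
      complex_of_real (u powr a * (LBINT v:{0<..<1}. v powr (b - 1) * (1 - v) powr (\<beta> - 1) * (v + u) powr (- a)))" .
  have "u powr (- a) * u powr a = 1" using u by (simp flip: powr_add)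
  then have "complex_of_real (u powr (- a)) * of_real (u powr a) = 1"
    by (simp only: of_real_mult[symmetric] of_real_1)
  then show ?thesis
    by (simp only: of_real_mult mult.assoc *) (simp only: mult.assoc[symmetric] mult_1_left)
qed

lemma hyp2F1_of_real:
  fixes a b c x s :: real
  assumes x: "\<bar>x\<bar> < 1"
    and sums: "(\<lambda>n. pochhammer a n * pochhammer b n / (pochhammer c n * fact n) * x ^ n) sums s"
  shows "hyp2F1 (of_real a) (of_real b) (of_real c) (of_real x) = of_real s"
proof -
  have "(\<lambda>n. complex_of_real (pochhammer a n * pochhammer b n / (pochhammer c n * fact n) * x ^ n)) sums of_real s"
    using sums by (simp only: sums_of_real_iff)
  then have "(\<lambda>n. pochhammer (complex_of_real a) n * pochhammer (of_real b) n / (pochhammer (of_real c) n * fact n) * of_real x ^ n) sums of_real s"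
    by (simp add: pochhammer_of_real)
  then show ?thesis
    using x by (simp add: hyp2F1_def hyp2F1_series_altdef sums_iff)
qed

section \<open>The integral of a power times a shifted power\<close>

text \<open>
  Substituting \<open>w = exp y / u\<close>. In this variable an incomplete Beta integral is the restriction of a complete
  one to a half-line, so that complementary pieces can be added.
\<close>
lemma incomplete_Beta_log:
  fixes s t u :: real
  assumes s: "s > 0" and t: "t > 0" and u: "u > 0"
  shows "set_integrable lborel {0<..<1} (\<lambda>w. w powr (s - 1) * (1 + u * w) powr (- (s + t)))" (is ?th1)
    and "(LBINT w:{0<..<1}. w powr (s - 1) * (1 + u * w) powr (- (s + t))) =
           u powr (- s) * (LBINT y:{..<ln u}. exp (s * y - (s + t) * ln (1 + exp y)))" (is ?th2)
proof -
  define f where "f = (\<lambda>w. w powr (s - 1) * (1 + u * w) powr (- (s + t)))"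
  define h where "h = (\<lambda>y. exp (s * y - (s + t) * ln (1 + exp y)))"
  have h: "integrable lborel h" unfolding h_def by (rule Beta_integral_exp_real(1)[OF s t])
  have fg: "f (exp y / u) * (exp y / u) = u powr (- s) * h y" for y
  proof -
    have "f (exp y / u) * (exp y / u) = ((exp y / u) powr (s - 1) * (exp y / u)) * (1 + exp y) powr (- (s + t))"
      using u by (simp add: f_def)
    also have "(exp y / u) powr (s - 1) * (exp y / u) = (exp y / u) powr s"
      using u by (intro powr_minus_one_mult) auto
    also have "\<dots> = u powr (- s) * exp (s * y)"
      using u by (simp add: powr_def ln_div algebra_simps flip: exp_add)
    also have "(1 + exp y) powr (- (s + t)) = exp (- (s + t) * ln (1 + exp y))"
      using add_pos_pos[OF zero_less_one exp_gt_zero[of y]] by (simp add: powr_def)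
    also have "u powr (- s) * exp (s * y) * exp (- (s + t) * ln (1 + exp y)) = u powr (- s) * h y"
      unfolding h_def mult.assoc exp_add[symmetric] by (simp add: algebra_simps)
    finally show ?thesis .
  qed
  have e: "einterval (-\<infinity>) (ereal (ln u)) = {..<ln u}" "einterval (ereal 0) (ereal 1) = {0<..<1}"
    by (auto simp: einterval_def)
  have int: "set_integrable lborel (einterval (-\<infinity>) (ereal (ln u))) (\<lambda>y. f (exp y / u) * (exp y / u))"
    unfolding fg e set_integrable_def using h by (intro integrable_mult_indicator integrable_mult_right) auto
  have lims: "((ereal \<circ> (\<lambda>y. exp y / u) \<circ> real_of_ereal) \<longlongrightarrow> ereal 0) (at_right (-\<infinity>))"
      "((ereal \<circ> (\<lambda>y. exp y / u) \<circ> real_of_ereal) \<longlongrightarrow> ereal 1) (at_left (ereal (ln u)))"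
  proof -
    show "((ereal \<circ> (\<lambda>y. exp y / u) \<circ> real_of_ereal) \<longlongrightarrow> ereal 0) (at_right (-\<infinity>))"
      unfolding ereal_tendsto_simps using u by real_asymp
    have "((\<lambda>y. exp y / u) \<longlongrightarrow> exp (ln u) / u) (at_left (ln u))"
      using u by (intro tendsto_intros) auto
    then show "((ereal \<circ> (\<lambda>y. exp y / u) \<circ> real_of_ereal) \<longlongrightarrow> ereal 1) (at_left (ereal (ln u)))"
      unfolding ereal_tendsto_simps using u by simp
  qed
  have pos: "exp y / u > 0" "1 + u * (exp y / u) > 0" for y using u by (auto intro: add_pos_pos)
  have contf: "isCont f (exp y / u)" for y
    using pos[of y] u unfolding f_def by (intro continuous_intros) auto
  have deriv: "DERIV (\<lambda>y. exp y / u) x :> exp x / u" "isCont (\<lambda>y. exp y / u) x" for x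
    using u by (auto intro!: derivative_eq_intros continuous_intros)
  have nn: "f w \<ge> 0" for w by (simp add: f_def)
  have *: "set_integrable lborel (einterval (ereal 0) (ereal 1)) f"
     "(LBINT w=ereal 0..ereal 1. f w) = (LBINT y=-\<infinity>..ereal (ln u). f (exp y / u) * (exp y / u))"
    using pos(1) by (intro interval_integral_substitution_nonneg[OF _ _ _ _ _ _ lims int] contf deriv nn; simp add: less_imp_le)+
  show ?th1 using *(1) unfolding e by (simp add: f_def)
  have "(LBINT w:{0<..<1}. f w) = (LBINT y:{..<ln u}. u powr (- s) * h y)"
    using *(2) unfolding fg by (simp add: interval_lebesgue_integral_def e)
  then show ?th2 unfolding f_def h_def by simp
qed

text \<open>
  The integral of \<open>v powr (s - 1) * (v + u) powr (- (s + t))\<close> over all \<open>v > 0\<close> is a complete Beta integral. It is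
  cut at \<open>v = 1\<close>; the second summand is the part over \<open>v > 1\<close> in terms of \<open>w = 1 / v\<close>.
\<close>
lemma Beta_split:
  fixes s t u :: real
  assumes s: "s > 0" and t: "t > 0" and u: "u > 0"
  shows "(LBINT v:{0<..<1}. v powr (s - 1) * (v + u) powr (- (s + t))) +
         (LBINT w:{0<..<1}. w powr (t - 1) * (1 + u * w) powr (- (s + t))) = u powr (- t) * Beta s t"
proof -
  define h where "h = (\<lambda>y. exp (s * y - (s + t) * ln (1 + exp y)))"
  have h: "integrable lborel h" unfolding h_def by (rule Beta_integral_exp_real(1)[OF s t])
  have hi: "integrable lborel (\<lambda>y. indicator A y *\<^sub>R h y)" if "A \<in> sets borel" for A
    using h that by (intro integrable_mult_indicator) auto
  have "(LBINT v:{0<..<1}. v powr (s - 1) * (v + u) powr (- (s + t))) =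
     (LBINT v:{0<..<1}. u powr (- (s + t)) * (v powr (s - 1) * (1 + (1 / u) * v) powr (- (s + t))))"
  proof (intro set_lebesgue_integral_cong allI impI)
    fix v :: real
    assume v: "v \<in> {0<..<1}"
    have "v + u = u * (1 + (1 / u) * v)" using u by (simp add: field_simps)
    then have "(v + u) powr (- (s + t)) = u powr (- (s + t)) * (1 + (1 / u) * v) powr (- (s + t))"
      using u v by (simp add: powr_mult)
    then show "v powr (s - 1) * (v + u) powr (- (s + t)) = u powr (- (s + t)) * (v powr (s - 1) * (1 + (1 / u) * v) powr (- (s + t)))"
      by simp
  qed simp
  also have "\<dots> = u powr (- (s + t)) * ((1 / u) powr (- s) * (LBINT y:{..<- ln u}. h y))"
    using incomplete_Beta_log(2)[OF s t, of "1 / u"] u by (simp add: h_def ln_div)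
  also have "\<dots> = u powr (- t) * (LBINT y:{..<- ln u}. h y)"
  proof -
    have "(1 / u) powr (- s) = u powr s" using u by (simp add: powr_divide powr_minus_divide)
    then have "u powr (- (s + t)) * (1 / u) powr (- s) = u powr (- t)" by (simp flip: powr_add)
    then show ?thesis by (simp only: mult.assoc[symmetric])
  qed
  finally have J: "(LBINT v:{0<..<1}. v powr (s - 1) * (v + u) powr (- (s + t))) = u powr (- t) * (LBINT y:{..<- ln u}. h y)" .
  have reflect: "exp (t * y - (t + s) * ln (1 + exp y)) = h (- y)" for y
  proof -
    have "ln (1 + exp y) = ln (exp y * (1 + exp (- y)))"
      by (simp add: algebra_simps flip: exp_add)
    also have "\<dots> = y + ln (1 + exp (- y))" by (subst ln_mult) (use add_pos_pos[OF zero_less_one exp_gt_zero[of "- y"]] in auto)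
    finally show ?thesis by (simp add: h_def algebra_simps)
  qed
  have "(LBINT w:{0<..<1}. w powr (t - 1) * (1 + u * w) powr (- (s + t))) = u powr (- t) * (LBINT y:{..<ln u}. h (- y))"
    using incomplete_Beta_log(2)[OF t s u] by (simp only: reflect add.commute[of s t])
  also have "(LBINT y:{..<ln u}. h (- y)) = (LBINT y:{- ln u<..}. h y)"
    unfolding set_lebesgue_integral_def
    by (subst lborel_integral_real_affine[of "-1" _ 0]) (auto intro!: Bochner_Integration.integral_cong simp: indicator_def)
  finally have K: "(LBINT w:{0<..<1}. w powr (t - 1) * (1 + u * w) powr (- (s + t))) = u powr (- t) * (LBINT y:{- ln u<..}. h y)" .
  have "(LBINT y:{..<- ln u}. h y) + (LBINT y:{- ln u<..}. h y) = (LBINT y. h y)"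
    unfolding set_lebesgue_integral_def
    by (subst Bochner_Integration.integral_add[symmetric], (intro hi; simp)+, intro integral_cong_AE)
       (use AE_lborel_singleton[of "- ln u"] h in \<open>auto elim!: eventually_mono simp: indicator_def dest: borel_measurable_integrable\<close>)
  also have "\<dots> = Beta s t" unfolding h_def by (rule Beta_integral_exp_real(2)[OF s t])
  finally show ?thesis unfolding J K by (simp only: distrib_left[symmetric])
qed

lemma non_Int_denominator_bound:
  fixes y :: real
  assumes "y \<notin> \<int>"
  obtains \<epsilon> where "\<epsilon> > 0" "\<And>n. n \<in> \<int> \<Longrightarrow> \<epsilon> \<le> \<bar>y - n\<bar>"
proof -
  have "frac y > 0" "frac y < 1" using assms by (auto simp: frac_gt_0_iff frac_lt_1)
  moreover have "min (frac y) (1 - frac y) \<le> \<bar>y - n\<bar>" if "n \<in> \<int>" for n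
  proof -
    obtain k where k: "n = of_int k" using \<open>n \<in> \<int>\<close> by (rule Ints_cases)
    show ?thesis
    proof (cases "k \<le> \<lfloor>y\<rfloor>")
      case True
      then have "n \<le> of_int \<lfloor>y\<rfloor>" by (simp only: k of_int_le_iff)
      then show ?thesis by (simp add: frac_def)
    next
      case False
      then have "of_int (\<lfloor>y\<rfloor> + 1) \<le> n" by (simp only: k of_int_le_iff)
      then show ?thesis by (simp add: frac_def)
    qed
  qed
  ultimately show ?thesis by (intro that[of "min (frac y) (1 - frac y)"]) auto
qed

lemma binomial_weighted_summable:
  fixes c x :: real
  assumes x: "\<bar>x\<bar> < 1"
  shows "summable (\<lambda>n. \<bar>pochhammer c n / fact n * x ^ n\<bar> * (1 + real n))"
proof -
  have rec: "real (Suc n) * (pochhammer c (Suc n) / fact (Suc n) * x ^ Suc n) = c * x * (pochhammer (c + 1) n / fact n * x ^ n)" for n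
    unfolding pochhammer_rec fact_Suc power_Suc by (simp del: of_nat_Suc)
  have "summable (\<lambda>n. \<bar>c * x\<bar> * \<bar>pochhammer (c + 1) n / fact n * x ^ n\<bar>)"
    using binomial_series_abs_summable[of x "c + 1"] x by (intro summable_mult) simp
  also have "(\<lambda>n. \<bar>c * x\<bar> * \<bar>pochhammer (c + 1) n / fact n * x ^ n\<bar>) =
      (\<lambda>n. real (Suc n) * \<bar>pochhammer c (Suc n) / fact (Suc n) * x ^ Suc n\<bar>)"
  proof
    fix n
    have "real (Suc n) * \<bar>pochhammer c (Suc n) / fact (Suc n) * x ^ Suc n\<bar> = \<bar>real (Suc n) * (pochhammer c (Suc n) / fact (Suc n) * x ^ Suc n)\<bar>"
      by (simp only: abs_mult abs_of_nat)
    then show "\<bar>c * x\<bar> * \<bar>pochhammer (c + 1) n / fact n * x ^ n\<bar> = real (Suc n) * \<bar>pochhammer c (Suc n) / fact (Suc n) * x ^ Suc n\<bar>"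
      unfolding rec abs_mult by simp
  qed
  finally have "summable (\<lambda>n. real n * \<bar>pochhammer c n / fact n * x ^ n\<bar>)"
    by (subst (asm) summable_Suc_iff)
  moreover have "summable (\<lambda>n. \<bar>pochhammer c n / fact n * x ^ n\<bar>)"
    using binomial_series_abs_summable[of x c] x by simp
  ultimately have "summable (\<lambda>n. \<bar>pochhammer c n / fact n * x ^ n\<bar> + real n * \<bar>pochhammer c n / fact n * x ^ n\<bar>)"
    by (intro summable_add)
  moreover have "t + real n * t = t * (1 + real n)" for t n by (simp add: algebra_simps)
  ultimately show ?thesis by (simp only:)
qed

lemma binomial_partial_fractions_summable:
  fixes c x y :: real
  assumes "\<bar>x\<bar> < 1" "y \<notin> \<int>"
  shows "summable (\<lambda>j. pochhammer c j / fact j * x ^ j / (y - real j))"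
proof -
  obtain \<epsilon> where \<epsilon>: "\<epsilon> > 0" "\<And>n. n \<in> \<int> \<Longrightarrow> \<epsilon> \<le> \<bar>y - n\<bar>"
    by (rule non_Int_denominator_bound[OF assms(2)]) blast
  have "summable (\<lambda>n. \<bar>pochhammer c n / fact n * x ^ n\<bar> / \<epsilon>)"
    using binomial_series_abs_summable[of x c] assms(1) by (intro summable_divide) simp
  then show ?thesis
  proof (rule summable_comparison_test'[where N = 0])
    fix n
    show "norm (pochhammer c n / fact n * x ^ n / (y - real n)) \<le> \<bar>pochhammer c n / fact n * x ^ n\<bar> / \<epsilon>"
      using \<epsilon>(1) \<epsilon>(2)[of "real n"] unfolding real_norm_def abs_divide[of "_ * _"] by (intro divide_left_mono) auto
  qed
qed

text \<open>
  For \<open>\<bar>x\<bar> < 1\<close> and \<open>y = - t\<close> with \<open>t > 0\<close> this is the negative of the integral of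
  \<open>w powr (t - 1) * (1 - x * w) powr (- c)\<close> over the unit interval. The series continues it to all
  non-integer \<open>y\<close>.
\<close>
definition binomial_partial_fractions :: "real \<Rightarrow> real \<Rightarrow> real \<Rightarrow> real" where
  "binomial_partial_fractions c x y = (\<Sum>j. pochhammer c j / fact j * x ^ j / (y - real j))"

lemma binomial_partial_fractions_sums:
  assumes "\<bar>x\<bar> < 1" "y \<notin> \<int>"
  shows "(\<lambda>j. pochhammer c j / fact j * x ^ j / (y - real j)) sums binomial_partial_fractions c x y"
  unfolding binomial_partial_fractions_def
  by (rule summable_sums[OF binomial_partial_fractions_summable[OF assms]])

text \<open>
  Coefficientwise \<open>y / (y - j) - 1 = j / (y - j)\<close>, and the factor \<open>j\<close> turns the coefficient of index \<open>j\<close>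
  for \<open>c\<close> into \<open>c * x\<close> times the coefficient of index \<open>j - 1\<close> for \<open>c + 1\<close>.
\<close>
lemma binomial_partial_fractions_step:
  fixes c x y :: real
  assumes x: "\<bar>x\<bar> < 1" and y: "y \<notin> \<int>"
  shows "y * binomial_partial_fractions c x y =
     (1 - x) powr (- c) + c * x * binomial_partial_fractions (c + 1) x (y - 1)"
proof -
  let ?d = "\<lambda>c j. pochhammer c j / fact j * x ^ j"
  have y1: "y - 1 \<notin> \<int>" using y by (metis Ints_1 Ints_add diff_add_cancel)
  have nz: "y - real j \<noteq> 0" for j using y by auto
  have "(\<lambda>j. y * (?d c j / (y - real j)) - ?d c j) sums (y * binomial_partial_fractions c x y - (1 - x) powr (- c))"
    by (intro sums_diff sums_mult binomial_partial_fractions_sums binomial_series_real x y)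
  also have "(\<lambda>j. y * (?d c j / (y - real j)) - ?d c j) = (\<lambda>j. real j * ?d c j / (y - real j))"
  proof
    fix j
    have "y * (t / (y - real j)) - t = real j * t / (y - real j)" for t
      using nz[of j] by (simp add: field_simps)
    then show "y * (?d c j / (y - real j)) - ?d c j = real j * ?d c j / (y - real j)" .
  qed
  finally have "(\<lambda>j. real (Suc j) * ?d c (Suc j) / (y - real (Suc j))) sums (y * binomial_partial_fractions c x y - (1 - x) powr (- c))"
    by (subst sums_Suc_iff) simp
  also have "(\<lambda>j. real (Suc j) * ?d c (Suc j) / (y - real (Suc j))) = (\<lambda>j. c * x * (?d (c + 1) j / (y - 1 - real j)))"
  proof
    fix j
    have "real (Suc j) * ?d c (Suc j) = c * x * ?d (c + 1) j"
      unfolding pochhammer_rec fact_Suc power_Suc by (simp del: of_nat_Suc)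
    then show "real (Suc j) * ?d c (Suc j) / (y - real (Suc j)) = c * x * (?d (c + 1) j / (y - 1 - real j))"
      by (simp only:) (simp add: algebra_simps)
  qed
  finally have "(\<lambda>j. c * x * (?d (c + 1) j / (y - 1 - real j))) sums (y * binomial_partial_fractions c x y - (1 - x) powr (- c))" .
  moreover have "(\<lambda>j. c * x * (?d (c + 1) j / (y - 1 - real j))) sums (c * x * binomial_partial_fractions (c + 1) x (y - 1))"
    by (intro sums_mult binomial_partial_fractions_sums x y1)
  ultimately show ?thesis by (simp add: sums_iff)
qed

lemma set_integrable_powr_shifted:
  fixes q c u :: real
  assumes q: "q > 0" and c: "c > 0" and u: "u > 0"
  shows "set_integrable lborel {0<..<1} (\<lambda>v. v powr (q - 1) * (v + u) powr (- c))"
proof (rule set_integrable_mult_bounded)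
  show "set_integrable lborel {0<..<1} (\<lambda>v. v powr (q - 1))"
    using Beta_set_integral(1)[OF q zero_less_one] 
    by (rule set_integrable_cong[THEN iffD1, rotated -1]) auto
  show "norm ((v + u) powr (- c)) \<le> u powr (- c)" if "v \<in> {0<..<1}" for v
    using that c u by (simp add: powr_mono2')
qed auto

text \<open>
  Integration of the derivative of \<open>v powr q * (v + u) powr (- c)\<close>. It is the analogue for the integral of
  \<open>binomial_partial_fractions_step\<close>, and the Gamma term of the closed form solves the homogeneous relation.
\<close>
lemma powr_shifted_integral_step:
  fixes q c u :: real
  assumes q: "q > 0" and c: "c > 0" and u: "u > 0"
  defines "J \<equiv> \<lambda>c. LBINT v:{0<..<1}. v powr (q - 1) * (v + u) powr (- c)"
  shows "(1 + u) powr (- c) = (q - c) * J c + c * u * J (c + 1)"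
proof -
  define F where "F = (\<lambda>v. v powr q * (v + u) powr (- c))"
  define F' where "F' = (\<lambda>v. (q - c) * (v powr (q - 1) * (v + u) powr (- c)) + c * u * (v powr (q - 1) * (v + u) powr (- (c + 1))))"
  have deriv: "(F has_vector_derivative F' v) (at v)" if v: "v \<in> {0<..<1}" for v
  proof -
    have vq: "v powr q = v powr (q - 1) * v" using v by (simp add: powr_minus_one_mult)
    have vu: "(v + u) powr (- c) = (v + u) powr (- c - 1) * (v + u)" using v u by (simp add: powr_minus_one_mult)
    have e: "- c - 1 = - (c + 1)" by simp
    have "(F has_real_derivative q * v powr (q - 1) * (v + u) powr (- c) + v powr q * (- c * (v + u) powr (- c - 1))) (at v)"
      unfolding F_def using v u by (auto intro!: derivative_eq_intros simp: powr_diff)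
    also have "q * v powr (q - 1) * (v + u) powr (- c) + v powr q * (- c * (v + u) powr (- c - 1)) = F' v"
      unfolding F'_def vq vu e by (simp add: algebra_simps)
    finally show ?thesis by (simp add: has_real_derivative_iff_has_vector_derivative)
  qed
  have "(F' has_integral (F 1 - F 0)) {0..1}"
  proof (rule fundamental_theorem_of_calculus_interior)
    show "continuous_on {0..1} F"
      unfolding F_def using q u by (intro continuous_intros continuous_on_powr') auto
  qed (use deriv in auto)
  then have "(F' has_integral (F 1 - F 0)) {0<..<1}"
    by (simp add: has_integral_Icc_iff_Ioo)
  moreover have i: "set_integrable lborel {0<..<1} (\<lambda>v. (q - c) * (v powr (q - 1) * (v + u) powr (- c)))"
      "set_integrable lborel {0<..<1} (\<lambda>v. c * u * (v powr (q - 1) * (v + u) powr (- (c + 1))))"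
    using set_integrable_powr_shifted[OF q _ u, of c] set_integrable_powr_shifted[OF q _ u, of "c + 1"] c by auto
  have "set_integrable lborel {0<..<1} F'"
    unfolding F'_def by (rule set_integral_add(1)[OF i])
  from set_borel_integral_eq_integral(2)[OF this]
  have "(LBINT v:{0<..<1}. F' v) = integral {0<..<1} F'" .
  ultimately have "(LBINT v:{0<..<1}. F' v) = F 1 - F 0" by (simp add: integral_unique)
  also have "(LBINT v:{0<..<1}. F' v) = (q - c) * J c + c * u * J (c + 1)"
    unfolding F'_def J_def by (subst set_integral_add(2)[OF i]) simp
  finally show ?thesis using q by (simp add: F_def)
qed

text \<open>
  For \<open>q < c\<close> the integral is a complete Beta integral minus its tail, and the tail has a convergent binomial
  expansion. Each further step lowers \<open>c\<close> by one; non-integrality of \<open>q - c\<close> allows the division by it.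
\<close>
lemma powr_shifted_integral_aux:
  fixes q c u :: real
  assumes u: "0 < u" "u < 1" and q: "q > 0"
  shows "c > 0 \<Longrightarrow> q - c \<notin> \<int> \<Longrightarrow> q < c + real n \<Longrightarrow>
     (LBINT v:{0<..<1}. v powr (q - 1) * (v + u) powr (- c)) =
       u powr (q - c) * (Gamma q * Gamma (c - q) / Gamma c) + binomial_partial_fractions c (- u) (q - c)"
proof (induction n arbitrary: c)
  case 0
  define t where "t = c - q"
  have t: "t > 0" "c = q + t" using 0 by (auto simp: t_def)
  have y: "q - c \<notin> \<int>" by fact
  let ?d = "\<lambda>j. pochhammer c j / fact j * (- u) ^ j"
  note gi = power_moment(1)[OF t(1)] and int_pow = power_moment(2)[OF t(1)]
  have "(\<lambda>j. ?d j * (LBINT w:{0<..<1}. w powr (t - 1) * of_real w ^ j)) sums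
      (LBINT w:{0<..<1}. w powr (t - 1) * (1 + u * w) powr (- c))"
  proof (rule sums_set_integral_power_series[OF gi])
    have "summable (\<lambda>j. norm (?d j) * (1 / t))"
      using binomial_series_abs_summable[of "- u" c] u by (intro summable_mult2) simp
    then show "summable (\<lambda>j. norm (?d j) * (LBINT w:{0<..<1}. norm (w powr (t - 1)) * w ^ j))"
    proof (rule summable_comparison_test'[where N = 0])
      fix n
      have le: "1 / (t + real n) \<le> 1 / t" "0 \<le> 1 / (t + real n)" using t by (auto intro: divide_left_mono)
      have e: "(LBINT w:{0<..<1}. norm (w powr (t - 1)) * w ^ n) = 1 / (t + real n)" using int_pow by simp
      then show "norm (norm (?d n) * (LBINT w:{0<..<1}. norm (w powr (t - 1)) * w ^ n)) \<le> norm (?d n) * (1 / t)"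
        using mult_left_mono[OF le(1) abs_ge_zero[of "?d n"]] le(2)
        unfolding e by (simp only: real_norm_def abs_mult[of "\<bar>?d n\<bar>"] abs_abs abs_of_nonneg)
    qed
    fix w :: real
    assume w: "w \<in> {0<..<1}"
    have "\<bar>- u * w\<bar> < 1" using w u mult_strict_mono[of u 1 w 1] by (auto simp: abs_mult)
    from binomial_series_real[OF this, of c]
    show "(\<lambda>j. ?d j * of_real w ^ j) sums (1 + u * w) powr (- c)"
      by (simp add: power_mult_distrib mult_ac power_minus[of "u * w"] power_minus[of u])
  qed
  then have "(\<lambda>j. - (?d j * (1 / (t + real j)))) sums - (LBINT w:{0<..<1}. w powr (t - 1) * (1 + u * w) powr (- c))"
    by (intro sums_minus) (simp add: int_pow)
  also have "(\<lambda>j. - (?d j * (1 / (t + real j)))) = (\<lambda>j. ?d j / (q - c - real j))"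
  proof
    fix j
    have "- (d * (1 / w)) = d / (- w)" for d w :: real by simp
    moreover have "q - c - real j = - (t + real j)" by (simp add: t_def)
    ultimately show "- (?d j * (1 / (t + real j))) = ?d j / (q - c - real j)" by (simp only:)
  qed
  finally have "- (LBINT w:{0<..<1}. w powr (t - 1) * (1 + u * w) powr (- c)) = binomial_partial_fractions c (- u) (q - c)"
    by (rule sums_unique2) (rule binomial_partial_fractions_sums, use u y in auto)
  moreover have "Beta q t = Gamma q * Gamma (c - q) / Gamma c" by (simp add: Beta_def t)
  moreover have "- t = q - c" by (simp add: t_def)
  ultimately show ?case
    using Beta_split[OF q t(1) u(1)] unfolding t(2)[symmetric] by simp
next
  case (Suc n)
  let ?J = "\<lambda>c. LBINT v:{0<..<1}. v powr (q - 1) * (v + u) powr (- c)"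
  have y1: "q - (c + 1) \<notin> \<int>" using Suc.prems(2) by (metis Ints_1 Ints_add diff_add_cancel diff_diff_eq)
  have nz: "q - c \<noteq> 0" using Suc.prems(2) by auto
  have IH: "?J (c + 1) = u powr (q - (c + 1)) * (Gamma q * Gamma (c + 1 - q) / Gamma (c + 1)) + binomial_partial_fractions (c + 1) (- u) (q - (c + 1))"
    using Suc.prems y1 by (intro Suc.IH) auto
  have G1: "Gamma (c + 1) = c * Gamma c" using Suc.prems(1) by (intro Gamma_plus1) (auto elim!: nonpos_Ints_cases)
  have "c - q \<notin> \<int>\<^sub>\<le>\<^sub>0" using Suc.prems(2) by (metis Ints_minus minus_diff_eq nonpos_Ints_Int)
  then have G2: "Gamma (c + 1 - q) = (c - q) * Gamma (c - q)" using Gamma_plus1[of "c - q"] by (simp add: algebra_simps)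
  have u1: "u * u powr (q - (c + 1)) = u powr (q - c)"
    using powr_minus_one_mult[OF u(1), of "q - c"] by (simp add: mult.commute diff_diff_eq)
  have S: "(q - c) * binomial_partial_fractions c (- u) (q - c) =
     (1 + u) powr (- c) - c * u * binomial_partial_fractions (c + 1) (- u) (q - (c + 1))"
    using binomial_partial_fractions_step[of "- u" "q - c" c] u Suc.prems(2) by (simp add: diff_diff_eq)
  have "c * u * (u powr (q - (c + 1)) * (Gamma q * Gamma (c + 1 - q) / Gamma (c + 1))) =
      (u * u powr (q - (c + 1))) * (Gamma q * (c * Gamma (c + 1 - q) / Gamma (c + 1)))" by simp
  also have "\<dots> = (c - q) * (u powr (q - c) * (Gamma q * Gamma (c - q) / Gamma c))"
    unfolding u1 G1 G2 using Suc.prems(1) by simp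
  finally have H: "c * u * (u powr (q - (c + 1)) * (Gamma q * Gamma (c + 1 - q) / Gamma (c + 1))) =
     (c - q) * (u powr (q - c) * (Gamma q * Gamma (c - q) / Gamma c))" .
  have "(q - c) * ?J c = (1 + u) powr (- c) - c * u * ?J (c + 1)"
    using powr_shifted_integral_step[OF q Suc.prems(1) u(1)] by simp
  also have "\<dots> = (q - c) * (u powr (q - c) * (Gamma q * Gamma (c - q) / Gamma c) + binomial_partial_fractions c (- u) (q - c))"
  proof -
    define X where "X = u powr (q - c) * (Gamma q * Gamma (c - q) / Gamma c)"
    show ?thesis
      unfolding IH distrib_left H S X_def[symmetric] by (simp add: left_diff_distrib)
  qed
  finally show ?case using nz by simp
qed

lemma powr_shifted_integral:
  fixes q c u :: real
  assumes u: "0 < u" "u < 1" and q: "q > 0" and c: "c > 0" and y: "q - c \<notin> \<int>"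
  shows "(LBINT v:{0<..<1}. v powr (q - 1) * (v + u) powr (- c)) =
       u powr (q - c) * (Gamma q * Gamma (c - q) / Gamma c) + binomial_partial_fractions c (- u) (q - c)"
proof -
  obtain n where "q - c < real n" using reals_Archimedean2 by blast
  then show ?thesis by (intro powr_shifted_integral_aux[OF u q c y, of n]) simp
qed

section \<open>The Beta function as a sum of partial fractions\<close>

text \<open>
  The Taylor coefficients of \<open>(1 - v) powr (\<beta> - 1)\<close> at 0.
\<close>
definition one_minus_powr_coeff :: "real \<Rightarrow> nat \<Rightarrow> real" where
  "one_minus_powr_coeff \<beta> k = pochhammer (1 - \<beta>) k / fact k"

text \<open>
  The coefficients, scaled by a power of the index, are up to elementary factors the approximants in the limit
  formula for the reciprocal Gamma function, hence bounded.
\<close>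
lemma one_minus_powr_coeff_bound:
  fixes \<beta> :: real
  obtains C where "C > 0" "\<And>k. \<bar>one_minus_powr_coeff \<beta> k\<bar> \<le> C * real (Suc k) powr (- \<beta>)"
proof -
  have lim: "(\<lambda>n. rGamma_series (1 - \<beta>) n) \<longlonglongrightarrow> rGamma (1 - \<beta>)" by (rule rGamma_series_LIMSEQ)
  have "(\<lambda>n. one_minus_powr_coeff \<beta> (Suc n) * real (Suc (Suc n)) powr \<beta>) \<longlonglongrightarrow> rGamma (1 - \<beta>)"
  proof (rule Lim_transform_eventually)
    have "(\<lambda>n. real n powr (1 - \<beta>) / real (Suc n) * real (Suc (Suc n)) powr \<beta>) \<longlonglongrightarrow> 1"
      by real_asymp
    from tendsto_mult[OF lim this]
    show "(\<lambda>n. rGamma_series (1 - \<beta>) n * (real n powr (1 - \<beta>) / real (Suc n) * real (Suc (Suc n)) powr \<beta>)) \<longlonglongrightarrow> rGamma (1 - \<beta>)"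
      by simp
    show "\<forall>\<^sub>F n in sequentially. rGamma_series (1 - \<beta>) n * (real n powr (1 - \<beta>) / real (Suc n) * real (Suc (Suc n)) powr \<beta>) =
       one_minus_powr_coeff \<beta> (Suc n) * real (Suc (Suc n)) powr \<beta>"
      using eventually_gt_at_top[of 0]
    proof eventually_elim
      case (elim n)
      have "exp ((1 - \<beta>) * ln (real n)) = real n powr (1 - \<beta>)" "real n powr (1 - \<beta>) \<noteq> 0"
        using elim by (simp_all add: powr_def)
      then show ?case
        by (simp add: rGamma_series_def one_minus_powr_coeff_def fact_Suc del: of_nat_Suc)
    qed
  qed
  then have "(\<lambda>n. one_minus_powr_coeff \<beta> n * real (Suc n) powr \<beta>) \<longlonglongrightarrow> rGamma (1 - \<beta>)"
    by (rule LIMSEQ_imp_Suc)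
  then have "Bseq (\<lambda>n. one_minus_powr_coeff \<beta> n * real (Suc n) powr \<beta>)"
    by (intro convergent_imp_Bseq convergentI)
  then obtain C where C: "C > 0" "\<And>n. norm (one_minus_powr_coeff \<beta> n * real (Suc n) powr \<beta>) \<le> C"
    by (auto simp: Bseq_def)
  have "\<bar>one_minus_powr_coeff \<beta> k\<bar> \<le> C * real (Suc k) powr (- \<beta>)" for k
    using C(2)[of k] by (simp add: abs_mult powr_minus_divide pos_le_divide_eq)
  with C(1) show ?thesis by (rule that)
qed

lemma one_minus_powr_coeff_tendsto_0:
  assumes "\<beta> > 0"
  shows "one_minus_powr_coeff \<beta> \<longlonglongrightarrow> 0"
proof -
  obtain C where C: "C > 0" "\<And>k. \<bar>one_minus_powr_coeff \<beta> k\<bar> \<le> C * real (Suc k) powr (- \<beta>)"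
    by (rule one_minus_powr_coeff_bound) blast
  have "(\<lambda>k. C * real (Suc k) powr (- \<beta>)) \<longlonglongrightarrow> 0" using assms by real_asymp
  then show ?thesis
    by (rule Lim_null_comparison[rotated]) (use C(2) in auto)
qed

lemma one_minus_powr_coeff_summable:
  assumes "\<beta> > 0"
  shows "summable (\<lambda>k. \<bar>one_minus_powr_coeff \<beta> k\<bar> / real (Suc k))"
proof -
  obtain C where C: "C > 0" "\<And>k. \<bar>one_minus_powr_coeff \<beta> k\<bar> \<le> C * real (Suc k) powr (- \<beta>)"
    by (rule one_minus_powr_coeff_bound) blast
  have "summable (\<lambda>k. real k powr (- \<beta> - 1))" using assms by (simp add: summable_real_powr_iff)
  then have "summable (\<lambda>k. C * real (Suc k) powr (- \<beta> - 1))"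
    by (intro summable_mult) (subst summable_Suc_iff[of "\<lambda>k. real k powr (- \<beta> - 1)"])
  then show ?thesis
  proof (rule summable_comparison_test'[where N = 0])
    fix k
    have "\<bar>one_minus_powr_coeff \<beta> k\<bar> / real (Suc k) \<le> C * real (Suc k) powr (- \<beta>) / real (Suc k)"
      using C(2)[of k] by (intro divide_right_mono) auto
    then show "norm (\<bar>one_minus_powr_coeff \<beta> k\<bar> / real (Suc k)) \<le> C * real (Suc k) powr (- \<beta> - 1)"
      by (simp add: powr_diff del: of_nat_Suc)
  qed
qed

text \<open>
  The denominator is comparable to \<open>k\<close> once \<open>k\<close> exceeds a multiple of \<open>j\<close>. Otherwise it stays away from 0
  because \<open>y\<close> is no integer, and the factor \<open>1 + j\<close> compensates. The product form on the right is what
  makes the double series absolutely summable.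
\<close>
lemma shifted_denominator_bound:
  fixes y :: real
  assumes "y \<notin> \<int>"
  obtains K where "K > 0" "\<And>k j :: nat. 1 / \<bar>y + real k - real j\<bar> \<le> K * (1 + real j) / real (Suc k)"
proof -
  obtain \<epsilon> where \<epsilon>: "\<epsilon> > 0" "\<And>n. n \<in> \<int> \<Longrightarrow> \<epsilon> \<le> \<bar>y - n\<bar>"
    by (rule non_Int_denominator_bound[OF assms]) blast
  \<comment> \<open>The summand 2 serves large \<open>k\<close>, where the denominator exceeds half of \<open>k + 1\<close>; the other one serves
    \<open>k\<close> at most of the order of \<open>j\<close>, where only the distance \<open>\<epsilon>\<close> to the integers is available.\<close>
  define K where "K = 2 + 2 * (1 + \<bar>y\<bar>) / \<epsilon>"
  have K: "K \<ge> 2" "K * \<epsilon> \<ge> 2 * (1 + \<bar>y\<bar>)" using \<epsilon>(1) by (auto simp: K_def field_simps)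
  have "1 / \<bar>y + real k - real j\<bar> \<le> K * (1 + real j) / real (Suc k)" for k j
  proof -
    have d: "\<epsilon> \<le> \<bar>y + real k - real j\<bar>" using \<epsilon>(2)[of "real j - real k"] by (simp add: algebra_simps)
    have "real (Suc k) \<le> K * (1 + real j) * \<bar>y + real k - real j\<bar>"
    proof (cases "real (Suc k) \<le> 2 * (1 + real j + \<bar>y\<bar>)")
      case True
      also have "2 * (1 + real j + \<bar>y\<bar>) \<le> 2 * (1 + \<bar>y\<bar>) * (1 + real j)" by (simp add: algebra_simps)
      also have "\<dots> \<le> K * \<epsilon> * (1 + real j)" using K(2) by (intro mult_right_mono) auto
      also have "\<dots> = K * (1 + real j) * \<epsilon>" by simp
      also have "\<dots> \<le> K * (1 + real j) * \<bar>y + real k - real j\<bar>" using d K(1) by (intro mult_left_mono) auto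
      finally show ?thesis .
    next
      case False
      then have "real (Suc k) \<le> 2 * \<bar>y + real k - real j\<bar>" by (auto simp: abs_if split: if_splits)
      also have "\<dots> \<le> K * (1 + real j) * \<bar>y + real k - real j\<bar>"
        using mult_mono[of 2 K 1 "1 + real j"] K(1) by (intro mult_right_mono) auto
      finally show ?thesis .
    qed
    moreover have "\<bar>y + real k - real j\<bar> > 0" using d \<epsilon>(1) by linarith
    ultimately show ?thesis by (simp add: field_simps)
  qed
  then show ?thesis using K(1) by (intro that[of K]) auto
qed

lemma Beta_partial_fractions_summable:
  assumes \<beta>: "\<beta> > 0" and y: "y \<notin> \<int>\<^sub>\<le>\<^sub>0"
  shows "summable (\<lambda>k. \<bar>one_minus_powr_coeff \<beta> k / (y + real k)\<bar>)"
proof -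
  have "(\<lambda>k. real (Suc k) / \<bar>y + real k\<bar>) \<longlonglongrightarrow> 1" by real_asymp
  then have "Bseq (\<lambda>k. real (Suc k) / \<bar>y + real k\<bar>)" by (intro convergent_imp_Bseq convergentI)
  then obtain K where K: "K > 0" "\<And>k. norm (real (Suc k) / \<bar>y + real k\<bar>) \<le> K" by (auto simp: Bseq_def)
  have "summable (\<lambda>k. K * (\<bar>one_minus_powr_coeff \<beta> k\<bar> / real (Suc k)))" by (intro summable_mult one_minus_powr_coeff_summable \<beta>)
  then show ?thesis
  proof (rule summable_comparison_test'[where N = 0])
    fix k
    have "\<bar>one_minus_powr_coeff \<beta> k\<bar> / real (Suc k) * (real (Suc k) / \<bar>y + real k\<bar>) \<le> \<bar>one_minus_powr_coeff \<beta> k\<bar> / real (Suc k) * K"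
      using K(2)[of k] by (intro mult_left_mono) auto
    then show "norm \<bar>one_minus_powr_coeff \<beta> k / (y + real k)\<bar> \<le> K * (\<bar>one_minus_powr_coeff \<beta> k\<bar> / real (Suc k))"
      by (simp add: mult.commute abs_divide del: of_nat_Suc)
  qed
qed

text \<open>
  For \<open>y > 0\<close> this is Euler's Beta integral with the power of \<open>1 - v\<close> expanded. The step from \<open>y + 1\<close> to
  \<open>y\<close> uses that \<open>y T(y) - (y + \<beta>) T(y + 1)\<close>, for \<open>T\<close> the sum, is a telescoping series.
\<close>
lemma Beta_partial_fractions_aux:
  fixes \<beta> y :: real
  assumes \<beta>: "\<beta> > 0"
  shows "y \<notin> \<int>\<^sub>\<le>\<^sub>0 \<Longrightarrow> y + real n > 0 \<Longrightarrow>
    (\<lambda>k. one_minus_powr_coeff \<beta> k / (y + real k)) sums (Gamma y * Gamma \<beta> * rGamma (y + \<beta>))"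
proof (induction n arbitrary: y)
  case 0
  then have y: "y > 0" by simp
  note gi = power_moment(1)[OF y] and int_pow = power_moment(2)[OF y]
  have "(\<lambda>k. one_minus_powr_coeff \<beta> k * (LBINT w:{0<..<1}. w powr (y - 1) * of_real w ^ k)) sums
      (LBINT w:{0<..<1}. w powr (y - 1) * (1 - w) powr (\<beta> - 1))"
  proof (rule sums_set_integral_power_series[OF gi])
    show "summable (\<lambda>k. norm (one_minus_powr_coeff \<beta> k) * (LBINT w:{0<..<1}. norm (w powr (y - 1)) * w ^ k))"
      using Beta_partial_fractions_summable[OF \<beta> \<open>y \<notin> \<int>\<^sub>\<le>\<^sub>0\<close>] y by (simp add: int_pow abs_divide)
    show "(\<lambda>k. one_minus_powr_coeff \<beta> k * of_real w ^ k) sums (1 - w) powr (\<beta> - 1)" if "w \<in> {0<..<1}" for w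
      using binomial_series_real[of w "1 - \<beta>"] that by (simp add: one_minus_powr_coeff_def)
  qed
  then show ?case
    using Beta_set_integral(2)[OF y \<beta>] by (simp add: int_pow Beta_altdef)
next
  case (Suc n)
  have y: "y \<noteq> 0" using Suc.prems(1) by auto
  have nz: "y + real k \<noteq> 0" for k
  proof
    assume "y + real k = 0"
    then have "y = - of_nat k" by simp
    then show False using Suc.prems(1) by auto
  qed
  have y1: "y + 1 \<notin> \<int>\<^sub>\<le>\<^sub>0"
  proof
    assume "y + 1 \<in> \<int>\<^sub>\<le>\<^sub>0"
    then obtain k where "y + 1 = - of_nat k" by (rule nonpos_Ints_cases')
    then have "y + real (Suc k) = 0" by simp
    then show False using nz by blast
  qed
  have IH: "(\<lambda>k. one_minus_powr_coeff \<beta> k / (y + 1 + real k)) sums (Gamma (y + 1) * Gamma \<beta> * rGamma (y + 1 + \<beta>))"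
    using Suc.prems y1 by (intro Suc.IH) auto
  \<comment> \<open>The telescoping sequence; it tends to 0 because \<open>\<beta> > 0\<close>.\<close>
  define b where "b = (\<lambda>k. real k * one_minus_powr_coeff \<beta> k / (y + real k))"
  have "b \<longlonglongrightarrow> 0"
  proof -
    have "(\<lambda>k. one_minus_powr_coeff \<beta> k * (real k / (y + real k))) \<longlonglongrightarrow> 0 * 1"
      by (intro tendsto_mult one_minus_powr_coeff_tendsto_0 \<beta>) real_asymp
    then show ?thesis by (simp add: b_def mult.commute)
  qed
  then have "(\<lambda>k. b (Suc k) - b k) sums (0 - b 0)" by (rule telescope_sums)
  then have tele: "(\<lambda>k. b (Suc k) - b k) sums 0" by (simp add: b_def)
  have "b (Suc k) - b k = y * (one_minus_powr_coeff \<beta> k / (y + real k)) - (y + \<beta>) * (one_minus_powr_coeff \<beta> k / (y + 1 + real k))" for k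
  proof -
    have rec: "real (Suc k) * one_minus_powr_coeff \<beta> (Suc k) = (1 - \<beta> + real k) * one_minus_powr_coeff \<beta> k"
      by (simp add: one_minus_powr_coeff_def pochhammer_Suc fact_Suc del: of_nat_Suc)
    have b1: "b (Suc k) = (1 - \<beta> + real k) * one_minus_powr_coeff \<beta> k / (y + 1 + real k)"
      unfolding b_def rec by (simp add: add_ac)
    have alg: "(1 - \<beta> + real k) * t / (y + 1 + real k) - real k * t / (y + real k) =
        y * (t / (y + real k)) - (y + \<beta>) * (t / (y + 1 + real k))" for t
    proof -
      have "(1 - \<beta> + real k) * t / (y + 1 + real k) + (y + \<beta>) * (t / (y + 1 + real k)) = (y + 1 + real k) * t / (y + 1 + real k)"
        by (simp add: add_divide_distrib[symmetric] algebra_simps)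
      also have "\<dots> = t" using nz[of "Suc k"] by (simp add: add_ac)
      also have "t = (y + real k) * t / (y + real k)" using nz[of k] by simp
      also have "\<dots> = y * (t / (y + real k)) + real k * t / (y + real k)"
        by (simp add: add_divide_distrib[symmetric] algebra_simps)
      finally show ?thesis by simp
    qed
    show ?thesis unfolding b1 alg[symmetric] by (simp add: b_def)
  qed
  then have "(\<lambda>k. y * (one_minus_powr_coeff \<beta> k / (y + real k)) - (y + \<beta>) * (one_minus_powr_coeff \<beta> k / (y + 1 + real k))) sums 0"
    using tele by simp
  from sums_add[OF this sums_mult[OF IH, of "y + \<beta>"]]
  have "(\<lambda>k. y * (one_minus_powr_coeff \<beta> k / (y + real k))) sums ((y + \<beta>) * (Gamma (y + 1) * Gamma \<beta> * rGamma (y + 1 + \<beta>)))"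
    by simp
  from sums_divide[OF this, of y]
  have "(\<lambda>k. one_minus_powr_coeff \<beta> k / (y + real k)) sums ((y + \<beta>) * (Gamma (y + 1) * Gamma \<beta> * rGamma (y + 1 + \<beta>)) / y)"
    using y by simp
  also have "(y + \<beta>) * (Gamma (y + 1) * Gamma \<beta> * rGamma (y + 1 + \<beta>)) / y = Gamma y * Gamma \<beta> * rGamma (y + \<beta>)"
    using y rGamma_plus1[of "y + \<beta>"] Gamma_plus1[OF Suc.prems(1)] by (simp add: add_ac)
  finally show ?case .
qed

lemma Beta_partial_fractions:
  fixes \<beta> y :: real
  assumes \<beta>: "\<beta> > 0" and y: "y \<notin> \<int>\<^sub>\<le>\<^sub>0"
  shows "(\<lambda>k. one_minus_powr_coeff \<beta> k / (y + real k)) sums (Gamma y * Gamma \<beta> * rGamma (y + \<beta>))"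
proof -
  obtain n where "- y < real n" using reals_Archimedean2 by blast
  then show ?thesis by (intro Beta_partial_fractions_aux[OF \<beta> y, of n]) simp
qed

section \<open>The connection formula near the origin\<close>

lemma rGamma_minus_nat: "rGamma (z - of_nat n) = (- 1) ^ n * pochhammer (1 - z) n * rGamma z" for z :: real
proof (induction n)
  case (Suc n)
  have "rGamma (z - of_nat (Suc n)) = (z - of_nat (Suc n)) * rGamma (z - of_nat n)"
    using rGamma_plus1[of "z - of_nat (Suc n)"] by simp
  then show ?case by (simp add: Suc pochhammer_Suc algebra_simps)
qed simp

lemma Gamma_minus_nat: "Gamma (z - of_nat n) = (- 1) ^ n * Gamma z / pochhammer (1 - z) n" for z :: real
proof -
  have "Gamma (z - of_nat n) = inverse ((- 1) ^ n * pochhammer (1 - z) n * rGamma z)"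
    by (simp only: Gamma_def rGamma_minus_nat[symmetric])
  also have "\<dots> = (- 1) ^ n * Gamma z / pochhammer (1 - z) n"
    by (cases "even n") (simp_all add: Gamma_def field_simps)
  finally show ?thesis .
qed

text \<open>
  Fubini for counting measure, in the form of the exchange of a sum and an integral.
\<close>
lemma double_series_swap:
  fixes D :: "nat \<Rightarrow> nat \<Rightarrow> real"
  assumes bound: "\<And>k j. \<bar>D k j\<bar> \<le> A k * B j" and A: "summable A" and B: "summable B"
  shows "(\<lambda>k. \<Sum>j. D k j) sums (\<Sum>j. \<Sum>k. D k j)"
    and "summable (\<lambda>j. \<Sum>k. D k j)"
proof -
  have row: "summable (\<lambda>j. \<bar>D k j\<bar>)" for k
    by (rule summable_comparison_test'[OF summable_mult[OF B, of "A k"], where N = 0]) (use bound in auto)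
  have col: "summable (\<lambda>k. \<bar>D k j\<bar>)" for j
    by (rule summable_comparison_test'[OF summable_mult2[OF A, of "B j"], where N = 0]) (use bound in auto)
  have int_row: "integrable (count_space UNIV) (D k)" for k
    using row by (simp add: integrable_count_space_nat_iff)
  have abs_int: "(LINT j|count_space UNIV. \<bar>D k j\<bar>) = (\<Sum>j. \<bar>D k j\<bar>)" for k
    using row by (intro integral_count_space_nat) (simp add: integrable_count_space_nat_iff)
  have abs_sum: "summable (\<lambda>k. \<Sum>j. \<bar>D k j\<bar>)"
  proof (rule summable_comparison_test'[OF summable_mult2[OF A, of "\<Sum>j. B j"], where N = 0])
    fix k
    have "(\<Sum>j. \<bar>D k j\<bar>) \<le> (\<Sum>j. A k * B j)"
      using bound by (intro suminf_le row summable_mult B)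
    also have "\<dots> = A k * (\<Sum>j. B j)" by (rule suminf_mult[OF B])
    finally show "norm (\<Sum>j. \<bar>D k j\<bar>) \<le> A k * (\<Sum>j. B j)"
      using suminf_nonneg[OF row] by simp
  qed
  have prem: "AE j in count_space UNIV. summable (\<lambda>k. norm (D k j))"
      "summable (\<lambda>k. LINT j|count_space UNIV. norm (D k j))"
    using col abs_sum by (auto simp: abs_int)
  have int: "integrable (count_space UNIV) (\<lambda>j. \<Sum>k. D k j)"
    by (rule integrable_suminf[OF int_row prem])
  then show "summable (\<lambda>j. \<Sum>k. D k j)"
    by (simp add: integrable_count_space_nat_iff summable_norm_cancel)
  have "(\<lambda>k. LINT j|count_space UNIV. D k j) sums (LINT j|count_space UNIV. (\<Sum>k. D k j))"
    by (rule sums_integral[OF int_row prem])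
  then show "(\<lambda>k. \<Sum>j. D k j) sums (\<Sum>j. \<Sum>k. D k j)"
    by (simp only: integral_count_space_nat[OF int_row] integral_count_space_nat[OF int])
qed

lemma Beta_integral_expansion:
  fixes p \<beta> c u :: real
  assumes p: "p > 0" and \<beta>: "\<beta> > 0" and c: "c > 0" and u: "u > 0"
  shows "(\<lambda>k. one_minus_powr_coeff \<beta> k * (LBINT v:{0<..<1}. v powr (p + real k - 1) * (v + u) powr (- c))) sums
     (LBINT v:{0<..<1}. v powr (p - 1) * (1 - v) powr (\<beta> - 1) * (v + u) powr (- c))"
proof -
  define g where "g = (\<lambda>v. v powr (p - 1) * (v + u) powr (- c))"
  have g: "set_integrable lborel {0<..<1} g" unfolding g_def by (rule set_integrable_powr_shifted[OF p c u])
  have gk: "v powr (p + real k - 1) * (v + u) powr (- c) = g v * v ^ k" if "v \<in> {0<..<1}" for v k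
    using that by (simp add: g_def powr_realpow[symmetric] powr_add powr_diff)
  have moment: "(LBINT v:{0<..<1}. v powr (p + real k - 1) * (v + u) powr (- c)) = (LBINT v:{0<..<1}. g v * of_real v ^ k)" for k
    by (intro set_lebesgue_integral_cong) (auto simp: gk)
  have gkint: "set_integrable lborel {0<..<1} (\<lambda>v. g v * v ^ k)" for k
    by (rule set_integrable_mult_bounded[OF g, where K = 1]) (auto simp: power_le_one)
  have bound: "(LBINT v:{0<..<1}. norm (g v) * v ^ k) \<le> u powr (- c) / (p + real k)"
    and nonneg: "0 \<le> (LBINT v:{0<..<1}. norm (g v) * v ^ k)" for k
  proof -
    have gpos: "g v \<ge> 0" for v by (simp add: g_def)
    have pk: "set_integrable lborel {0<..<1} (\<lambda>v. u powr (- c) * (v powr (p - 1) * v ^ k))"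
      by (intro set_integrable_mult_right set_integrable_mult_bounded[OF power_moment(1)[OF p], where K = 1])
         (auto simp: power_le_one)
    have "(LBINT v:{0<..<1}. norm (g v) * v ^ k) = (LBINT v:{0<..<1}. g v * v ^ k)"
      using gpos by simp
    also have "\<dots> \<le> (LBINT v:{0<..<1}. u powr (- c) * (v powr (p - 1) * v ^ k))"
    proof (rule set_integral_mono[OF gkint pk])
      fix v :: real
      assume v: "v \<in> {0<..<1}"
      then have "(v + u) powr (- c) \<le> u powr (- c)" using c u by (simp add: powr_mono2')
      then have "(v powr (p - 1) * v ^ k) * (v + u) powr (- c) \<le> (v powr (p - 1) * v ^ k) * u powr (- c)"
        using v by (intro mult_left_mono) auto
      then show "g v * v ^ k \<le> u powr (- c) * (v powr (p - 1) * v ^ k)" by (simp add: g_def mult_ac)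
    qed
    also have "\<dots> = u powr (- c) / (p + real k)"
      using power_moment(2)[OF p, of k] by simp
    finally show "(LBINT v:{0<..<1}. norm (g v) * v ^ k) \<le> u powr (- c) / (p + real k)" .
    show "0 \<le> (LBINT v:{0<..<1}. norm (g v) * v ^ k)"
      unfolding set_lebesgue_integral_def by (intro Bochner_Integration.integral_nonneg) (auto simp: indicator_def)
  qed
  have "p \<notin> \<int>\<^sub>\<le>\<^sub>0" using p by (auto elim!: nonpos_Ints_cases)
  have "(\<lambda>k. one_minus_powr_coeff \<beta> k * (LBINT v:{0<..<1}. g v * of_real v ^ k)) sums
      (LBINT v:{0<..<1}. g v * (1 - v) powr (\<beta> - 1))"
  proof (rule sums_set_integral_power_series[OF g])
    have "summable (\<lambda>k. u powr (- c) * \<bar>one_minus_powr_coeff \<beta> k / (p + real k)\<bar>)"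
      by (intro summable_mult Beta_partial_fractions_summable \<beta> \<open>p \<notin> \<int>\<^sub>\<le>\<^sub>0\<close>)
    then show "summable (\<lambda>k. norm (one_minus_powr_coeff \<beta> k) * (LBINT v:{0<..<1}. norm (g v) * v ^ k))"
    proof (rule summable_comparison_test'[where N = 0])
      fix k
      have "\<bar>one_minus_powr_coeff \<beta> k\<bar> * (LBINT v:{0<..<1}. norm (g v) * v ^ k) \<le> \<bar>one_minus_powr_coeff \<beta> k\<bar> * (u powr (- c) / (p + real k))"
        by (intro mult_left_mono bound) auto
      also have "\<dots> = u powr (- c) * \<bar>one_minus_powr_coeff \<beta> k / (p + real k)\<bar>"
        using p by (simp add: abs_divide)
      finally show "norm (norm (one_minus_powr_coeff \<beta> k) * (LBINT v:{0<..<1}. norm (g v) * v ^ k)) \<le> u powr (- c) * \<bar>one_minus_powr_coeff \<beta> k / (p + real k)\<bar>"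
        using nonneg[of k] by (simp only: real_norm_def abs_mult abs_abs abs_of_nonneg)
    qed
    show "(\<lambda>k. one_minus_powr_coeff \<beta> k * of_real v ^ k) sums (1 - v) powr (\<beta> - 1)" if "v \<in> {0<..<1}" for v
      using binomial_series_real[of v "1 - \<beta>"] that by (simp add: one_minus_powr_coeff_def)
  qed
  also have "(LBINT v:{0<..<1}. g v * (1 - v) powr (\<beta> - 1)) =
      (LBINT v:{0<..<1}. v powr (p - 1) * (1 - v) powr (\<beta> - 1) * (v + u) powr (- c))"
    by (simp add: g_def mult_ac)
  finally show ?thesis by (simp only: moment)
qed

text \<open>
  The Gamma quotients carry the powers \<open>u powr (p - c + k)\<close> and the partial fractions the powers \<open>u ^ j\<close>, so
  the two groups of terms belong to the two exponents \<open>p - c\<close> and 0 at the origin. If these differed by an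
  integer, individual partial fractions and Gamma factors would have poles.
\<close>
lemma Beta_integral_connection:
  fixes p \<beta> c u :: real
  assumes p: "p > 0" and \<beta>: "\<beta> > 0" and c: "c > 0" and u: "0 < u" "u < 1" and y: "p - c \<notin> \<int>"
  shows "complex_of_real (LBINT v:{0<..<1}. v powr (p - 1) * (1 - v) powr (\<beta> - 1) * (v + u) powr (- c)) =
     of_real (u powr (p - c) * (Gamma p * Gamma (c - p) / Gamma c)) *
       hyp2F1 (of_real p) (of_real (1 - \<beta>)) (of_real (1 + p - c)) (of_real (- u)) +
     of_real (Gamma (p - c) * Gamma \<beta> * rGamma (p - c + \<beta>)) *
       hyp2F1 (of_real c) (of_real (1 - (p - c + \<beta>))) (of_real (1 - (p - c))) (of_real (- u))"
proof -
  define y where "y = p - c"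
  have y: "y \<notin> \<int>" using y by (simp add: y_def)
  let ?I = "LBINT v:{0<..<1}. v powr (p - 1) * (1 - v) powr (\<beta> - 1) * (v + u) powr (- c)"
  define C1 where "C1 = u powr y * (Gamma p * Gamma (- y) / Gamma c)"
  define C2 where "C2 = Gamma y * Gamma \<beta> * rGamma (y + \<beta>)"
  define h1 where "h1 = (\<lambda>k. pochhammer p k * pochhammer (1 - \<beta>) k / (pochhammer (1 + y) k * fact k) * (- u) ^ k)"
  define h2 where "h2 = (\<lambda>j. pochhammer c j * pochhammer (1 - (y + \<beta>)) j / (pochhammer (1 - y) j * fact j) * (- u) ^ j)"
  define d where "d = (\<lambda>j. pochhammer c j / fact j * (- u) ^ j)"
  define D where "D = (\<lambda>k j. one_minus_powr_coeff \<beta> k * (d j / (y + real k - real j)))"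
  have shift: "y + real k \<notin> \<int>" "y - real k \<notin> \<int>" for k
    using y by (metis Ints_diff Ints_of_nat add_diff_cancel_right', metis Ints_add Ints_of_nat diff_add_cancel)
  have nonpos: "x \<notin> \<int> \<Longrightarrow> x \<notin> \<int>\<^sub>\<le>\<^sub>0" for x :: real using nonpos_Ints_Int by blast
  have Gc: "Gamma c \<noteq> 0" "Gamma p \<noteq> 0" "Gamma \<beta> \<noteq> 0" using Gamma_real_pos[OF p] Gamma_real_pos[OF c] Gamma_real_pos[OF \<beta>] by auto
  have Gy: "Gamma y \<noteq> 0" "Gamma (- y) \<noteq> 0"
    using nonpos[OF y] nonpos[of "- y"] y by (auto simp: Gamma_eq_zero_iff)
  have rows: "(\<lambda>j. D k j) sums (one_minus_powr_coeff \<beta> k * binomial_partial_fractions c (- u) (y + real k))" for k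
    unfolding D_def d_def using u shift by (intro sums_mult binomial_partial_fractions_sums) auto
  have cols: "(\<lambda>k. D k j) sums (C2 * h2 j)" for j
  proof -
    have "(\<lambda>k. d j * (one_minus_powr_coeff \<beta> k / (y - real j + real k))) sums (d j * (Gamma (y - real j) * Gamma \<beta> * rGamma (y - real j + \<beta>)))"
      by (intro sums_mult Beta_partial_fractions \<beta> nonpos shift)
    also have "(\<lambda>k. d j * (one_minus_powr_coeff \<beta> k / (y - real j + real k))) = (\<lambda>k. D k j)"
      by (auto simp: D_def algebra_simps)
    also have "y - real j + \<beta> = (y + \<beta>) - real j" by simp
    also have "d j * (Gamma (y - real j) * Gamma \<beta> * rGamma (y + \<beta> - real j)) = C2 * h2 j"
      unfolding Gamma_minus_nat rGamma_minus_nat C2_def h2_def d_def by (cases "even j") (simp_all add: mult_ac)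
    finally show ?thesis .
  qed
  obtain K where K: "K > 0" "\<And>k j :: nat. 1 / \<bar>y + real k - real j\<bar> \<le> K * (1 + real j) / real (Suc k)"
    by (rule shifted_denominator_bound[OF y]) blast
  have bound: "\<bar>D k j\<bar> \<le> (K * (\<bar>one_minus_powr_coeff \<beta> k\<bar> / real (Suc k))) * (\<bar>d j\<bar> * (1 + real j))" for k j
  proof -
    have "\<bar>D k j\<bar> = \<bar>one_minus_powr_coeff \<beta> k\<bar> * \<bar>d j\<bar> * (1 / \<bar>y + real k - real j\<bar>)"
      by (simp add: D_def abs_mult abs_divide)
    also have "\<dots> \<le> \<bar>one_minus_powr_coeff \<beta> k\<bar> * \<bar>d j\<bar> * (K * (1 + real j) / real (Suc k))"
      by (intro mult_left_mono K(2)) auto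
    finally show ?thesis by (simp add: mult_ac del: of_nat_Suc)
  qed
  have A: "summable (\<lambda>k. K * (\<bar>one_minus_powr_coeff \<beta> k\<bar> / real (Suc k)))"
    by (intro summable_mult one_minus_powr_coeff_summable \<beta>)
  have B: "summable (\<lambda>j. \<bar>d j\<bar> * (1 + real j))"
    unfolding d_def using u by (intro binomial_weighted_summable) auto
  note swap = double_series_swap[of D, OF bound A B]
  define S2 where "S2 = (\<Sum>j. C2 * h2 j)"
  have sums2: "(\<lambda>k. one_minus_powr_coeff \<beta> k * binomial_partial_fractions c (- u) (y + real k)) sums S2"
    using swap(1) by (simp only: sums_unique[OF rows, symmetric] sums_unique[OF cols, symmetric] S2_def)
  have "(\<lambda>j. C2 * h2 j) sums S2"
    using swap(2) unfolding S2_def by (simp only: sums_unique[OF cols, symmetric] summable_sums)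
  have S2: "complex_of_real S2 = of_real C2 * hyp2F1 (of_real c) (of_real (1 - (y + \<beta>))) (of_real (1 - y)) (of_real (- u))"
  \<comment> \<open>If the reciprocal Gamma factor vanishes, both sides are 0. Otherwise the double series may be divided
    by it, and this gives the sum of \<open>h2\<close>.\<close>
  proof (cases "C2 = 0")
    case True
    then show ?thesis by (simp add: S2_def)
  next
    case False
    from sums_divide[OF \<open>(\<lambda>j. C2 * h2 j) sums S2\<close>, of C2] have "h2 sums (S2 / C2)" using False by simp
    then have "hyp2F1 (of_real c) (of_real (1 - (y + \<beta>))) (of_real (1 - y)) (of_real (- u)) = of_real (S2 / C2)"
      using u unfolding h2_def by (intro hyp2F1_of_real) auto
    then show ?thesis using False by simp
  qed
  have term1: "one_minus_powr_coeff \<beta> k * (LBINT v:{0<..<1}. v powr (p + real k - 1) * (v + u) powr (- c)) =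
     C1 * h1 k + one_minus_powr_coeff \<beta> k * binomial_partial_fractions c (- u) (y + real k)" for k
  proof -
    have pk: "p + real k > 0" using p by simp
    have yk: "p + real k - c = y + real k" by (simp add: y_def)
    have ck: "c - (p + real k) = - y - real k" by (simp add: y_def)
    have "p \<notin> \<int>\<^sub>\<le>\<^sub>0" using p by (auto elim!: nonpos_Ints_cases)
    from pochhammer_Gamma[OF this, of k] have Gp: "Gamma (p + real k) = Gamma p * pochhammer p k"
      using Gc by simp
    have "u powr (y + real k) = u powr y * u ^ k" using u by (simp add: powr_add powr_realpow)
    then have "one_minus_powr_coeff \<beta> k * (u powr (y + real k) * (Gamma (p + real k) * Gamma (- y - real k) / Gamma c)) = C1 * h1 k"
      unfolding Gp Gamma_minus_nat C1_def h1_def one_minus_powr_coeff_def by (cases "even k") (simp_all add: mult_ac)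
    moreover have "(LBINT v:{0<..<1}. v powr (p + real k - 1) * (v + u) powr (- c)) =
       u powr (y + real k) * (Gamma (p + real k) * Gamma (- y - real k) / Gamma c) + binomial_partial_fractions c (- u) (y + real k)"
      using powr_shifted_integral[OF u pk c] shift(1)[of k] unfolding yk ck by blast
    ultimately show ?thesis by (simp only: distrib_left)
  qed
  from sums_diff[OF Beta_integral_expansion[OF p \<beta> c u(1)] sums2]
  have "(\<lambda>k. C1 * h1 k) sums (?I - S2)" unfolding term1 by simp
  moreover have C1: "C1 \<noteq> 0" unfolding C1_def using u Gc Gy by simp
  ultimately have "h1 sums ((?I - S2) / C1)"
    using sums_divide[of "\<lambda>k. C1 * h1 k" "?I - S2" C1] by simp
  then have "hyp2F1 (of_real p) (of_real (1 - \<beta>)) (of_real (1 + y)) (of_real (- u)) = of_real ((?I - S2) / C1)"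
    using u unfolding h1_def by (intro hyp2F1_of_real) auto
  then have "of_real C1 * hyp2F1 (of_real p) (of_real (1 - \<beta>)) (of_real (1 + y)) (of_real (- u)) = complex_of_real (?I - S2)"
    using C1 by (simp only: of_real_mult[symmetric] of_real_eq_iff) simp
  then have "complex_of_real ?I = of_real C1 * hyp2F1 (of_real p) (of_real (1 - \<beta>)) (of_real (1 + y)) (of_real (- u)) + of_real S2"
    by simp
  moreover have "- y = c - p" "1 + y = 1 + p - c" by (auto simp: y_def)
  ultimately show ?thesis unfolding S2 C1_def C2_def by (simp only: y_def)
qed

section \<open>The Meijer G-function in terms of integrals and hypergeometric functions\<close>

theorem theorem2p5:
  fixes \<alpha> \<beta> \<gamma> \<delta> u :: real
  assumes "\<alpha> > -1" and "\<gamma> > -1" and "\<beta> > 0" and "\<delta> > 0" and "u > 0"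
  shows
    "set_integrable lborel {u<..}
       (\<lambda>v. v powr (\<gamma> - \<alpha> - \<beta>) * (v - u) powr (\<beta> - 1) * (1 + v) powr (- (\<gamma> + 1 + \<delta>))) \<and>
     set_integrable lborel {0<..<1}
       (\<lambda>v. v powr (\<alpha> + \<delta>) * (1 - v) powr (\<beta> - 1) * (v + u) powr (- (\<gamma> + 1 + \<delta>))) \<and>
     meijer_G 2 1 [- of_real \<delta>, of_real (\<alpha> + \<beta>)] [of_real \<alpha>, of_real \<gamma>] u =
       of_real (Gamma (\<gamma> + 1 + \<delta>) / Gamma \<beta> * u powr \<alpha> *
         (LBINT v:{u<..}.
            v powr (\<gamma> - \<alpha> - \<beta>) * (v - u) powr (\<beta> - 1) * (1 + v) powr (- (\<gamma> + 1 + \<delta>)))) \<and>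
     meijer_G 2 1 [- of_real \<delta>, of_real (\<alpha> + \<beta>)] [of_real \<alpha>, of_real \<gamma>] u =
       of_real (Gamma (\<gamma> + 1 + \<delta>) / Gamma \<beta> * u powr \<gamma> *
         (LBINT v:{0<..<1}.
            v powr (\<alpha> + \<delta>) * (1 - v) powr (\<beta> - 1) * (v + u) powr (- (\<gamma> + 1 + \<delta>)))) \<and>
     (u < 1 \<and> (\<forall>\<nu>::nat. \<alpha> - \<gamma> \<noteq> real \<nu> \<and> \<alpha> - \<gamma> \<noteq> - real \<nu>) \<longrightarrow>
       meijer_G 2 1 [- of_real \<delta>, of_real (\<alpha> + \<beta>)] [of_real \<alpha>, of_real \<gamma>] u =
         of_real (Gamma (\<gamma> - \<alpha>) * Gamma (1 + \<delta> + \<alpha>) / Gamma \<beta> * u powr \<alpha>) *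
           hyp2F1 (of_real (1 + \<delta> + \<alpha>)) (of_real (1 - \<beta>)) (of_real (1 + \<alpha> - \<gamma>)) (of_real (- u)) +
         of_real (Gamma (\<alpha> - \<gamma>) * Gamma (1 + \<delta> + \<gamma>) * rGamma (\<alpha> + \<beta> - \<gamma>) * u powr \<gamma>) *
           hyp2F1 (of_real (1 + \<delta> + \<gamma>)) (of_real (1 + \<gamma> - \<alpha> - \<beta>)) (of_real (1 + \<gamma> - \<alpha>))
             (of_real (- u))) \<and>
     (1 \<le> u \<longrightarrow>
       meijer_G 2 1 [- of_real \<delta>, of_real (\<alpha> + \<beta>)] [of_real \<alpha>, of_real \<gamma>] u =
         of_real (Gamma (\<alpha> + 1 + \<delta>) * Gamma (\<gamma> + 1 + \<delta>) / Gamma (\<alpha> + \<beta> + 1 + \<delta>) *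
             u powr (- 1 - \<delta>)) *
           hyp2F1 (of_real (\<alpha> + 1 + \<delta>)) (of_real (\<gamma> + 1 + \<delta>)) (of_real (\<alpha> + \<beta> + 1 + \<delta>))
             (of_real (- 1 / u)))"
proof -
  let ?G = "meijer_G 2 1 [- of_real \<delta>, of_real (\<alpha> + \<beta>)] [of_real \<alpha>, of_real \<gamma>] u"
  note I = meijer_G_integrals[OF assms]
  define p c where "p = \<alpha> + 1 + \<delta>" and "c = \<gamma> + 1 + \<delta>"
  have p: "p > 0" and c: "c > 0" using assms by (auto simp: p_def c_def)
  define J where "J = (LBINT v:{0<..<1}. v powr (p - 1) * (1 - v) powr (\<beta> - 1) * (v + u) powr (- c))"
  have G: "?G = of_real (Gamma c / Gamma \<beta> * u powr \<gamma>) * of_real J"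
    unfolding I(4) J_def by (simp add: p_def c_def)
  have nz: "Gamma c \<noteq> 0" "Gamma \<beta> \<noteq> 0" "u \<noteq> 0"
    using Gamma_real_pos[OF c] Gamma_real_pos[OF assms(3)] assms(5) by auto
  have small: "?G = of_real (Gamma (\<gamma> - \<alpha>) * Gamma (1 + \<delta> + \<alpha>) / Gamma \<beta> * u powr \<alpha>) *
           hyp2F1 (of_real (1 + \<delta> + \<alpha>)) (of_real (1 - \<beta>)) (of_real (1 + \<alpha> - \<gamma>)) (of_real (- u)) +
         of_real (Gamma (\<alpha> - \<gamma>) * Gamma (1 + \<delta> + \<gamma>) * rGamma (\<alpha> + \<beta> - \<gamma>) * u powr \<gamma>) *
           hyp2F1 (of_real (1 + \<delta> + \<gamma>)) (of_real (1 + \<gamma> - \<alpha> - \<beta>)) (of_real (1 + \<gamma> - \<alpha>))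
             (of_real (- u))"
    if u1: "u < 1" and nonint: "\<forall>\<nu>::nat. \<alpha> - \<gamma> \<noteq> real \<nu> \<and> \<alpha> - \<gamma> \<noteq> - real \<nu>"
  proof -
    have "p - c \<notin> \<int>"
    proof
      assume "p - c \<in> \<int>"
      then obtain k where "p - c = of_int k" by (rule Ints_cases)
      then have "\<alpha> - \<gamma> = of_int k" by (simp add: p_def c_def)
      then show False using nonint by (cases k rule: int_cases2) auto
    qed
    note conn = Beta_integral_connection[OF p assms(3) c assms(5) u1 this, folded J_def]
    have params: "c - p = \<gamma> - \<alpha>" "p - c = \<alpha> - \<gamma>" "p = 1 + \<delta> + \<alpha>" "c = 1 + \<delta> + \<gamma>" "1 + p - c = 1 + \<alpha> - \<gamma>"
        "1 - (\<alpha> + \<beta> - \<gamma>) = 1 + \<gamma> - \<alpha> - \<beta>" "1 - (\<alpha> - \<gamma>) = 1 + \<gamma> - \<alpha>"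
        "\<alpha> - \<gamma> + \<beta> = \<alpha> + \<beta> - \<gamma>"
      by (auto simp: p_def c_def)
    define h1 where "h1 = hyp2F1 (of_real p) (of_real (1 - \<beta>)) (of_real (1 + p - c)) (of_real (- u))"
    define h2 where "h2 = hyp2F1 (of_real c) (of_real (1 - (p - c + \<beta>))) (of_real (1 - (p - c))) (of_real (- u))"
    have pw: "u powr \<gamma> * u powr (p - c) = u powr \<alpha>" by (simp add: p_def c_def flip: powr_add)
    have "Gamma c / Gamma \<beta> * u powr \<gamma> * (u powr (p - c) * (Gamma p * Gamma (c - p) / Gamma c)) =
        (u powr \<gamma> * u powr (p - c)) * (Gamma p * Gamma (c - p) / Gamma \<beta>)" using nz by simp
    then have c1: "Gamma c / Gamma \<beta> * u powr \<gamma> * (u powr (p - c) * (Gamma p * Gamma (c - p) / Gamma c)) =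
        Gamma (c - p) * Gamma p / Gamma \<beta> * u powr \<alpha>" unfolding pw by simp
    have c2: "Gamma c / Gamma \<beta> * u powr \<gamma> * (Gamma (p - c) * Gamma \<beta> * rGamma (p - c + \<beta>)) =
        Gamma (p - c) * Gamma c * rGamma (p - c + \<beta>) * u powr \<gamma>" using nz by simp
    have "?G = of_real (Gamma (c - p) * Gamma p / Gamma \<beta> * u powr \<alpha>) * h1 +
        of_real (Gamma (p - c) * Gamma c * rGamma (p - c + \<beta>) * u powr \<gamma>) * h2"
      unfolding G conn h1_def[symmetric] h2_def[symmetric] c1[symmetric] c2[symmetric]
      by (simp only: of_real_mult distrib_left mult.assoc)
    then show ?thesis
      unfolding h1_def h2_def by (simp only: params(1,2,5)) (simp only: params(3,4,6-8))
  qed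
  have large: "?G = of_real (Gamma (\<alpha> + 1 + \<delta>) * Gamma (\<gamma> + 1 + \<delta>) / Gamma (\<alpha> + \<beta> + 1 + \<delta>) *
             u powr (- 1 - \<delta>)) *
           hyp2F1 (of_real (\<alpha> + 1 + \<delta>)) (of_real (\<gamma> + 1 + \<delta>)) (of_real (\<alpha> + \<beta> + 1 + \<delta>))
             (of_real (- 1 / u))"
  proof -
    have pb: "p + \<beta> = \<alpha> + \<beta> + 1 + \<delta>" by (simp add: p_def)
    have "u powr \<gamma> * u powr (- c) = u powr (- 1 - \<delta>)" by (simp add: c_def flip: powr_add)
    moreover have "Gamma c / Gamma \<beta> * u powr \<gamma> * (u powr (- c) * Beta p \<beta>) =
        Gamma p * Gamma c / Gamma (p + \<beta>) * (u powr \<gamma> * u powr (- c))"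
      using nz by (simp add: Beta_def)
    ultimately have "Gamma c / Gamma \<beta> * u powr \<gamma> * (u powr (- c) * Beta p \<beta>) =
        Gamma p * Gamma c / Gamma (p + \<beta>) * u powr (- 1 - \<delta>)" by (simp only:)
    then have "?G = of_real (Gamma p * Gamma c / Gamma (p + \<beta>) * u powr (- 1 - \<delta>)) *
        hyp2F1 (of_real p) (of_real c) (of_real (p + \<beta>)) (of_real (- 1 / u))"
      unfolding G J_def Beta_integral_hyp2F1[OF p assms(3,5)] by (simp only: of_real_mult[symmetric] mult.assoc[symmetric])
    then show ?thesis by (simp only: pb) (simp only: p_def c_def)
  qed
  show ?thesis
    using I(1,2,3,4) small large by blast
qed

end
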